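(* Let $n\ge 1$ and $m=n+3$. The joint kernel $\mathcal{L}_m^\perp=\{u\in U\mathfrak{p}_m:\ l_{a,\kappa}(u)=0 \text{ for all formal polylogs } l_{a,\kappa}\}$ of the formal polylogs is the left ideal $$\mathcal{L}_{m}^\perp = U\mathfrak{p}_{m}\, s(\mathfrak{p}_{m-1}) + U\mathfrak{p}_{m}\,X_{\beta \omega} + \sum_{1\leq i<j \leq n} (X_{i\beta})(X_{j\beta}),$$ where $(X_{i\beta})\subset U\mathfrak{p}_{m}$ is the two-sided ideal of $U\mathfrak{p}_m$ generated by $X_{i\beta}$.
   Context: The ground field is $\mathbb{C}$; $n\ge1$, $m=n+3$, $\mathcal S=\{\alpha,1,\dots,n,\beta,\omega\}$. Lie algebras. $\mathfrak{p}_m$ is the Lie algebra with generators $X_{ab}=X_{ba}$ ($a\ne b$ in $\mathcal S$) and relations $\sum_{b\ne a}X_{ab}=0$ for each $a\in\mathcal S$, and $[X_{ab},X_{cd}]=0$ for $a,b,c,d$ all distinct. It is graded with $\deg X_{ab}=1$; a basis of its degree-one part is $X_{\alpha i},X_{i\beta}$ ($1\le i\le n$), $X_{ij}$ ($1\le i<j\le n$). $\mathfrak{p}_{m-1}$ is defined in the same way with index set $\mathcal S\setminus\{\beta\}=\{\alpha,1,\dots,n,\omega\}$. The map $\pi_\beta:\mathfrak p_m\to\mathfrak p_{m-1}$ sends $X_{\beta v}\mapsto 0$ and the other generators to the generators of the same name. It has a Lie algebra section $s:\mathfrak{p}_{m-1}\to\mathfrak{p}_m$ determined by $s(X_{\alpha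 i})=X_{\alpha i}$ ($1\le i\le n-1$), $s(X_{ij})=X_{ij}$ ($1\le i<j\le n$). $U\mathfrak g$ is the universal enveloping algebra, $(U\mathfrak{p}_m)^*$ is the graded dual, and $\varepsilon\in(U\mathfrak p_m)^*$ is the counit. Polylogarithms. Use coordinates $(x_1,\dots,x_n)$, $z_i=x_ix_{i+1}\cdots x_n$, $z_\beta=1$, and $\mathcal D=\{|x_i|<1\ \forall i\}$. For $N\ge 0$, $a=(a_1,\dots,a_N)\in\mathbb Z_{\ge1}^N$ and a non-decreasing $\kappa:\{1,\dots,N\}\to\{1,\dots,n\}$ put $\kappa(N+1):=\beta$, $y_{\kappa,i}=z_{\kappa(i)}/z_{\kappa(i+1)}$ and $$L_{a,\kappa}(x_1,\dots,x_n)=\sum_{0<k_1<\dots<k_N}\frac{y_{\kappa,1}^{k_1}\cdots y_{\kappa,N}^{k_N}}{k_1^{a_1}\cdots k_N^{a_N}},$$ with $L_\emptyset=1$ for $N=0$. Formal polylogs. For $\varphi\in(U\mathfrak p_m)^*$ and $X\in\mathfrak p_m$ of degree one let $\varphi_X(u):=\varphi(Xu)$. Let $\iota:(U\mathfrak p_m)^*\to\mathcal O(\mathcal D)[\log x_1,\dots,\log x_n]$ be the (Chen) iterated integral map from the tangential base point at $x=0$ in direction $(1,\dots,1)$, i.e. the unique linear map with $\iota(\varepsilon)=1$, $$d\,\iota(\varphi)=\sum_{i=1}^n\Big(\iota(\varphi_{X_{\alpha i}})\frac{dz_i}{z_i}+\iota(\varphi_{X_{i\beta}})\frac{dz_i}{z_i-1}\Big)+\sum_{i<j}\iota(\varphi_{X_{ij}})\frac{d(z_i-z_j)}{z_i-z_j},$$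 and such that for $\varphi$ homogeneous of positive degree the coefficient of $(\log x_1)^0\cdots(\log x_n)^0$ in $\iota(\varphi)$ vanishes at $x=0$. It is known that $\iota$ is injective and that every $L_{a,\kappa}$ is in its image. The formal polylog $l_{a,\kappa}\in(U\mathfrak p_m)^*$ is the unique element with $\iota(l_{a,\kappa})=L_{a,\kappa}$ (so $l_\emptyset=\varepsilon$), and $\mathcal L_m\subset(U\mathfrak p_m)^*$ is the span of all $l_{a,\kappa}$ ($N\ge0$). *)

theory Defs
  imports "HOL-Analysis.Analysis" "HOL-Library.Set_Algebras"
begin

section \<open>Complex vector spaces and complex Lie algebras\<close>

class complex_vec = ab_group_add +
  fixes scaleC :: "complex \<Rightarrow> 'a \<Rightarrow> 'a" (infixr "*\<^sub>C" 75)
  assumes scaleC_right_distrib: "a *\<^sub>C (x + y) = a *\<^sub>C x + a *\<^sub>C y"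
    and scaleC_left_distrib: "(a + b) *\<^sub>C x = a *\<^sub>C x + b *\<^sub>C x"
    and scaleC_scaleC: "a *\<^sub>C b *\<^sub>C x = (a * b) *\<^sub>C x"
    and scaleC_one: "1 *\<^sub>C x = x"

interpretation cvec: vector_space "scaleC :: complex \<Rightarrow> 'a \<Rightarrow> 'a::complex_vec"
  by unfold_locales
    (simp_all add: scaleC_right_distrib scaleC_left_distrib scaleC_scaleC scaleC_one)

class complex_lie = complex_vec +
  fixes lie_bracket :: "'a \<Rightarrow> 'a \<Rightarrow> 'a"
  assumes lie_add_left: "lie_bracket (x + y) z = lie_bracket x z + lie_bracket y z"
    and lie_add_right: "lie_bracket x (y + z) = lie_bracket x y + lie_bracket x z"
    and lie_scale_left: "lie_bracket (a *\<^sub>C x) y = a *\<^sub>C lie_bracket x y"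
    and lie_scale_right: "lie_bracket x (a *\<^sub>C y) = a *\<^sub>C lie_bracket x y"
    and lie_self: "lie_bracket x x = 0"
    and lie_jacobi: "lie_bracket x (lie_bracket y z) + lie_bracket y (lie_bracket z x)
      + lie_bracket z (lie_bracket x y) = 0"

definition lie_hom :: "('a::complex_lie \<Rightarrow> 'b::complex_lie) \<Rightarrow> bool" where
  "lie_hom f \<longleftrightarrow> Vector_Spaces.linear scaleC scaleC f \<and>
     (\<forall>x y. f (lie_bracket x y) = lie_bracket (f x) (f y))"


section \<open>The Lie algebra with generators \<open>X\<^sub>a\<^sub>b\<close>\<close>

datatype 'v lterm =
    LGen 'v 'v
  | LZero
  | LAdd "'v lterm" "'v lterm"
  | LScale complex "'v lterm"
  | LBr "'v lterm" "'v lterm"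

text \<open>The least congruence on formal Lie expressions that contains the axioms of a complex Lie
  algebra and the defining relations.  A symbol \<open>LGen a b\<close> exists for every pair; \<open>gen_sym\<close>
  imposes \<open>X\<^sub>a\<^sub>b = X\<^sub>b\<^sub>a\<close>, and \<open>gen_diag\<close> discards the superfluous symbols with \<open>a = b\<close>.\<close>

inductive lie_eq :: "'v lterm \<Rightarrow> 'v lterm \<Rightarrow> bool" where
  refl: "lie_eq t t"
| sym: "lie_eq t u \<Longrightarrow> lie_eq u t"
| trans: "lie_eq t u \<Longrightarrow> lie_eq u v \<Longrightarrow> lie_eq t v"
| cong_add: "lie_eq t t' \<Longrightarrow> lie_eq u u' \<Longrightarrow> lie_eq (LAdd t u) (LAdd t' u')"
| cong_scale: "lie_eq t t' \<Longrightarrow> lie_eq (LScale c t) (LScale c t')"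
| cong_br: "lie_eq t t' \<Longrightarrow> lie_eq u u' \<Longrightarrow> lie_eq (LBr t u) (LBr t' u')"
| add_assoc: "lie_eq (LAdd (LAdd t u) v) (LAdd t (LAdd u v))"
| add_comm: "lie_eq (LAdd t u) (LAdd u t)"
| add_zero: "lie_eq (LAdd LZero t) t"
| add_neg: "lie_eq (LAdd (LScale (-1) t) t) LZero"
| scale_add_right: "lie_eq (LScale c (LAdd t u)) (LAdd (LScale c t) (LScale c u))"
| scale_add_left: "lie_eq (LScale (c + d) t) (LAdd (LScale c t) (LScale d t))"
| scale_scale: "lie_eq (LScale c (LScale d t)) (LScale (c * d) t)"
| scale_one: "lie_eq (LScale 1 t) t"
| br_add_left: "lie_eq (LBr (LAdd t u) v) (LAdd (LBr t v) (LBr u v))"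
| br_add_right: "lie_eq (LBr t (LAdd u v)) (LAdd (LBr t u) (LBr t v))"
| br_scale_left: "lie_eq (LBr (LScale c t) u) (LScale c (LBr t u))"
| br_scale_right: "lie_eq (LBr t (LScale c u)) (LScale c (LBr t u))"
| br_self: "lie_eq (LBr t t) LZero"
| br_jacobi: "lie_eq (LAdd (LAdd (LBr t (LBr u v)) (LBr u (LBr v t))) (LBr v (LBr t u))) LZero"
| gen_sym: "lie_eq (LGen a b) (LGen b a)"
| gen_diag: "lie_eq (LGen a a) LZero"
| gen_sum: "distinct bs \<Longrightarrow> set bs = UNIV - {a} \<Longrightarrow>
    lie_eq (foldr LAdd (map (LGen a) bs) LZero) LZero"
| gen_comm: "distinct [a, b, c, d] \<Longrightarrow> lie_eq (LBr (LGen a b) (LGen c d)) LZero"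

lemma equivp_lie_eq: "equivp lie_eq"
  by (intro equivpI reflpI sympI transpI) (fact lie_eq.refl, erule lie_eq.sym, erule (1) lie_eq.trans)

quotient_type 'v sbraid = "'v::finite lterm" / lie_eq
  by (rule equivp_lie_eq)

instantiation sbraid :: (finite) complex_lie
begin

lift_definition zero_sbraid :: "'a sbraid" is LZero .
lift_definition plus_sbraid :: "'a sbraid \<Rightarrow> 'a sbraid \<Rightarrow> 'a sbraid" is LAdd
  by (rule lie_eq.cong_add)
lift_definition uminus_sbraid :: "'a sbraid \<Rightarrow> 'a sbraid" is "LScale (-1)"
  by (rule lie_eq.cong_scale)
lift_definition minus_sbraid :: "'a sbraid \<Rightarrow> 'a sbraid \<Rightarrow> 'a sbraid" is
  "\<lambda>t u. LAdd t (LScale (-1) u)"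
  by (intro lie_eq.cong_add lie_eq.cong_scale)
lift_definition scaleC_sbraid :: "complex \<Rightarrow> 'a sbraid \<Rightarrow> 'a sbraid" is LScale
  by (rule lie_eq.cong_scale)
lift_definition lie_bracket_sbraid :: "'a sbraid \<Rightarrow> 'a sbraid \<Rightarrow> 'a sbraid" is LBr
  by (rule lie_eq.cong_br)

instance
proof (standard; transfer)
qed (rule lie_eq.add_assoc lie_eq.add_comm lie_eq.add_zero lie_eq.add_neg
    lie_eq.scale_add_right lie_eq.scale_add_left lie_eq.scale_scale lie_eq.scale_one
    lie_eq.br_add_left lie_eq.br_add_right lie_eq.br_scale_left lie_eq.br_scale_right
    lie_eq.br_self lie_eq.br_jacobi lie_eq.refl)+

end

lift_definition Xgen :: "'v::finite \<Rightarrow> 'v \<Rightarrow> 'v sbraid" is LGen .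

lemma Xgen_sym: "Xgen a b = Xgen b a"
  by transfer (rule lie_eq.gen_sym)

lemma Xgen_diag: "Xgen a a = 0"
  by transfer (rule lie_eq.gen_diag)

lemma Xgen_comm: "distinct [a, b, c, d] \<Longrightarrow> lie_bracket (Xgen a b) (Xgen c d) = 0"
  by transfer (rule lie_eq.gen_comm)

lemma abs_foldr_LAdd: "abs_sbraid (foldr LAdd ts LZero) = sum_list (map abs_sbraid ts)"
  by (induction ts) (simp_all add: zero_sbraid.abs_eq plus_sbraid.abs_eq [symmetric])

lemma Xgen_sum: "(\<Sum>b\<in>UNIV - {a}. Xgen a b) = 0"
proof -
  obtain bs where bs: "set bs = UNIV - {a}" "distinct bs"
    using finite_distinct_list [of "UNIV - {a}"] by auto
  have "abs_sbraid (foldr LAdd (map (LGen a) bs) LZero) = 0"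
    using lie_eq.gen_sum [OF bs(2,1)] by (simp add: zero_sbraid_def sbraid.abs_eq_iff)
  then have "sum_list (map (Xgen a) bs) = 0"
    by (simp add: abs_foldr_LAdd Xgen.abs_eq [abs_def] o_def)
  then show ?thesis
    using bs by (simp add: sum_list_distinct_conv_sum_set)
qed

text \<open>Evaluation of Lie expressions in a Lie algebra; it factors through the quotient when the
  images of the generators satisfy the relations.\<close>

primrec lie_eval :: "('v \<Rightarrow> 'v \<Rightarrow> 'a::complex_lie) \<Rightarrow> 'v lterm \<Rightarrow> 'a" where
  "lie_eval f (LGen a b) = f a b"
| "lie_eval f LZero = 0"
| "lie_eval f (LAdd t u) = lie_eval f t + lie_eval f u"
| "lie_eval f (LScale c t) = c *\<^sub>C lie_eval f t"
| "lie_eval f (LBr t u) = lie_bracket (lie_eval f t) (lie_eval f u)"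

lemma lie_eval_foldr: "lie_eval f (foldr LAdd ts LZero) = sum_list (map (lie_eval f) ts)"
  by (induction ts) simp_all

lemma lie_eval_cong:
  fixes f :: "'v::finite \<Rightarrow> 'v \<Rightarrow> 'a::complex_lie"
  assumes "lie_eq t u"
    and "\<And>a b. f a b = f b a" "\<And>a. f a a = 0" "\<And>a. (\<Sum>b\<in>UNIV - {a}. f a b) = 0"
    and "\<And>a b c d. distinct [a, b, c, d] \<Longrightarrow> lie_bracket (f a b) (f c d) = 0"
  shows "lie_eval f t = lie_eval f u"
  using assms(1)
proof induction
  case (gen_sum bs a)
  have "lie_eval f (foldr LAdd (map (LGen a) bs) LZero) = (\<Sum>b\<leftarrow>bs. f a b)"
    by (simp add: lie_eval_foldr o_def)
  also have "\<dots> = (\<Sum>b\<in>UNIV - {a}. f a b)"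
    using gen_sum by (metis sum_list_distinct_conv_sum_set)
  finally show ?case
    using assms(4) by simp
next
  case (gen_comm a b c d)
  then show ?case
    using assms(5) [of a b c d] by simp
next
  case (gen_sym a b)
  show ?case
    unfolding lie_eval.simps by (rule assms(2))
next
  case (add_comm t u)
  then show ?case
    by (simp add: add.commute)
next
  case (br_jacobi t u v)
  then show ?case
    using lie_jacobi by simp
qed (simp_all add: assms(3) add.assoc scaleC_right_distrib scaleC_left_distrib
    scaleC_scaleC scaleC_one lie_add_left lie_add_right lie_scale_left lie_scale_right lie_self)


section \<open>The index sets, the projection and its section\<close>

text \<open>The indices \<open>1, \<dots>, n\<close> are the elements of a finite linearly ordered type \<open>'n\<close>.  The type
  \<open>'n marks\<close> is \<open>{\<alpha>, 1, \<dots>, n, \<omega>}\<close>, and \<open>'n marks option\<close> is the full index set, \<open>None\<close> being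
  \<open>\<beta>\<close>.\<close>

datatype 'n marks = Alpha | Pt 'n | Omega

instance marks :: (finite) finite
proof
  have "(UNIV :: 'a marks set) = insert Alpha (insert Omega (range Pt))"
    using marks.exhaust by auto
  then show "finite (UNIV :: 'a marks set)"
    by (metis finite.insertI finite_imageI finite)
qed

type_synonym 'n p_full = "'n marks option sbraid"
type_synonym 'n p_sub = "'n marks sbraid"

abbreviation al :: "'n marks option" where "al \<equiv> Some Alpha"
abbreviation pt :: "'n \<Rightarrow> 'n marks option" where "pt i \<equiv> Some (Pt i)"
abbreviation be :: "'n marks option" where "be \<equiv> None"
abbreviation om :: "'n marks option" where "om \<equiv> Some Omega"

primrec pi_gen :: "'n::finite marks option \<Rightarrow> 'n marks option \<Rightarrow> 'n p_sub" where
  "pi_gen None b = 0"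
| "pi_gen (Some a) b = (case b of None \<Rightarrow> 0 | Some b' \<Rightarrow> Xgen a b')"

lift_definition pi_beta :: "'n::finite p_full \<Rightarrow> 'n p_sub" is "lie_eval pi_gen"
proof (erule lie_eval_cong)
  show "pi_gen a b = pi_gen b a" for a b :: "'n marks option"
    by (cases a; cases b) (simp_all add: Xgen_sym)
  show "pi_gen a a = 0" for a :: "'n marks option"
    by (cases a) (simp_all add: Xgen_diag)
  show "(\<Sum>b\<in>UNIV - {a}. pi_gen a b) = 0" for a :: "'n marks option"
  proof (cases a)
    case (Some a')
    have "UNIV - {a} = insert None (Some ` (UNIV - {a'}))"
      using Some by (auto simp: image_iff UNIV_option_conv)
    then show ?thesis
      using Some by (simp add: sum.reindex Xgen_sum)
  qed simp
  show "lie_bracket (pi_gen a b) (pi_gen c d) = 0"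
    if "distinct [a, b, c, d]" for a b c d :: "'n marks option"
  proof -
    have "lie_bracket 0 x = 0" "lie_bracket x 0 = 0" for x :: "'n p_sub"
      using lie_scale_left [of 0 0 x] lie_scale_right [of x 0 0] by simp_all
    then show ?thesis
      using that by (cases a; cases b; cases c; cases d) (simp_all add: Xgen_comm)
  qed
qed

definition beta_section :: "('n::{finite,linorder} p_sub \<Rightarrow> 'n p_full) \<Rightarrow> bool" where
  "beta_section s \<longleftrightarrow> lie_hom s \<and> pi_beta \<circ> s = id \<and>
     (\<forall>i. i < Max UNIV \<longrightarrow> s (Xgen Alpha (Pt i)) = Xgen al (pt i)) \<and>
     (\<forall>i j. i < j \<longrightarrow> s (Xgen (Pt i) (Pt j)) = Xgen (pt i) (pt j))"


section \<open>The universal enveloping algebra\<close>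

datatype 'g uterm =
    UEmb 'g
  | UZero
  | UOne
  | UAdd "'g uterm" "'g uterm"
  | UScale complex "'g uterm"
  | UMul "'g uterm" "'g uterm"

text \<open>The least congruence on formal algebra expressions over a Lie algebra \<open>\<gg>\<close> that contains the
  axioms of a unital associative complex algebra, linearity of \<open>\<gg> \<rightarrow> U\<gg>\<close> and
  \<open>[x, y] = x y - y x\<close>.\<close>

inductive uea_eq :: "'g::complex_lie uterm \<Rightarrow> 'g uterm \<Rightarrow> bool" where
  refl: "uea_eq t t"
| sym: "uea_eq t u \<Longrightarrow> uea_eq u t"
| trans: "uea_eq t u \<Longrightarrow> uea_eq u v \<Longrightarrow> uea_eq t v"
| cong_add: "uea_eq t t' \<Longrightarrow> uea_eq u u' \<Longrightarrow> uea_eq (UAdd t u) (UAdd t' u')"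
| cong_scale: "uea_eq t t' \<Longrightarrow> uea_eq (UScale c t) (UScale c t')"
| cong_mul: "uea_eq t t' \<Longrightarrow> uea_eq u u' \<Longrightarrow> uea_eq (UMul t u) (UMul t' u')"
| add_assoc: "uea_eq (UAdd (UAdd t u) v) (UAdd t (UAdd u v))"
| add_comm: "uea_eq (UAdd t u) (UAdd u t)"
| add_zero: "uea_eq (UAdd UZero t) t"
| add_neg: "uea_eq (UAdd (UScale (-1) t) t) UZero"
| scale_add_right: "uea_eq (UScale c (UAdd t u)) (UAdd (UScale c t) (UScale c u))"
| scale_add_left: "uea_eq (UScale (c + d) t) (UAdd (UScale c t) (UScale d t))"
| scale_scale: "uea_eq (UScale c (UScale d t)) (UScale (c * d) t)"
| scale_one: "uea_eq (UScale 1 t) t"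
| mul_assoc: "uea_eq (UMul (UMul t u) v) (UMul t (UMul u v))"
| mul_one_left: "uea_eq (UMul UOne t) t"
| mul_one_right: "uea_eq (UMul t UOne) t"
| mul_add_left: "uea_eq (UMul (UAdd t u) v) (UAdd (UMul t v) (UMul u v))"
| mul_add_right: "uea_eq (UMul t (UAdd u v)) (UAdd (UMul t u) (UMul t v))"
| mul_scale_left: "uea_eq (UMul (UScale c t) u) (UScale c (UMul t u))"
| mul_scale_right: "uea_eq (UMul t (UScale c u)) (UScale c (UMul t u))"
| emb_add: "uea_eq (UEmb (x + y)) (UAdd (UEmb x) (UEmb y))"
| emb_scale: "uea_eq (UEmb (c *\<^sub>C x)) (UScale c (UEmb x))"
| emb_bracket: "uea_eq (UEmb (lie_bracket x y))
    (UAdd (UMul (UEmb x) (UEmb y)) (UScale (-1) (UMul (UEmb y) (UEmb x))))"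

lemma equivp_uea_eq: "equivp uea_eq"
  by (intro equivpI reflpI sympI transpI) (fact uea_eq.refl, erule uea_eq.sym, erule (1) uea_eq.trans)

quotient_type (overloaded) 'g uea = "'g::complex_lie uterm" / uea_eq
  by (rule equivp_uea_eq)

primrec counit_term :: "'g uterm \<Rightarrow> complex" where
  "counit_term (UEmb x) = 0"
| "counit_term UZero = 0"
| "counit_term UOne = 1"
| "counit_term (UAdd t u) = counit_term t + counit_term u"
| "counit_term (UScale c t) = c * counit_term t"
| "counit_term (UMul t u) = counit_term t * counit_term u"

lemma counit_term_cong: "uea_eq t u \<Longrightarrow> counit_term t = counit_term u"
  by (induction rule: uea_eq.induct) (simp_all add: algebra_simps)

lift_definition counit :: "'g::complex_lie uea \<Rightarrow> complex" is counit_term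
  by (rule counit_term_cong)

instantiation uea :: (complex_lie) "{complex_vec, ring_1}"
begin

lift_definition zero_uea :: "'a uea" is UZero .
lift_definition one_uea :: "'a uea" is UOne .
lift_definition plus_uea :: "'a uea \<Rightarrow> 'a uea \<Rightarrow> 'a uea" is UAdd
  by (rule uea_eq.cong_add)
lift_definition uminus_uea :: "'a uea \<Rightarrow> 'a uea" is "UScale (-1)"
  by (rule uea_eq.cong_scale)
lift_definition minus_uea :: "'a uea \<Rightarrow> 'a uea \<Rightarrow> 'a uea" is
  "\<lambda>t u. UAdd t (UScale (-1) u)"
  by (intro uea_eq.cong_add uea_eq.cong_scale)
lift_definition scaleC_uea :: "complex \<Rightarrow> 'a uea \<Rightarrow> 'a uea" is UScale
  by (rule uea_eq.cong_scale)
lift_definition times_uea :: "'a uea \<Rightarrow> 'a uea \<Rightarrow> 'a uea" is UMul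
  by (rule uea_eq.cong_mul)

instance
proof
  show "(0 :: 'a uea) \<noteq> 1"
    by transfer (use counit_term_cong in fastforce)
qed (transfer; rule uea_eq.add_assoc uea_eq.add_comm uea_eq.add_zero uea_eq.add_neg
    uea_eq.scale_add_right uea_eq.scale_add_left uea_eq.scale_scale uea_eq.scale_one
    uea_eq.mul_assoc uea_eq.mul_one_left uea_eq.mul_one_right uea_eq.mul_add_left
    uea_eq.mul_add_right uea_eq.refl)+

end

lift_definition emb :: "'g::complex_lie \<Rightarrow> 'g uea" is UEmb .

lemma scaleC_mult_left: "(c *\<^sub>C u) * v = c *\<^sub>C (u * (v :: 'g::complex_lie uea))"
  by transfer (rule uea_eq.mul_scale_left)

lemma scaleC_mult_right: "u * (c *\<^sub>C v) = c *\<^sub>C (u * (v :: 'g::complex_lie uea))"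
  by transfer (rule uea_eq.mul_scale_right)

lemma emb_add: "emb (x + y) = emb x + emb y"
  by transfer (rule uea_eq.emb_add)

lemma emb_scaleC: "emb (c *\<^sub>C x) = c *\<^sub>C emb x"
  by transfer (rule uea_eq.emb_scale)

lemma emb_bracket: "emb (lie_bracket x y) = emb x * emb y - emb y * emb x"
  by transfer (rule uea_eq.emb_bracket)

lemma counit_simps:
  "counit 0 = 0" "counit 1 = 1" "counit (u + v) = counit u + counit v"
  "counit (c *\<^sub>C u) = c * counit u" "counit (u * v) = counit u * counit v" "counit (emb x) = 0"
  by (transfer, simp)+

abbreviation XU :: "'v::finite \<Rightarrow> 'v \<Rightarrow> 'v sbraid uea" where
  "XU a b \<equiv> emb (Xgen a b)"


section \<open>Ideals\<close>

definition left_ideal :: "'g::complex_lie uea set \<Rightarrow> bool" where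
  "left_ideal I \<longleftrightarrow> cvec.subspace I \<and> (\<forall>u. \<forall>x\<in>I. u * x \<in> I)"

definition two_sided_ideal :: "'g::complex_lie uea set \<Rightarrow> bool" where
  "two_sided_ideal I \<longleftrightarrow> cvec.subspace I \<and> (\<forall>u. \<forall>x\<in>I. u * x \<in> I \<and> x * u \<in> I)"

definition gen_ideal :: "'g::complex_lie uea \<Rightarrow> 'g uea set" where
  "gen_ideal x = two_sided_ideal hull {x}"

text \<open>The product of two linear subspaces of the algebra, as usual the span of the products (the
  operation \<open>*\<close> on sets is only the set of products).\<close>

definition span_prod :: "'g::complex_lie uea set \<Rightarrow> 'g uea set \<Rightarrow> 'g uea set" where
  "span_prod A B = cvec.span {a * b | a b. a \<in> A \<and> b \<in> B}"


section \<open>The graded dual\<close>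

text \<open>Since \<open>U\<close> is generated by the \<open>X\<^sub>a\<^sub>b\<close>, which have degree one, its part of degree \<open>k\<close> is spanned
  by the products of \<open>k\<close> of them.\<close>

definition U_deg :: "nat \<Rightarrow> 'v::finite sbraid uea set" where
  "U_deg k = cvec.span {prod_list (map (\<lambda>(a, b). XU a b) w) | w. length w = k}"

definition graded_dual :: "('v::finite sbraid uea \<Rightarrow> complex) set" where
  "graded_dual = {\<phi>. Vector_Spaces.linear scaleC (*) \<phi> \<and> finite {k. \<exists>u\<in>U_deg k. \<phi> u \<noteq> 0}}"

definition homogeneous_dual :: "nat \<Rightarrow> ('v::finite sbraid uea \<Rightarrow> complex) set" where
  "homogeneous_dual d = {\<phi>\<in>graded_dual. \<forall>k. k \<noteq> d \<longrightarrow> (\<forall>u\<in>U_deg k. \<phi> u = 0)}"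

definition contract ::
  "('v::finite sbraid uea \<Rightarrow> complex) \<Rightarrow> 'v \<Rightarrow> 'v \<Rightarrow> 'v sbraid uea \<Rightarrow> complex" where
  "contract \<phi> a b = (\<lambda>u. \<phi> (XU a b * u))"


section \<open>Functions on the polydisc and polynomials in logarithms\<close>

definition polydisc :: "(complex ^ 'n) set" where
  "polydisc = {x. \<forall>i. norm (x $ i) < 1}"

text \<open>Holomorphic functions on the polydisc, extended by zero to the whole space so that they are
  determined by their values on the polydisc.\<close>

definition holo_polydisc :: "(complex ^ 'n::finite \<Rightarrow> complex) set" where
  "holo_polydisc = {f.
     (\<forall>x\<in>polydisc. \<exists>c. (f has_derivative (\<lambda>h. \<Sum>i\<in>UNIV. c $ i * h $ i)) (at x)) \<and>
     (\<forall>x. x \<notin> polydisc \<longrightarrow> f x = 0)}"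

text \<open>\<open>F p\<close> is the coefficient of the monomial \<open>\<Prod>i. (log x\<^sub>i) ^ p i\<close>; the logarithms are treated
  as independent variables over the holomorphic functions.\<close>

type_synonym 'n logpoly = "('n \<Rightarrow> nat) \<Rightarrow> complex ^ 'n \<Rightarrow> complex"

definition logpolys :: "'n::finite logpoly set" where
  "logpolys = {F. (\<forall>p. F p \<in> holo_polydisc) \<and> finite {p. F p \<noteq> (\<lambda>_. 0)}}"

definition of_holo :: "(complex ^ 'n::finite \<Rightarrow> complex) \<Rightarrow> 'n logpoly" where
  "of_holo f = (\<lambda>p x. if p = (\<lambda>_. 0) \<and> x \<in> polydisc then f x else 0)"

definition pderiv_at :: "'n::finite \<Rightarrow> (complex ^ 'n \<Rightarrow> complex) \<Rightarrow> complex ^ 'n \<Rightarrow> complex" where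
  "pderiv_at k f x = deriv (\<lambda>t. f (\<chi> j. if j = k then t else x $ j)) (x $ k)"

text \<open>The coefficient of \<open>dx\<^sub>k\<close> in \<open>dF\<close>, again as a polynomial in the logarithms; the second term
  comes from \<open>d (log x\<^sub>k) = dx\<^sub>k / x\<^sub>k\<close>.\<close>

definition logpoly_deriv :: "'n::finite \<Rightarrow> 'n logpoly \<Rightarrow> 'n logpoly" where
  "logpoly_deriv k F = (\<lambda>p x. pderiv_at k (F p) x
     + of_nat (p k + 1) * F (p(k := p k + 1)) x / x $ k)"

text \<open>The coefficient of \<open>dx\<^sub>k\<close> in \<open>df / f\<close>.\<close>

definition dlog_coeff :: "'n::finite \<Rightarrow> (complex ^ 'n \<Rightarrow> complex) \<Rightarrow> complex ^ 'n \<Rightarrow> complex" where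
  "dlog_coeff k f x = pderiv_at k f x / f x"

definition zcoord :: "'n \<Rightarrow> complex ^ 'n::{finite,linorder} \<Rightarrow> complex" where
  "zcoord i x = (\<Prod>j\<in>{i..}. x $ j)"


section \<open>The iterated integral map\<close>

text \<open>The differential equation is an identity of one-forms on the part of the polydisc where no
  coordinate vanishes, with coefficients that are polynomials in the logarithms.  Nothing is
  required of \<open>\<iota>\<close> outside the graded dual.\<close>

definition iterated_integral_map ::
  "(('n::{finite,linorder} p_full uea \<Rightarrow> complex) \<Rightarrow> 'n logpoly) \<Rightarrow> bool" where
  "iterated_integral_map \<iota> \<longleftrightarrow>
     \<iota> ` graded_dual \<subseteq> logpolys \<and>
     (\<forall>\<phi>\<in>graded_dual. \<forall>\<psi>\<in>graded_dual. \<iota> (\<lambda>u. \<phi> u + \<psi> u) = (\<lambda>p x. \<iota> \<phi> p x + \<iota> \<psi> p x)) \<and>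
     (\<forall>\<phi>\<in>graded_dual. \<forall>c. \<iota> (\<lambda>u. c * \<phi> u) = (\<lambda>p x. c * \<iota> \<phi> p x)) \<and>
     \<iota> counit = of_holo (\<lambda>_. 1) \<and>
     (\<forall>\<phi>\<in>graded_dual. \<forall>k p. \<forall>x\<in>polydisc. (\<forall>i. x $ i \<noteq> 0) \<longrightarrow>
        logpoly_deriv k (\<iota> \<phi>) p x =
          (\<Sum>i\<in>UNIV. \<iota> (contract \<phi> al (pt i)) p x * dlog_coeff k (zcoord i) x
                   + \<iota> (contract \<phi> (pt i) be) p x * dlog_coeff k (\<lambda>y. zcoord i y - 1) x)
          + (\<Sum>(i, j)\<in>{(i, j). i < j}.
               \<iota> (contract \<phi> (pt i) (pt j)) p x * dlog_coeff k (\<lambda>y. zcoord i y - zcoord j y) x)) \<and>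
     (\<forall>d>0. \<forall>\<phi>\<in>homogeneous_dual d. \<iota> \<phi> (\<lambda>_. 0) 0 = 0)"


section \<open>Polylogarithms\<close>

text \<open>Index data \<open>(a, \<kappa>)\<close> are pairs of lists of the same length \<open>N\<close>, numbered from zero.\<close>

definition polylog_index :: "nat list \<Rightarrow> 'n::linorder list \<Rightarrow> bool" where
  "polylog_index a \<kappa> \<longleftrightarrow> length a = length \<kappa> \<and> (\<forall>r\<in>set a. 1 \<le> r) \<and> sorted \<kappa>"

text \<open>\<open>z\<^sub>\<kappa>\<^sub>(\<^sub>i\<^sub>) / z\<^sub>\<kappa>\<^sub>(\<^sub>i\<^sub>+\<^sub>1\<^sub>)\<close> with \<open>z\<^sub>\<beta> = 1\<close>, written as a monomial in the coordinates because the
  quotient of values is not meaningful where a coordinate vanishes.\<close>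

definition ykap :: "'n list \<Rightarrow> nat \<Rightarrow> complex ^ 'n::{finite,linorder} \<Rightarrow> complex" where
  "ykap \<kappa> i x = (if Suc i < length \<kappa> then \<Prod>j\<in>{\<kappa> ! i ..< \<kappa> ! Suc i}. x $ j else zcoord (\<kappa> ! i) x)"

lemma ykap_eq_quotient:
  assumes "sorted \<kappa>" "Suc i < length \<kappa>" "\<And>j. x $ j \<noteq> 0"
  shows "ykap \<kappa> i x = zcoord (\<kappa> ! i) x / zcoord (\<kappa> ! Suc i) x"
proof -
  have "\<kappa> ! i \<le> \<kappa> ! Suc i"
    using assms by (simp add: sorted_nth_mono)
  then have "{\<kappa> ! i ..} = {\<kappa> ! i ..< \<kappa> ! Suc i} \<union> {\<kappa> ! Suc i ..}"
    by auto
  moreover have "zcoord (\<kappa> ! Suc i) x \<noteq> 0"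
    using assms by (simp add: zcoord_def)
  moreover have "{\<kappa> ! i ..< \<kappa> ! Suc i} \<inter> {\<kappa> ! Suc i ..} = {}"
    by auto
  ultimately have "zcoord (\<kappa> ! i) x = (\<Prod>j\<in>{\<kappa> ! i ..< \<kappa> ! Suc i}. x $ j) * zcoord (\<kappa> ! Suc i) x"
    unfolding zcoord_def by (metis finite prod.union_disjoint)
  with \<open>zcoord (\<kappa> ! Suc i) x \<noteq> 0\<close> show ?thesis
    using assms(2) by (simp add: ykap_def)
qed

definition polylog :: "nat list \<Rightarrow> 'n list \<Rightarrow> complex ^ 'n::{finite,linorder} \<Rightarrow> complex" where
  "polylog a \<kappa> x =
     (\<Sum>\<^sub>\<infinity>k\<in>{k. length k = length a \<and> sorted_wrt (<) k \<and> (\<forall>r\<in>set k. 0 < r)}.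
        \<Prod>i<length a. ykap \<kappa> i x ^ (k ! i) / of_nat (k ! i) ^ (a ! i))"

definition formal_polylog ::
  "(('n::{finite,linorder} p_full uea \<Rightarrow> complex) \<Rightarrow> 'n logpoly) \<Rightarrow> nat list \<Rightarrow> 'n list \<Rightarrow>
     'n p_full uea \<Rightarrow> complex" where
  "formal_polylog \<iota> a \<kappa> = (THE \<phi>. \<phi> \<in> graded_dual \<and> \<iota> \<phi> = of_holo (polylog a \<kappa>))"

definition polylog_perp ::
  "(('n::{finite,linorder} p_full uea \<Rightarrow> complex) \<Rightarrow> 'n logpoly) \<Rightarrow> 'n p_full uea set" where
  "polylog_perp \<iota> = {u. \<forall>a \<kappa>. polylog_index a \<kappa> \<longrightarrow> formal_polylog \<iota> a \<kappa> u = 0}"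

end

theory Submission
  imports Defs
    "HOL-Complex_Analysis.Cauchy_Integral_Formula"
    "HOL-Computational_Algebra.Formal_Laurent_Series"
    "HOL-Computational_Algebra.Polynomial_FPS"
begin

no_notation fps_nth (infixl "$" 75)

text \<open>Write \<open>J\<close> for the left ideal on the right-hand side.  Modulo \<open>J\<close> the algebra is spanned by the words
  in \<open>X\<^sub>\<beta>\<^sub>\<omega>\<close> and \<open>X\<^sub>i\<^sub>\<beta>\<close> that do not end in \<open>X\<^sub>\<beta>\<^sub>\<omega>\<close> and in which no \<open>X\<^sub>i\<^sub>\<beta>\<close> precedes an
  \<open>X\<^sub>j\<^sub>\<beta>\<close> with \<open>i < j\<close>; these correspond to the index data \<open>(a, \<kappa>)\<close>.  The action of \<open>\<pp>\<^sub>m\<close> on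
  noncommutative power series, where the \<open>X\<^sub>a\<^sub>\<beta>\<close> multiply and the other generators are essentially
  derivations, yields the functionals dual to these words, and they vanish on \<open>J\<close>.

  It remains to identify the formal polylogarithms with these functionals, up to sign.  The Euler
  operator \<open>x\<^sub>n \<partial>/\<partial>x\<^sub>n\<close> only involves the contractions by \<open>X\<^sub>\<beta>\<^sub>\<omega>\<close> and the \<open>X\<^sub>i\<^sub>\<beta>\<close>, which remove the
  first letter of the word, and the solution of the resulting recursion that vanishes for
  \<open>x\<^sub>n = 0\<close> is the series of the polylogarithm.  Uniqueness of the formal polylogarithm is the
  injectivity of the iterated integral map: along a polynomial curve on which the logarithmic forms
  have independent residues, iterated integrals are linearly independent over the polynomials.\<close>

section \<open>Linear operators on noncommutative power series\<close>

text \<open>The Lie algebra is a semidirect product of a free one, generated by the letters, and a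
  copy of p_(m-1), so one expects derivations of the free algebra. But the X_ab with a < b in
  {\<alpha>, 1, ..., n} sum to X_\<beta>\<omega>, which does not annihilate the series 1 as
  derivations do. Adding right multiplications by multiples of X_\<beta>\<omega> repairs this, and
  X_\<beta>\<omega> lies in J.

  The analytic obstacle is that the iterated integral is normalised only at the origin, whereas the
  recursion in x_n needs initial values on the whole hyperplane x_n = 0. The contractions by
  X_\<alpha>i and X_ij get no explicit formula; it is enough that they are combinations of
  functionals of shorter, nonempty admissible words. By induction their integrals have no logarithms
  and vanish for x_n = 0, and the remaining partial derivatives then carry the value 0 from the
  origin over the hyperplane.

  Independence is proved over polynomials, not only over constants, because eliminating a leading
  coefficient multiplies by polynomials.\<close>

typedef 'l op = "{T :: ('l list \<Rightarrow> complex) \<Rightarrow> 'l list \<Rightarrow> complex.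
    (\<forall>f g. T (\<lambda>w. f w + g w) = (\<lambda>w. T f w + T g w)) \<and> (\<forall>c f. T (\<lambda>w. c * f w) = (\<lambda>w. c * T f w))}"
  morphisms op_app Abs_op
  by (rule exI [of _ "\<lambda>f. f"]) simp

setup_lifting type_definition_op

lemma op_app_add: "op_app T (\<lambda>w. f w + g w) = (\<lambda>w. op_app T f w + op_app T g w)"
  by transfer blast

lemma op_app_scale: "op_app T (\<lambda>w. c * f w) = (\<lambda>w. c * op_app T f w)"
  by transfer blast

lemma op_app_zero: "op_app T (\<lambda>w. 0) = (\<lambda>w. 0)"
  using op_app_scale [of T 0 "\<lambda>w. 0"] by simp

lemma op_app_uminus: "op_app T (\<lambda>w. - f w) = (\<lambda>w. - op_app T f w)"
  using op_app_scale [of T "-1" f] by simp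

text \<open>A type of its own, because \<open>lie_eval\<close> and \<open>lie_eval_cong\<close> ask
  for a target in the class \<open>complex_lie\<close>; the bracket is the commutator.\<close>

instantiation op :: (type) "{complex_lie, ring_1}"
begin

lift_definition zero_op :: "'a op" is "\<lambda>f w. 0" by simp
lift_definition one_op :: "'a op" is "\<lambda>f. f" by simp
lift_definition plus_op :: "'a op \<Rightarrow> 'a op \<Rightarrow> 'a op" is "\<lambda>S T f w. S f w + T f w"
  by (auto simp: algebra_simps)
lift_definition uminus_op :: "'a op \<Rightarrow> 'a op" is "\<lambda>S f w. - S f w"
  by auto
lift_definition minus_op :: "'a op \<Rightarrow> 'a op \<Rightarrow> 'a op" is "\<lambda>S T f w. S f w - T f w"
  by (auto simp: algebra_simps)
lift_definition times_op :: "'a op \<Rightarrow> 'a op \<Rightarrow> 'a op" is "\<lambda>S T f. S (T f)"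
  by auto
lift_definition scaleC_op :: "complex \<Rightarrow> 'a op \<Rightarrow> 'a op" is "\<lambda>c S f w. c * S f w"
  by (auto simp: algebra_simps)
definition lie_bracket_op :: "'a op \<Rightarrow> 'a op \<Rightarrow> 'a op" where
  "lie_bracket_op S T = S * T - T * S"

instance
proof
  fix a b c :: "'a op" and x y :: complex
  show "a + b + c = a + (b + c)" by transfer (simp add: algebra_simps)
  show "a + b = b + a" by transfer (simp add: algebra_simps)
  show "0 + a = a" by transfer simp
  show "- a + a = 0" by transfer simp
  show "a - b = a + - b" by transfer simp
  show "(0 :: 'a op) \<noteq> 1" by transfer (metis zero_neq_one)
  show mul_assoc: "a * b * c = a * (b * c)" for a b c :: "'a op" by transfer simp
  show "1 * a = a" by transfer simp
  show "a * 1 = a" by transfer simp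
  show mul_add: "(a + b) * c = a * c + b * c" for a b c :: "'a op" by transfer simp
  show mul_add': "a * (b + c) = a * b + a * c" for a b c :: "'a op" by transfer simp
  show "x *\<^sub>C (a + b) = x *\<^sub>C a + x *\<^sub>C b" by transfer (simp add: algebra_simps)
  show "(x + y) *\<^sub>C a = x *\<^sub>C a + y *\<^sub>C a" by transfer (simp add: algebra_simps)
  show "x *\<^sub>C y *\<^sub>C a = (x * y) *\<^sub>C a" by transfer (simp add: algebra_simps)
  show "1 *\<^sub>C a = a" by transfer simp
  show "lie_bracket (a + b) c = lie_bracket a c + lie_bracket b c"
    unfolding lie_bracket_op_def by transfer (force simp: algebra_simps)
  show "lie_bracket a (b + c) = lie_bracket a b + lie_bracket a c"
    unfolding lie_bracket_op_def by transfer (force simp: algebra_simps)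
  show "lie_bracket (x *\<^sub>C a) b = x *\<^sub>C lie_bracket a b"
    unfolding lie_bracket_op_def by transfer (force simp: algebra_simps)
  show "lie_bracket a (x *\<^sub>C b) = x *\<^sub>C lie_bracket a b"
    unfolding lie_bracket_op_def by transfer (force simp: algebra_simps)
  show "lie_bracket a a = 0"
    unfolding lie_bracket_op_def by transfer simp
  have minus: "u * - v = - (u * v)" "- u * v = - (u * v)" for u v :: "'a op"
    by (rule op_app_inject [THEN iffD1],
        simp add: times_op.rep_eq uminus_op.rep_eq op_app_uminus fun_eq_iff)+
  have diff: "(u - v) * w = u * w - v * w" "w * (u - v) = w * u - w * v" for u v w :: "'a op"
  proof -
    have sub: "s - t = s + - t" for s t :: "'a op" by transfer simp
    show "(u - v) * w = u * w - v * w" "w * (u - v) = w * u - w * v"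
      by (simp_all only: sub mul_add mul_add' minus)
  qed
  show "lie_bracket a (lie_bracket b c) + lie_bracket b (lie_bracket c a)
      + lie_bracket c (lie_bracket a b) = 0"
    unfolding lie_bracket_op_def diff mul_assoc by transfer (simp add: fun_eq_iff)
qed

end

lemma op_mult_scaleC: "(c *\<^sub>C S) * T = c *\<^sub>C (S * T)" "S * (c *\<^sub>C T) = c *\<^sub>C (S * T :: 'l op)"
  by (transfer, simp)+

lemmas op_app_simps = zero_op.rep_eq one_op.rep_eq plus_op.rep_eq uminus_op.rep_eq minus_op.rep_eq
  times_op.rep_eq scaleC_op.rep_eq

lemma op_app_sum: "op_app (\<Sum>i\<in>I. S i) f w = (\<Sum>i\<in>I. op_app (S i) f w)"
  by (induction I rule: infinite_finite_induct) (simp_all add: op_app_simps)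

lemma op_app_sum_arg: "op_app S (\<lambda>w. \<Sum>i\<in>I. f i w) = (\<lambda>w. \<Sum>i\<in>I. op_app S (f i) w)"
  by (induction I rule: infinite_finite_induct) (simp_all add: op_app_add op_app_zero)

lemma op_eqI: "(\<And>f w. op_app S f w = op_app T f w) \<Longrightarrow> S = T"
  by (rule op_app_inject [THEN iffD1]) blast

definition unit_word :: "'l list \<Rightarrow> 'l list \<Rightarrow> complex" where
  "unit_word v w = of_bool (w = v)"

text \<open>Left multiplication by the combination of letters with coefficients
  \<open>\<epsilon>\<close>, seen on coefficient functions.\<close>

lift_definition lmul :: "('l \<Rightarrow> complex) \<Rightarrow> 'l op" is
  "\<lambda>\<epsilon> f w. case w of [] \<Rightarrow> 0 | p # v \<Rightarrow> \<epsilon> p * f v"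
  by (auto simp: fun_eq_iff algebra_simps split: list.split)

lemma lmul_Nil [simp]: "op_app (lmul \<epsilon>) f [] = 0"
  by transfer simp

lemma lmul_Cons [simp]: "op_app (lmul \<epsilon>) f (p # v) = \<epsilon> p * f v"
  by transfer simp

definition kron :: "'l \<Rightarrow> 'l \<Rightarrow> complex" where
  "kron x p = of_bool (p = x)"

lemma lmul_sum: "lmul (\<lambda>p. \<Sum>a\<in>A. \<epsilon> a p) = (\<Sum>a\<in>A. lmul (\<epsilon> a))"
proof (rule op_eqI)
  show "op_app (lmul (\<lambda>p. \<Sum>a\<in>A. \<epsilon> a p)) f w = op_app (\<Sum>a\<in>A. lmul (\<epsilon> a)) f w" for f w
    by (cases w) (simp_all add: op_app_sum sum_distrib_right)
qed

lemma op_eq_wordI: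
  assumes "\<And>f. op_app S f [] = op_app T f []" "\<And>f p w. op_app S f (p # w) = op_app T f (p # w)"
  shows "S = T"
  by (metis assms op_eqI list.exhaust)

lemma lmul_scale: "lmul (\<lambda>p. c * \<epsilon> p) = c *\<^sub>C lmul \<epsilon>"
  by (rule op_eq_wordI) (simp_all add: op_app_simps)

lemma lmul_zero: "lmul (\<lambda>p. 0) = 0"
  by (rule op_eq_wordI) (simp_all add: op_app_simps)

lemma lmul_expand: "lmul \<epsilon> = (\<Sum>x\<in>UNIV. \<epsilon> x *\<^sub>C lmul (kron (x :: 'l::finite)))"
proof -
  have "lmul \<epsilon> = lmul (\<lambda>p. \<Sum>x\<in>UNIV. \<epsilon> x * kron x p)"
    by (simp add: kron_def)
  then show ?thesis
    by (simp only: lmul_sum lmul_scale)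
qed

lemma unit_word_Cons: "op_app (lmul (kron x)) (unit_word v) = unit_word (x # v)"
proof
  show "op_app (lmul (kron x)) (unit_word v) w = unit_word (x # v) w" for w
    by (cases w) (simp_all add: unit_word_def kron_def)
qed

text \<open>A series is its constant term plus letters times its tails, so \<open>C\<close> applied
  to it is the sum of the letters times \<open>C\<close> applied to the tails. This uses up one
  letter of the evaluated word, and induction on that word avoids any question of
  convergence.\<close>

lemma op_eq_0I:
  fixes C :: "'l::finite op"
  assumes one: "op_app C (unit_word []) = (\<lambda>w. 0)"
    and comm: "\<And>x. C * lmul (kron x) = lmul (kron x) * C"
  shows "C = 0"
proof (rule op_eqI)
  fix f :: "'l list \<Rightarrow> complex" and w
  have dec: "f = (\<lambda>w. f [] * unit_word [] w + (\<Sum>x\<in>UNIV. op_app (lmul (kron x)) (\<lambda>v. f (x # v)) w))"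
    (is "_ = ?dec f") for f :: "'l list \<Rightarrow> complex"
  proof
    show "f w = ?dec f w" for w
      by (cases w) (simp_all add: unit_word_def kron_def of_bool_def if_distrib [of "\<lambda>x. x * _"] cong: if_cong)
  qed
  have C: "op_app C f w = (\<Sum>x\<in>UNIV. op_app (lmul (kron x)) (op_app C (\<lambda>v. f (x # v))) w)" for f w
  proof -
    have "op_app C (op_app (lmul (kron x)) g) = op_app (lmul (kron x)) (op_app C g)" for g x
      using arg_cong [OF comm, of "\<lambda>S. op_app S g"] by (simp add: op_app_simps)
    moreover have "op_app C f w = op_app C (?dec f) w"
      using dec [of f] by (rule arg_cong)
    ultimately show ?thesis
      by (simp add: op_app_add op_app_scale op_app_sum_arg one)
  qed
  show "op_app C f w = op_app 0 f w"
  proof (induction w arbitrary: f)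
    case Nil
    show ?case by (subst C) (simp add: op_app_simps)
  next
    case (Cons p w)
    then show ?case by (subst C) (simp add: op_app_simps)
  qed
qed

text \<open>The derivation sending the letter \<open>x\<close> to the sum of all
  \<open>\<delta> x p q\<close> times the word \<open>p q\<close>: the coefficient at a word
  collects, for each pair of neighbours, the letters that can have produced the pair.\<close>

primrec deriv_fun :: "('l \<Rightarrow> 'l \<Rightarrow> 'l \<Rightarrow> complex) \<Rightarrow> ('l::finite list \<Rightarrow> complex) \<Rightarrow> 'l list \<Rightarrow> complex"
  where
    "deriv_fun \<delta> f [] = 0"
  | "deriv_fun \<delta> f (p # w) = deriv_fun \<delta> (\<lambda>v. f (p # v)) w
      + (case w of [] \<Rightarrow> 0 | q # v \<Rightarrow> \<Sum>x\<in>UNIV. \<delta> x p q * f (x # v))"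

lemma deriv_fun_add: "deriv_fun \<delta> (\<lambda>w. f w + g w) w = deriv_fun \<delta> f w + deriv_fun \<delta> g w"
  by (induction w arbitrary: f g)
    (auto simp: algebra_simps sum.distrib split: list.split)

lemma deriv_fun_scale: "deriv_fun \<delta> (\<lambda>w. c * f w) w = c * deriv_fun \<delta> f w"
  by (induction w arbitrary: f)
    (auto simp: algebra_simps sum_distrib_left split: list.split)

lift_definition deriv_op :: "('l \<Rightarrow> 'l \<Rightarrow> 'l \<Rightarrow> complex) \<Rightarrow> 'l::finite op" is deriv_fun
  by (simp add: fun_eq_iff deriv_fun_add deriv_fun_scale)

lemma deriv_op_one: "op_app (deriv_op \<delta>) (unit_word []) = (\<lambda>w. 0)"
proof
  have zero: "deriv_fun \<delta> (\<lambda>v. 0) w = 0" for w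
    using deriv_fun_scale [of \<delta> 0 "\<lambda>v. 0" w] by simp
  show "op_app (deriv_op \<delta>) (unit_word []) w = 0" for w
    by (cases w) (auto simp: deriv_op.rep_eq unit_word_def zero split: list.split)
qed

text \<open>Leibniz rule for a derivation whose value on the letter \<open>x\<close> is a multiple
  of the commutator of two linear forms.\<close>

lemma deriv_op_lmul:
  assumes "\<And>p q. \<delta> x p q = c * (\<epsilon> p * \<eta> q - \<eta> p * \<epsilon> q)"
  shows "deriv_op \<delta> * lmul (kron x)
    = lmul (kron x) * deriv_op \<delta> + c *\<^sub>C (lmul \<epsilon> * lmul \<eta> - lmul \<eta> * lmul \<epsilon>)"
proof (rule op_eqI)
  fix f w
  have D: "deriv_fun \<delta> (op_app (lmul (kron x)) f) (p # v) = kron x p * deriv_fun \<delta> f v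
      + (case v of [] \<Rightarrow> 0 | q # u \<Rightarrow> \<delta> x p q * f u)" for p v
  proof -
    have "(\<Sum>y\<in>UNIV. \<delta> y p q * (kron x y * r)) = \<delta> x p q * r" for q r
      by (simp add: kron_def of_bool_def if_distrib [of "\<lambda>u. u * _"] if_distrib [of "\<lambda>u. _ * u"] cong: if_cong)
    then show ?thesis
      by (simp add: deriv_fun_scale split: list.split)
  qed
  show "op_app (deriv_op \<delta> * lmul (kron x)) f w =
    op_app (lmul (kron x) * deriv_op \<delta> + c *\<^sub>C (lmul \<epsilon> * lmul \<eta> - lmul \<eta> * lmul \<epsilon>)) f w"
  proof (cases w)
    case (Cons p v)
    then show ?thesis
      by (cases v) (simp_all add: op_app_simps deriv_op.rep_eq D assms right_diff_distrib
          left_diff_distrib mult.assoc del: deriv_fun.simps(2))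
  qed (simp add: op_app_simps deriv_op.rep_eq)
qed

lift_definition rmul :: "'l \<Rightarrow> 'l op" is
  "\<lambda>x f w. if w \<noteq> [] \<and> last w = x then f (butlast w) else 0"
  by (auto simp: fun_eq_iff)

lemma rmul_one: "op_app (rmul x) (unit_word []) = unit_word [x]"
proof
  show "op_app (rmul x) (unit_word []) w = unit_word [x] w" for w
    by (cases w rule: rev_cases) (auto simp: rmul.rep_eq unit_word_def)
qed

lemma rmul_lmul: "rmul x * lmul \<epsilon> = lmul \<epsilon> * rmul x"
proof (rule op_eq_wordI)
  show "op_app (rmul x * lmul \<epsilon>) f (p # w) = op_app (lmul \<epsilon> * rmul x) f (p # w)" for f p w
    by (cases w) (auto simp: op_app_simps rmul.rep_eq)
qed (simp add: op_app_simps rmul.rep_eq)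

section \<open>The representation of the Lie algebra on power series\<close>

text \<open>A power series in \<open>X\<^sub>\<beta>\<^sub>\<omega>\<close> (the letter \<^term>\<open>None\<close>) and the \<open>X\<^sub>i\<^sub>\<beta>\<close> (the letters
  \<^term>\<open>Some i\<close>) is a function on words; \<open>mark_coord a\<close> are the coordinates of \<open>X\<^sub>a\<^sub>\<beta>\<close>.\<close>

fun mark_coord :: "'n marks \<Rightarrow> 'n option \<Rightarrow> complex" where
  "mark_coord Alpha p = -1"
| "mark_coord (Pt i) p = kron (Some i) p"
| "mark_coord Omega p = kron None p"

text \<open>Selects the letters on which [X_ab, X_c\<beta>] = (\<delta>_ac - \<delta>_bc)
  [X_a\<beta>, X_b\<beta>] is nonzero. X_\<alpha>\<beta> is not a letter, and X_\<beta>\<omega>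
  commutes with X_ab for a, b other than \<omega>; hence the default 0.\<close>

fun mark_ind :: "'n marks \<Rightarrow> 'n option \<Rightarrow> complex" where
  "mark_ind (Pt i) p = kron (Some i) p"
| "mark_ind _ p = 0"

lemma UNIV_marks: "UNIV = insert Alpha (insert Omega (range Pt))"
  using marks.exhaust by auto

lemma sum_marks: "(\<Sum>a\<in>UNIV. f a) = f Alpha + f Omega + (\<Sum>i\<in>UNIV. f (Pt (i::'n::finite)))"
  by (simp add: UNIV_marks image_iff sum.reindex inj_def add.assoc)

lemma sum_marks_minus: "(\<Sum>a\<in>UNIV - {Omega}. f a) = f Alpha + (\<Sum>i\<in>UNIV. f (Pt (i::'n::finite)))"
proof -
  have "UNIV - {Omega} = insert Alpha (range (Pt :: 'n \<Rightarrow> _))"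
    using marks.exhaust by auto
  then show ?thesis
    by (simp add: image_iff sum.reindex inj_def)
qed

definition lop :: "'n::finite marks \<Rightarrow> 'n option op" where
  "lop a = lmul (mark_coord a)"

lemma sum_lop: "(\<Sum>a\<in>UNIV. lop a) = (0 :: 'n::finite option op)"
proof -
  have "(\<lambda>p. \<Sum>a\<in>UNIV. mark_coord a p) = (\<lambda>p :: 'n option. 0)"
  proof
    show "(\<Sum>a\<in>UNIV. mark_coord a p) = 0" for p :: "'n option"
      by (cases p) (simp_all add: sum_marks kron_def of_bool_def)
  qed
  then show ?thesis
    unfolding lop_def lmul_sum [symmetric] by (simp add: lmul_zero)
qed

text \<open>For marks other than \<omega> this is the adjoint action of X_ab on the algebra
  generated by the X_c\<beta>.\<close>

definition dop :: "'n::finite marks \<Rightarrow> 'n marks \<Rightarrow> 'n option op" where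
  "dop a b = deriv_op (\<lambda>x p q. (mark_ind a x - mark_ind b x)
     * (mark_coord a p * mark_coord b q - mark_coord b p * mark_coord a q))"

lemma dop_sym: "dop a b = dop b a"
  unfolding dop_def by (rule arg_cong [of _ _ deriv_op]) (auto simp: fun_eq_iff algebra_simps)

lemma dop_one: "op_app (dop a b) (unit_word []) = (\<lambda>w. 0)"
  by (simp add: dop_def deriv_op_one)

lemma dop_kron: "dop a b * lmul (kron x) = lmul (kron x) * dop a b
    + (mark_ind a x - mark_ind b x) *\<^sub>C lie_bracket (lop a) (lop b)"
  unfolding dop_def lop_def lie_bracket_op_def by (rule deriv_op_lmul) simp

lemma mark_pairing:
  fixes a c :: "'n::finite marks"
  assumes "a \<noteq> Omega" "c \<noteq> Omega"
  shows "(\<Sum>x\<in>UNIV. mark_coord c x * mark_ind a x) =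
    of_bool (a = c \<and> a \<noteq> Alpha) - of_bool (c = Alpha \<and> a \<noteq> Alpha)"
  using assms by (cases a; cases c)
    (auto simp: kron_def of_bool_def sum_negf if_distrib [of "\<lambda>x. x * _"] cong: if_cong)

text \<open>Beyond the letters, the content is the case \<open>c = Alpha\<close>: all coordinates of
  X_\<alpha>\<beta> are -1, and minus the sum of the coefficients prescribed on the letters is again
  the difference of the two indicators.\<close>

lemma lie_dop_lop:
  assumes "a \<noteq> Omega" "b \<noteq> Omega" "c \<noteq> Omega"
  shows "lie_bracket (dop a b) (lop c) =
    (of_bool (a = c) - of_bool (b = c) :: complex) *\<^sub>C lie_bracket (lop a) (lop b)"
proof -
  have "dop a b * lop c = (\<Sum>x\<in>UNIV. mark_coord c x *\<^sub>C (dop a b * lmul (kron x)))"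
    unfolding lop_def by (subst lmul_expand) (simp add: sum_distrib_left op_mult_scaleC)
  also have "\<dots> = (\<Sum>x\<in>UNIV. mark_coord c x *\<^sub>C (lmul (kron x) * dop a b))
      + (\<Sum>x\<in>UNIV. (mark_coord c x * (mark_ind a x - mark_ind b x)) *\<^sub>C lie_bracket (lop a) (lop b))"
    unfolding dop_kron scaleC_right_distrib scaleC_scaleC sum.distrib ..
  also have "(\<Sum>x\<in>UNIV. mark_coord c x *\<^sub>C (lmul (kron x) * dop a b)) = lop c * dop a b"
    unfolding lop_def by (subst (2) lmul_expand) (simp add: sum_distrib_right op_mult_scaleC)
  also have "(\<Sum>x\<in>UNIV. (mark_coord c x * (mark_ind a x - mark_ind b x)) *\<^sub>C lie_bracket (lop a) (lop b))
      = (\<Sum>x\<in>UNIV. mark_coord c x * (mark_ind a x - mark_ind b x)) *\<^sub>C lie_bracket (lop a) (lop b)"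
    by (simp add: cvec.scale_sum_left)
  also have "(\<Sum>x\<in>UNIV. mark_coord c x * (mark_ind a x - mark_ind b x))
      = of_bool (a = c) - of_bool (b = c)"
    using assms by (simp add: right_diff_distrib sum_subtractf mark_pairing) auto
  finally show ?thesis
    unfolding lie_bracket_op_def [of "dop a b"] by simp
qed

lemma kron_None: "lmul (kron None) = lop (Omega :: 'n::finite marks)"
proof -
  have "mark_coord (Omega :: 'n marks) = kron None"
    by (simp add: fun_eq_iff)
  then show ?thesis
    by (simp only: lop_def)
qed

lemma kron_Some: "lmul (kron (Some i)) = lop (Pt i)"
proof -
  have "mark_coord (Pt i) = kron (Some i)"
    by (simp add: fun_eq_iff)
  then show ?thesis
    by (simp only: lop_def)
qed

lemma lop_Omega: "lop Omega = - (\<Sum>c\<in>UNIV - {Omega}. lop (c :: 'n::finite marks))"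
proof -
  have "lop Omega + (\<Sum>c\<in>UNIV - {Omega}. lop (c :: 'n marks)) = 0"
    using sum_lop [where 'n = 'n] by (simp add: sum.remove [of UNIV Omega])
  then show ?thesis
    by (rule eq_neg_iff_add_eq_0 [THEN iffD2])
qed

text \<open>X_\<beta>\<omega> is minus the sum of the other X_c\<beta>, so the brackets with those
  decide.\<close>

lemma op_eq_0I':
  fixes C :: "'n::finite option op"
  assumes "op_app C (unit_word []) = (\<lambda>w. 0)"
    and "\<And>c. c \<noteq> Omega \<Longrightarrow> lie_bracket C (lop c) = 0"
  shows "C = 0"
proof (rule op_eq_0I)
  have comm: "C * lop c = lop c * C" if "c \<noteq> Omega" for c
    using assms(2) [OF that] unfolding lie_bracket_op_def by simp
  have "C * lop Omega = lop Omega * C"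
    unfolding lop_Omega mult_minus_left mult_minus_right sum_distrib_left sum_distrib_right
    by (intro arg_cong [of _ _ uminus] sum.cong comm) auto
  then show "C * lmul (kron x) = lmul (kron x) * C" for x
    by (cases x) (simp_all only: kron_None kron_Some comm marks.simps not_False_eq_True)
qed (fact assms(1))

text \<open>The n(n+1)/2 generators X_ab with a, b in {\<alpha>, 1, ..., n} must sum to
  X_\<beta>\<omega>. On the series 1 the derivations contribute nothing, so each pair carries an
  equal share of X_\<beta>\<omega>, multiplied from the right in order to commute with the left
  multiplications.\<close>

definition rop :: "'n::finite option op" where
  "rop = (2 / (of_nat (CARD('n)) * (of_nat (CARD('n)) + 1))) *\<^sub>C rmul None"

definition aop :: "'n::finite marks \<Rightarrow> 'n marks \<Rightarrow> 'n option op" where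
  "aop a b = (if a = b then 0 else dop a b + rop)"

text \<open>Solves the relation at \<open>a\<close> for X_a\<omega>. The relations at the marks
  other than \<omega> then hold by construction, and the one at \<omega> comes down to
  \<open>sum_aop\<close>.\<close>

definition oop :: "'n::finite marks \<Rightarrow> 'n option op" where
  "oop a = - (\<Sum>b\<in>UNIV - {Omega}. aop a b) - lop a"

fun gop :: "'n::finite marks option \<Rightarrow> 'n marks option \<Rightarrow> 'n option op" where
  "gop None None = 0"
| "gop None (Some a) = lop a"
| "gop (Some a) None = lop a"
| "gop (Some a) (Some b) = (if a = Omega then (if b = Omega then 0 else oop b)
     else if b = Omega then oop a else aop a b)"

section \<open>Commutation relations of the operators\<close>

lemma lie_simps:
  "lie_bracket 0 x = 0" "lie_bracket x 0 = 0" "lie_bracket (- x) y = - lie_bracket x y"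
  "lie_bracket x (- y) = - lie_bracket x y"
  "lie_bracket (x - z) y = lie_bracket x y - lie_bracket z y"
  "lie_bracket x (y - z) = lie_bracket x y - lie_bracket x z"
  for x y z :: "'a::complex_lie"
proof -
  show zl: "lie_bracket 0 x = 0" for x :: 'a
    using lie_add_left [of 0 0 x] by simp
  show zr: "lie_bracket x 0 = 0" for x :: 'a
    using lie_add_right [of x 0 0] by simp
  show nl: "lie_bracket (- x) y = - lie_bracket x y" for x y :: 'a
    using lie_add_left [of x "- x" y] by (simp add: zl eq_neg_iff_add_eq_0 add.commute)
  show nr: "lie_bracket x (- y) = - lie_bracket x y" for x y :: 'a
    using lie_add_right [of x y "- y"] by (simp add: zr eq_neg_iff_add_eq_0 add.commute)
  show "lie_bracket (x - z) y = lie_bracket x y - lie_bracket z y"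
    using lie_add_left [of x "- z" y] by (simp add: nl)
  show "lie_bracket x (y - z) = lie_bracket x y - lie_bracket x z"
    using lie_add_right [of x y "- z"] by (simp add: nr)
qed

lemma lie_antisym: "lie_bracket y x = - lie_bracket x (y :: 'a::complex_lie)"
proof -
  have "lie_bracket (y + x) (y + x) = 0"
    by (rule lie_self)
  then have "lie_bracket y x + lie_bracket x y = 0"
    unfolding lie_add_left lie_add_right by (simp add: lie_self add.commute)
  then show ?thesis
    by (rule eq_neg_iff_add_eq_0 [THEN iffD2])
qed

lemma lie_jacobi': "lie_bracket (lie_bracket x y) z
    = lie_bracket x (lie_bracket y z) - lie_bracket y (lie_bracket x (z :: 'a::complex_lie))"
  using lie_jacobi [of x y z]
  by (simp add: lie_antisym [of z "lie_bracket x y"] lie_antisym [of z x] lie_simps)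

lemma lie_sum_right: "lie_bracket x (\<Sum>i\<in>I. f i) = (\<Sum>i\<in>I. lie_bracket x (f i :: 'a::complex_lie))"
  by (induction I rule: infinite_finite_induct) (simp_all add: lie_simps lie_add_right)

lemma lie_sum_left: "lie_bracket (\<Sum>i\<in>I. f i) x = (\<Sum>i\<in>I. lie_bracket (f i :: 'a::complex_lie) x)"
  by (induction I rule: infinite_finite_induct) (simp_all add: lie_simps lie_add_left)

lemma lie_rop_lop: "lie_bracket rop (lop a) = 0"
  unfolding rop_def lop_def lie_scale_left by (simp add: lie_bracket_op_def rmul_lmul)

text \<open>A derivation that kills the letter X_\<beta>\<omega> commutes with right multiplication
  by it.\<close>

lemma rmul_deriv_comm:
  assumes "\<And>p q. \<delta> None p q = 0"
  shows "rmul None * deriv_op \<delta> = deriv_op \<delta> * (rmul None :: 'n::finite option op)"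
proof -
  have "op_app (rmul None) (deriv_fun \<delta> f) w = deriv_fun \<delta> (op_app (rmul None) f) w" for f w
  proof (induction w arbitrary: f)
    case Nil
    then show ?case by (simp add: rmul.rep_eq)
  next
    case (Cons p w)
    \<comment> \<open>The correction concerns the word \<open>[p]\<close>, whose last letter is also
      its first: removing it leaves nothing of the tail.\<close>
    have eq: "(\<lambda>v. op_app (rmul None) f (p # v)) = (\<lambda>v. op_app (rmul None) (\<lambda>v. f (p # v)) v + (if v = [] \<and> p = None then f [] else 0))" for f :: "'n option list \<Rightarrow> complex"
      by (auto simp: rmul.rep_eq)
    have z: "deriv_fun \<delta> (\<lambda>v. if v = [] \<and> p = None then f [] else 0) w = 0"
      by (cases w) (auto simp: deriv_fun_scale [of \<delta> 0 "\<lambda>v. 0", simplified] split: list.split)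
    have r: "(\<Sum>x\<in>UNIV. \<delta> x p q * op_app (rmul None) f (x # v)) = (if v = [] then 0 else if last v = None then \<Sum>x\<in>UNIV. \<delta> x p q * f (x # butlast v) else 0)" for q v
      using assms by (auto simp: rmul.rep_eq intro!: sum.neutral)
    show ?case
      apply (simp only: deriv_fun.simps eq [of f] deriv_fun_add z Cons.IH [symmetric] r)
      by (cases w; cases "tl w") (auto simp: rmul.rep_eq split: list.split)
  qed
  then show ?thesis
    by (intro op_eqI) (simp add: op_app_simps deriv_op.rep_eq)
qed

lemma lie_rop_dop: "lie_bracket rop (dop a b) = 0"
proof -
  have "mark_ind c None = 0" for c :: "'a marks"
    by (cases c) (simp_all add: kron_def)
  then have "lie_bracket (rmul None) (dop a b) = 0"
    unfolding dop_def lie_bracket_op_def by (subst rmul_deriv_comm) simp_all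
  then show ?thesis
    by (simp add: rop_def lie_scale_left)
qed

lemma lie_aop_lop:
  assumes "a \<noteq> Omega" "b \<noteq> Omega" "c \<noteq> Omega"
  shows "lie_bracket (aop a b) (lop c) =
    (of_bool (a = c) - of_bool (b = c) :: complex) *\<^sub>C lie_bracket (lop a) (lop b)"
  using assms by (auto simp: aop_def lie_add_left lie_rop_lop lie_dop_lop lie_simps lie_self)

lemma aop_sym: "aop a b = aop b a"
  by (simp add: aop_def dop_sym [of a b])

text \<open>In the sum of the X_c\<beta> with c other than \<omega> the contributions of c = a and c
  = b cancel.\<close>

lemma lie_aop_Omega:
  assumes "a \<noteq> Omega" "b \<noteq> Omega"
  shows "lie_bracket (aop a b) (lop Omega) = 0"
proof (cases "a = b")
  case False
  have "(\<Sum>c\<in>UNIV - {Omega}. lie_bracket (aop a b) (lop c))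
      = (\<Sum>c\<in>UNIV - {Omega}. (of_bool (a = c) - of_bool (b = c)) *\<^sub>C lie_bracket (lop a) (lop b))"
    using assms by (intro sum.cong) (auto simp: lie_aop_lop)
  also have "\<dots> = (\<Sum>c\<in>UNIV - {Omega}. (of_bool (a = c) - of_bool (b = c))) *\<^sub>C lie_bracket (lop a) (lop b)"
    by (simp add: cvec.scale_sum_left)
  also have "(\<Sum>c\<in>UNIV - {Omega}. (of_bool (a = c) - of_bool (b = c)) :: complex) = 0"
    using assms by (simp add: sum_subtractf of_bool_def sum.delta)
  finally show ?thesis
    unfolding lop_Omega by (simp add: lie_simps lie_sum_right)
qed (simp add: aop_def lie_simps)

text \<open>Commutators of operators killing the series 1 kill it too, so they are determined by
  their brackets with the X_c\<beta>.\<close>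

lemma lie_dop_dop:
  assumes "\<And>c. c \<noteq> Omega \<Longrightarrow> lie_bracket (lie_bracket (dop a b) S) (lop c) = 0"
    and "op_app S (unit_word []) = (\<lambda>w. 0)"
  shows "lie_bracket (dop a b) S = 0"
proof (rule op_eq_0I')
  show "op_app (lie_bracket (dop a b) S) (unit_word []) = (\<lambda>w. 0)"
    by (simp add: assms(2) lie_bracket_op_def op_app_simps dop_one op_app_zero)
qed (rule assms(1))

lemma lie_dop_deriv: "lie_bracket (dop a b) (lie_bracket x y)
    = lie_bracket (lie_bracket (dop a b) x) y + lie_bracket x (lie_bracket (dop a b) y)"
  using lie_jacobi' [of "dop a b" x y] by (simp add: algebra_simps)

lemma lie_dop_disjoint:
  assumes "distinct [a, b, c, d, Omega]"
  shows "lie_bracket (dop a b) (dop c d) = 0"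
  using assms
  by (rule_tac lie_dop_dop)
    (auto simp: dop_one lie_jacobi' [of "dop a b" "dop c d"] lie_dop_lop lie_scale_right lie_simps
      lie_dop_deriv of_bool_def)

text \<open>The infinitesimal braid relation. Tested on X_a\<beta>, X_b\<beta> and X_c\<beta> it
  reduces to antisymmetry and the Jacobi identity for these three elements; on any other X_x\<beta>
  all terms vanish.\<close>

lemma lie_dop_triangle:
  assumes "distinct [a, b, c, Omega]"
  shows "lie_bracket (dop a b) (dop c a + dop c b) = 0"
proof (rule lie_dop_dop)
  fix x :: "'a marks"
  assume x: "x \<noteq> Omega"
  note neq = assms [simplified] x
  have *: "lie_bracket (lie_bracket (dop a b) (dop c a + dop c b)) (lop x)
      = lie_bracket (dop a b) (lie_bracket (dop c a) (lop x)) + lie_bracket (dop a b) (lie_bracket (dop c b) (lop x))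
      - (lie_bracket (dop c a) (lie_bracket (dop a b) (lop x)) + lie_bracket (dop c b) (lie_bracket (dop a b) (lop x)))"
    by (simp add: lie_jacobi' [of "dop a b" _ "lop x"] lie_add_left lie_add_right)
  have j: "lie_bracket (lop c) (lie_bracket (lop a) (lop b)) + lie_bracket (lop a) (lie_bracket (lop b) (lop c))
      + lie_bracket (lop b) (lie_bracket (lop c) (lop a)) = 0"
    by (rule lie_jacobi)
  consider "x = a" | "x = b" | "x = c" | "x \<noteq> a" "x \<noteq> b" "x \<noteq> c"
    by blast
  then show "lie_bracket (lie_bracket (dop a b) (dop c a + dop c b)) (lop x) = 0"
    unfolding * using neq j
    by cases (auto simp: lie_dop_lop lie_simps lie_dop_deriv
       lie_antisym [of "lop c" "lop a"] lie_antisym [of "lop c" "lop b"] lie_antisym [of "lop b" "lop a"]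
       lie_antisym [of "lie_bracket (lop a) (lop c)" "lop b"]
       lie_antisym [of "lie_bracket (lop b) (lop c)" "lop a"] lie_antisym [of "lie_bracket (lop a) (lop b)" "lop c"]
       algebra_simps)
qed (simp add: op_app_simps dop_one)

lemma lie_rop_aop: "lie_bracket rop (aop a b) = 0"
  by (simp add: aop_def lie_simps lie_add_right lie_rop_dop lie_self)

lemma lie_dop_rop: "lie_bracket (dop a b) rop = 0"
  using lie_antisym [of "dop a b" rop] by (simp add: lie_rop_dop)

lemma lie_aop_disjoint:
  assumes "distinct [a, b, c, d, Omega]"
  shows "lie_bracket (aop a b) (aop c d) = 0"
  using assms by (simp add: aop_def lie_add_left lie_add_right lie_dop_disjoint lie_self
      lie_rop_dop lie_dop_rop)

lemma lie_aop_triangle: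
  assumes "distinct [a, b, c, Omega]"
  shows "lie_bracket (aop a b) (aop c a + aop c b) = 0"
proof -
  have "lie_bracket (aop a b) (aop c a + aop c b) = lie_bracket (dop a b) (dop c a + dop c b)"
    using assms by (auto simp: aop_def lie_add_left lie_add_right lie_rop_dop lie_dop_rop lie_self)
  then show ?thesis
    using lie_dop_triangle [OF assms] by simp
qed

lemma lie_lop_aop:
  assumes "a \<notin> {c, d}" "c \<noteq> Omega" "d \<noteq> Omega"
  shows "lie_bracket (lop a) (aop c d) = 0" "lie_bracket (aop c d) (lop a) = 0"
proof -
  show "lie_bracket (aop c d) (lop a) = 0"
    using assms by (cases "a = Omega") (auto simp: lie_aop_Omega lie_aop_lop)
  then show "lie_bracket (lop a) (aop c d) = 0"
    using lie_antisym [of "lop a" "aop c d"] by simp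
qed

text \<open>Of the sum defining X_c\<omega> only the terms for a and b fail to commute with X_ab,
  and these two cancel by the braid relation.\<close>

lemma lie_aop_oop:
  assumes "distinct [a, b, c, Omega]"
  shows "lie_bracket (aop a b) (oop c) = 0"
proof -
  have "(\<Sum>x\<in>UNIV - {Omega}. lie_bracket (aop a b) (aop c x)) =
      (\<Sum>x\<in>{a, b}. lie_bracket (aop a b) (aop c x))"
  proof (rule sum.mono_neutral_right)
    show "\<forall>x\<in>UNIV - {Omega} - {a, b}. lie_bracket (aop a b) (aop c x) = 0"
    proof
      fix x assume "x \<in> UNIV - {Omega} - {a, b}"
      then show "lie_bracket (aop a b) (aop c x) = 0"
        using assms lie_aop_disjoint [of a b c x]
        by (cases "x = c") (auto simp: aop_def [of c c] lie_simps)
    qed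
  qed (use assms in auto)
  also have "\<dots> = lie_bracket (aop a b) (aop c a) + lie_bracket (aop a b) (aop c b)"
    using assms by simp
  also have "\<dots> = 0"
    using lie_aop_triangle [OF assms] by (simp add: lie_add_right)
  finally show ?thesis
    using assms by (auto simp: oop_def lie_simps lie_sum_right lie_lop_aop)
qed

text \<open>In the sum defining X_c\<omega> the contribution of X_ca cancels that of
  X_c\<beta>.\<close>

lemma lie_lop_oop:
  assumes "a \<noteq> c" "c \<noteq> Omega" "a \<noteq> Omega"
  shows "lie_bracket (lop a) (oop c) = 0"
proof -
  have "(\<Sum>x\<in>UNIV - {Omega}. lie_bracket (lop a) (aop c x))
      = (\<Sum>x\<in>{a}. lie_bracket (lop a) (aop c x))"
    using assms by (intro sum.mono_neutral_right) (auto intro!: lie_lop_aop)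
  also have "\<dots> = - lie_bracket (aop c a) (lop a)"
    using lie_antisym [of "lop a" "aop c a"] by simp
  also have "\<dots> = - lie_bracket (lop a) (lop c)"
    using assms lie_antisym [of "lop c" "lop a"] by (simp add: lie_aop_lop)
  finally show ?thesis
    by (simp add: oop_def lie_simps lie_sum_right)
qed

lemma gop_sym: "gop a b = gop b a"
  by (cases a; cases b) (auto simp: aop_sym)

lemma gop_comm:
  assumes "distinct [a, b, c, d]"
  shows "lie_bracket (gop a b) (gop c d) = 0"
proof -
  have oop_aop: "lie_bracket (oop c) (aop a b) = 0" if "distinct [a, b, c, Omega]" for a b c :: "'a marks"
    using lie_aop_oop [OF that] lie_antisym [of "oop c" "aop a b"] by simp
  have oop_lop: "lie_bracket (oop c) (lop a) = 0" if "a \<noteq> c" "c \<noteq> Omega" "a \<noteq> Omega" for a c :: "'a marks"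
    using lie_lop_oop [OF that] lie_antisym [of "oop c" "lop a"] by simp
  show ?thesis
    using assms
    by (cases a; cases b; cases c; cases d)
      (auto intro: lie_aop_disjoint lie_aop_oop lie_lop_oop lie_lop_aop oop_aop oop_lop)
qed

lemma scaleC_2: "2 *\<^sub>C x = x + (x :: 'a::complex_vec)"
  using scaleC_left_distrib [of 1 1 x] by (simp add: scaleC_one)

text \<open>What remains of the relation at \<omega>. Both sides have the same brackets with all
  X_c\<beta>, and the constant in \<open>rop\<close> makes them agree on the series 1.\<close>

lemma sum_aop: "(\<Sum>a\<in>UNIV - {Omega}. \<Sum>b\<in>UNIV - {Omega}. aop a b) = 2 *\<^sub>C lop (Omega :: 'n::finite marks)"
proof -
  let ?A = "UNIV - {Omega :: 'n marks}"
  define C where "C = (\<Sum>a\<in>?A. \<Sum>b\<in>?A. aop a b) - 2 *\<^sub>C lop Omega"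
  have "C = 0"
  proof (rule op_eq_0I')
    fix c :: "'n marks"
    assume c: "c \<noteq> Omega"
    have "lie_bracket (\<Sum>a\<in>?A. \<Sum>b\<in>?A. aop a b) (lop c)
        = (\<Sum>a\<in>?A. \<Sum>b\<in>?A. (of_bool (a = c) - of_bool (b = c)) *\<^sub>C lie_bracket (lop a) (lop b))"
      unfolding lie_sum_left using c by (intro sum.cong refl) (auto simp: lie_aop_lop)
    also have "\<dots> = (\<Sum>a\<in>?A. \<Sum>b\<in>?A. of_bool (a = c) *\<^sub>C lie_bracket (lop a) (lop b))
        - (\<Sum>a\<in>?A. \<Sum>b\<in>?A. of_bool (b = c) *\<^sub>C lie_bracket (lop a) (lop b))"
      by (simp add: cvec.scale_left_diff_distrib sum_subtractf)
    also have "(\<Sum>a\<in>?A. \<Sum>b\<in>?A. of_bool (a = c) *\<^sub>C lie_bracket (lop a) (lop b))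
        = (\<Sum>b\<in>?A. lie_bracket (lop c) (lop b))"
    proof -
      have "(\<Sum>a\<in>?A. \<Sum>b\<in>?A. of_bool (a = c) *\<^sub>C lie_bracket (lop a) (lop b))
          = (\<Sum>a\<in>{c}. \<Sum>b\<in>?A. of_bool (a = c) *\<^sub>C lie_bracket (lop a) (lop b))"
        using c by (intro sum.mono_neutral_right) auto
      then show ?thesis by (simp add: scaleC_one)
    qed
    also have "(\<Sum>a\<in>?A. \<Sum>b\<in>?A. of_bool (b = c) *\<^sub>C lie_bracket (lop a) (lop b))
        = (\<Sum>a\<in>?A. lie_bracket (lop a) (lop c))"
    proof (rule sum.cong)
      fix a
      have "(\<Sum>b\<in>?A. of_bool (b = c) *\<^sub>C lie_bracket (lop a) (lop b))
          = (\<Sum>b\<in>{c}. of_bool (b = c) *\<^sub>C lie_bracket (lop a) (lop b))"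
        using c by (intro sum.mono_neutral_right) auto
      then show "(\<Sum>b\<in>?A. of_bool (b = c) *\<^sub>C lie_bracket (lop a) (lop b)) = lie_bracket (lop a) (lop c)"
        by (simp add: scaleC_one)
    qed simp
    also have "(\<Sum>b\<in>?A. lie_bracket (lop c) (lop b)) = - lie_bracket (lop c) (lop Omega)"
      by (simp add: lop_Omega lie_sum_right lie_simps)
    also have "\<dots> = lie_bracket (lop Omega) (lop c)"
      by (rule lie_antisym [symmetric])
    also have "(\<Sum>a\<in>?A. lie_bracket (lop a) (lop c)) = - lie_bracket (lop Omega) (lop c)"
      by (simp add: lop_Omega lie_sum_left lie_simps)
    also have "lie_bracket (lop Omega) (lop c) - - lie_bracket (lop Omega) (lop c)
        = 2 *\<^sub>C lie_bracket (lop Omega) (lop c)"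
      by (simp add: scaleC_2)
    finally show "lie_bracket C (lop c) = 0"
      by (simp add: C_def lie_simps lie_scale_left)
  next
    \<comment> \<open>On the series 1 only the right multiplications contribute: n(n+1) ordered
      pairs times 2 / (n(n+1)).\<close>
    have a1: "op_app (aop a b) (unit_word []) = (\<lambda>w. if a = b then 0 else
        2 / (of_nat (CARD('n)) * (of_nat (CARD('n)) + 1)) * unit_word [None] w)" for a b :: "'n marks"
      by (simp add: aop_def op_app_simps dop_one rop_def rmul_one fun_eq_iff)
    have card: "card ?A = CARD('n) + 1"
      using sum_marks_minus [of "\<lambda>_. 1 :: nat"] by simp
    have "(\<Sum>a\<in>?A. \<Sum>b\<in>?A. if a = b then 0 else r) = of_nat (CARD('n)) * (of_nat (CARD('n)) + 1) * r" for r :: complex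
    proof -
      have "(\<Sum>b\<in>?A. if a = b then 0 else r) = of_nat (CARD('n)) * r" if "a \<in> ?A" for a
      proof -
        have "(\<Sum>b\<in>?A. if a = b then 0 else r) = (\<Sum>b\<in>?A - {a}. r)"
          by (rule sum.mono_neutral_cong_right) auto
        then show ?thesis
          using that card by simp
      qed
      then show ?thesis
        using card by simp
    qed
    moreover have "complex_of_nat (CARD('n)) + 1 \<noteq> 0"
      using of_nat_neq_0 [of "CARD('n)", where 'a = complex] by (simp add: add.commute)
    ultimately show "op_app C (unit_word []) = (\<lambda>w. 0)"
      unfolding C_def
      by (simp add: op_app_simps fun_eq_iff op_app_sum a1 kron_None [symmetric] unit_word_Cons)
  qed
  then show ?thesis
    by (simp add: C_def)
qed

lemma gop_sum: "(\<Sum>b\<in>UNIV - {a}. gop a b) = 0"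
proof (cases a)
  case None
  have "UNIV - {a} = range Some"
    using None by (auto simp: UNIV_option_conv)
  then show ?thesis
    using None by (simp add: sum.reindex sum_lop)
next
  case (Some c)
  have "UNIV - {a} = insert None (Some ` (UNIV - {c}))"
    using Some by (auto simp: image_iff UNIV_option_conv)
  then have *: "(\<Sum>b\<in>UNIV - {a}. gop a b) = lop c + (\<Sum>b\<in>UNIV - {c}. gop (Some c) (Some b))"
    using Some by (simp add: sum.reindex)
  show ?thesis
  proof (cases "c = Omega")
    case True
    have "(\<Sum>b\<in>UNIV - {c}. gop (Some c) (Some b)) = (\<Sum>b\<in>UNIV - {Omega}. oop b)"
      using True by (intro sum.cong) auto
    also have "\<dots> = - (\<Sum>a\<in>UNIV - {Omega}. \<Sum>b\<in>UNIV - {Omega}. aop a b) - (\<Sum>b\<in>UNIV - {Omega}. lop b)"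
      by (simp add: oop_def sum_subtractf sum_negf)
    also have "\<dots> = - (2 *\<^sub>C lop Omega) + lop Omega"
      by (simp add: sum_aop lop_Omega)
    also have "\<dots> = - lop Omega"
      by (simp add: scaleC_2)
    finally show ?thesis
      using * True by simp
  next
    case False
    have "(\<Sum>b\<in>UNIV - {c}. gop (Some c) (Some b)) = gop (Some c) (Some Omega)
        + (\<Sum>b\<in>UNIV - {c} - {Omega}. gop (Some c) (Some b))"
      using False by (intro sum.remove) auto
    also have "(\<Sum>b\<in>UNIV - {c} - {Omega}. gop (Some c) (Some b)) = (\<Sum>b\<in>UNIV - {Omega}. aop c b)"
      using False by (intro sum.mono_neutral_cong_left) (auto simp: aop_def)
    finally show ?thesis
      using * False by (simp add: oop_def)
  qed
qed

lemma gop_diag: "gop a a = 0"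
  by (cases a) (simp_all add: aop_def)

section \<open>Extension to the enveloping algebra\<close>

lift_definition lie_rep :: "'n::finite p_full \<Rightarrow> 'n option op" is "lie_eval gop"
  by (erule lie_eval_cong) (rule gop_sym gop_diag gop_sum gop_comm, assumption?)+

lemma lie_rep_simps:
  "lie_rep (x + y) = lie_rep x + lie_rep y"
  "lie_rep (c *\<^sub>C x) = c *\<^sub>C lie_rep x"
  "lie_rep (lie_bracket x y) = lie_bracket (lie_rep x) (lie_rep y)"
  "lie_rep (Xgen a b) = gop a b"
  by (transfer, simp)+

primrec uea_eval :: "'n::finite p_full uterm \<Rightarrow> 'n option op" where
  "uea_eval (UEmb x) = lie_rep x"
| "uea_eval UZero = 0"
| "uea_eval UOne = 1"
| "uea_eval (UAdd t u) = uea_eval t + uea_eval u"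
| "uea_eval (UScale c t) = c *\<^sub>C uea_eval t"
| "uea_eval (UMul t u) = uea_eval t * uea_eval u"

lemma uea_eval_cong: "uea_eq t u \<Longrightarrow> uea_eval t = uea_eval u"
proof (induction rule: uea_eq.induct)
  case (add_comm t u)
  then show ?case by (simp add: add.commute)
next
  case (mul_assoc t u v)
  then show ?case by (simp add: mult.assoc)
qed (simp_all add: lie_rep_simps lie_bracket_op_def scaleC_right_distrib scaleC_left_distrib
    scaleC_scaleC scaleC_one add.assoc algebra_simps op_mult_scaleC)

lift_definition rep :: "'n::finite p_full uea \<Rightarrow> 'n option op" is uea_eval
  by (rule uea_eval_cong)

lemma rep_simps:
  "rep 0 = 0" "rep 1 = 1" "rep (u + v) = rep u + rep v" "rep (c *\<^sub>C u) = c *\<^sub>C rep u"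
  "rep (u * v) = rep u * rep v" "rep (XU a b) = gop a b"
proof -
  show "rep 0 = 0" by transfer simp
  show "rep 1 = 1" by transfer simp
  show "rep (u + v) = rep u + rep v" by transfer simp
  show "rep (c *\<^sub>C u) = c *\<^sub>C rep u" by transfer simp
  show "rep (u * v) = rep u * rep v" by transfer simp
  show "rep (XU a b) = gop a b" by transfer (simp add: lie_rep_simps)
qed

text \<open>The derivations replace two adjacent letters by one of them, never by \<open>X\<^sub>\<beta>\<^sub>\<omega>\<close>.  Hence the power
  series vanishing on a set of words that is closed under such contractions form a submodule.\<close>

definition contr_closed :: "('n option list \<Rightarrow> bool) \<Rightarrow> bool" where
  "contr_closed Q \<longleftrightarrow> (\<forall>u p q v x. Q (u @ p # q # v) \<longrightarrow> x \<in> {p, q} \<longrightarrow> x \<noteq> None \<longrightarrow> Q (u @ x # v))"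

lemma deriv_fun_vanish:
  assumes "contr_closed Q" "\<And>w. Q w \<Longrightarrow> f w = 0" "Q w"
    and "\<And>x p q. \<delta> x p q \<noteq> 0 \<Longrightarrow> x \<in> {p, q} \<and> x \<noteq> None"
  shows "deriv_fun \<delta> f w = 0"
  using assms(1-3)
proof (induction w arbitrary: f Q)
  case (Cons p w)
  have "deriv_fun \<delta> (\<lambda>v. f (p # v)) w = 0"
  proof (rule Cons.IH [of "\<lambda>v. Q (p # v)"])
    show "contr_closed (\<lambda>v. Q (p # v))"
      using Cons.prems(1) unfolding contr_closed_def by (metis append_Cons)
  qed (use Cons.prems in auto)
  moreover have "(case w of [] \<Rightarrow> 0 | q # v \<Rightarrow> \<Sum>x\<in>UNIV. \<delta> x p q * f (x # v)) = 0"
  proof (cases w)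
    case (Cons q v)
    have "\<delta> x p q * f (x # v) = 0" for x
    proof (cases "\<delta> x p q = 0")
      case False
      then have "Q (x # v)"
        using Cons.prems(1,3) assms(4) [OF False] Cons unfolding contr_closed_def
        by (metis append_Nil)
      then show ?thesis
        using Cons.prems(2) by simp
    qed simp
    then show ?thesis
      unfolding Cons by (auto intro: sum.neutral)
  qed simp
  ultimately show ?case
    by simp
qed simp

text \<open>A nonzero coefficient means that the contracted letter is X_a\<beta> or X_b\<beta>, and
  this is a factor of every term of their commutator.\<close>

lemma dop_vanish:
  assumes "contr_closed Q" "\<And>w. Q w \<Longrightarrow> f w = 0" "Q w"
  shows "op_app (dop a b) f w = 0"
  unfolding dop_def deriv_op.rep_eq
proof (rule deriv_fun_vanish [OF assms])
  fix x p q
  assume "(mark_ind a x - mark_ind b x)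
     * (mark_coord a p * mark_coord b q - mark_coord b p * mark_coord a q) \<noteq> 0"
  then show "x \<in> {p, q} \<and> x \<noteq> None"
    by (cases a; cases b) (auto simp: kron_def of_bool_def split: if_splits)
qed

definition vanishing :: "('n option list \<Rightarrow> bool) \<Rightarrow> 'n option op set" where
  "vanishing Q = {T. \<forall>f. (\<forall>w. Q w \<longrightarrow> f w = 0) \<longrightarrow> (\<forall>w. Q w \<longrightarrow> op_app T f w = 0)}"

lemma vanishing_closed:
  "0 \<in> vanishing Q"
  "S \<in> vanishing Q \<Longrightarrow> T \<in> vanishing Q \<Longrightarrow> S + T \<in> vanishing Q"
  "S \<in> vanishing Q \<Longrightarrow> T \<in> vanishing Q \<Longrightarrow> S - T \<in> vanishing Q"
  "S \<in> vanishing Q \<Longrightarrow> - S \<in> vanishing Q"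
  "S \<in> vanishing Q \<Longrightarrow> c *\<^sub>C S \<in> vanishing Q"
  "S \<in> vanishing Q \<Longrightarrow> T \<in> vanishing Q \<Longrightarrow> S * T \<in> vanishing Q"
  "1 \<in> vanishing Q"
  by (auto simp: vanishing_def op_app_simps)

lemma vanishing_sum: "(\<And>i. i \<in> I \<Longrightarrow> T i \<in> vanishing Q) \<Longrightarrow> (\<Sum>i\<in>I. T i) \<in> vanishing Q"
  by (induction I rule: infinite_finite_induct) (auto intro: vanishing_closed)

text \<open>The three closure conditions match the three kinds of operators: derivations contract
  neighbours, left multiplications drop the first letter, and \<open>rop\<close> drops a final
  X_\<beta>\<omega>.\<close>

lemma gop_vanishing:
  assumes contr: "contr_closed Q" and tl: "\<And>p w. Q (p # w) \<Longrightarrow> Q w"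
    and last: "\<And>w. Q (w @ [None]) \<Longrightarrow> Q w"
  shows "gop a b \<in> vanishing Q"
proof -
  have l: "lop c \<in> vanishing Q" for c
  proof -
    have "op_app (lop c) f w = 0" if "\<forall>w. Q w \<longrightarrow> f w = 0" "Q w" for f w
      using that tl by (cases w) (auto simp: lop_def)
    then show ?thesis
      by (simp add: vanishing_def)
  qed
  have "op_app (rmul None) f w = 0" if "\<forall>w. Q w \<longrightarrow> f w = 0" "Q w" for f w
    using that last by (cases w rule: rev_cases) (auto simp: rmul.rep_eq)
  then have "rmul None \<in> vanishing Q"
    by (simp add: vanishing_def)
  then have r: "rop \<in> vanishing Q"
    unfolding rop_def by (rule vanishing_closed)
  have "dop c d \<in> vanishing Q" for c d
    using dop_vanish [OF contr] by (auto simp: vanishing_def)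
  then have a: "aop c d \<in> vanishing Q" for c d
    by (simp add: aop_def vanishing_closed r)
  then have "oop c \<in> vanishing Q" for c
    unfolding oop_def by (intro vanishing_closed vanishing_sum l)
  with l a show ?thesis
    by (cases a; cases b) (auto intro: vanishing_closed)
qed

section \<open>Words in the enveloping algebra\<close>

lemma emb_lin:
  fixes x y :: "'g::complex_lie"
  shows "emb (0 :: 'g) = 0" "emb (- x) = - emb x" "emb (x - y) = emb x - emb y"
proof -
  show 0: "emb 0 = (0 :: 'g::complex_lie uea)"
    using emb_scaleC [of 0 0] by simp
  have "emb (- x) + emb x = 0" for x :: 'g
    by (simp add: 0 flip: emb_add)
  then show m: "emb (- x) = - emb x" for x :: 'g
    by (rule eq_neg_iff_add_eq_0 [THEN iffD2])
  show "emb (x - y) = emb x - emb y"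
    using emb_add [of x "- y"] by (simp add: m)
qed

lemma emb_sum: "emb (\<Sum>i\<in>I. f i) = (\<Sum>i\<in>I. emb (f i))"
  by (induction I rule: infinite_finite_induct) (simp_all add: emb_lin emb_add)

lemma sbraid_induct [case_names gen zero add scale bracket]:
  fixes x :: "'v::finite sbraid"
  assumes "\<And>a b. P (Xgen a b)" "P 0" "\<And>x y. P x \<Longrightarrow> P y \<Longrightarrow> P (x + y)"
    "\<And>c x. P x \<Longrightarrow> P (c *\<^sub>C x)" "\<And>x y. P x \<Longrightarrow> P y \<Longrightarrow> P (lie_bracket x y)"
  shows "P x"
proof (induction x rule: sbraid.abs_induct)
  case (1 t)
  show ?case
    by (induction t)
      (use assms in \<open>simp_all add: Xgen.abs_eq zero_sbraid.abs_eq plus_sbraid.abs_eq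
        scaleC_sbraid.abs_eq lie_bracket_sbraid.abs_eq flip: Xgen.abs_eq zero_sbraid.abs_eq plus_sbraid.abs_eq
        scaleC_sbraid.abs_eq lie_bracket_sbraid.abs_eq\<close>)
qed

lemma uea_induct [case_names gen zero one add scale mult]:
  fixes u :: "'v::finite sbraid uea"
  assumes gen: "\<And>a b. P (XU a b)" and "P 0" "P 1"
    and add: "\<And>u v. P u \<Longrightarrow> P v \<Longrightarrow> P (u + v)"
    and scale: "\<And>c u. P u \<Longrightarrow> P (c *\<^sub>C u)" and mult: "\<And>u v. P u \<Longrightarrow> P v \<Longrightarrow> P (u * v)"
  shows "P u"
proof -
  have diff: "P (u - v)" if "P u" "P v" for u v
  proof -
    have "(- 1) *\<^sub>C v = - v" by (simp add: cvec.scale_minus_left scaleC_one)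
    then show ?thesis
      using add [OF that(1) scale [OF that(2), of "- 1"]] by simp
  qed
  have emb: "P (emb x)" for x
    by (induction x rule: sbraid_induct) (simp_all add: assms emb_lin emb_add emb_scaleC emb_bracket diff)
  have "P (abs_uea t)" for t
    by (induction t)
      (use emb assms in \<open>simp_all flip: emb.abs_eq zero_uea_def one_uea_def plus_uea.abs_eq
        scaleC_uea.abs_eq times_uea.abs_eq\<close>)
  then show ?thesis
    by (induction u rule: uea.abs_induct) simp
qed

primrec letter :: "'n::finite option \<Rightarrow> 'n p_full uea" where
  "letter None = XU be om"
| "letter (Some i) = XU (pt i) be"

definition mword :: "'n::finite option list \<Rightarrow> 'n p_full uea" where
  "mword w = prod_list (map letter w)"

lemma mword_simps [simp]: "mword [] = 1" "mword (p # w) = letter p * mword w"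
  "mword (v @ w) = mword v * mword w"
  by (simp_all add: mword_def)

definition coef :: "'n::finite option list \<Rightarrow> 'n p_full uea \<Rightarrow> complex" where
  "coef w u = op_app (rep u) (unit_word []) w"

lemma coef_simps: "coef w 0 = 0" "coef w (u + v) = coef w u + coef w v" "coef w (c *\<^sub>C u) = c * coef w u"
  by (simp_all add: coef_def rep_simps op_app_simps)

lemma coef_linear: "Vector_Spaces.linear scaleC (*) (coef w)"
proof -
  interpret vector_space "(*) :: complex \<Rightarrow> complex \<Rightarrow> complex"
    by unfold_locales (simp_all add: algebra_simps)
  show ?thesis
    by unfold_locales (simp_all add: coef_simps)
qed

lemma rep_letter: "rep (letter p) = lmul (kron p)"
  by (cases p) (simp_all add: rep_simps kron_None kron_Some)

lemma coef_letter_Cons: "coef (q # w) (letter p * u) = of_bool (p = q) * coef w u"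
  by (simp add: coef_def rep_simps rep_letter op_app_simps kron_def eq_commute)

text \<open>Letters act by left multiplication, so a word sends the series 1 to itself.\<close>

lemma coef_mword: "coef w (mword v) = of_bool (w = v)"
proof -
  have "op_app (rep (mword v)) (unit_word []) = unit_word v"
    by (induction v) (simp_all add: rep_simps rep_letter op_app_simps unit_word_Cons)
  then show ?thesis
    by (simp add: coef_def unit_word_def)
qed

text \<open>Indices decrease weakly along the word although \<kappa> increases, because the first
  letter is the outermost integration and belongs to the last entry of \<kappa>.\<close>

definition adm :: "'n::linorder option list \<Rightarrow> bool" where
  "adm w \<longleftrightarrow> (w = [] \<or> last w \<noteq> None) \<and> sorted_wrt (\<lambda>p q. \<forall>i j. p = Some i \<longrightarrow> q = Some j \<longrightarrow> j \<le> i) w"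

section \<open>Ideals\<close>

lemma left_idealD:
  assumes "left_ideal I"
  shows "0 \<in> I" "x \<in> I \<Longrightarrow> y \<in> I \<Longrightarrow> x + y \<in> I" "x \<in> I \<Longrightarrow> y \<in> I \<Longrightarrow> x - y \<in> I" "x \<in> I \<Longrightarrow> - x \<in> I"
    "x \<in> I \<Longrightarrow> c *\<^sub>C x \<in> I" "x \<in> I \<Longrightarrow> u * x \<in> I"
  using assms unfolding left_ideal_def
  by (auto intro: cvec.subspace_0 cvec.subspace_add cvec.subspace_diff cvec.subspace_neg cvec.subspace_scale)

lemma left_ideal_sum_mem: "left_ideal I \<Longrightarrow> (\<And>k. k \<in> K \<Longrightarrow> f k \<in> I) \<Longrightarrow> (\<Sum>k\<in>K. f k) \<in> I"
  by (simp add: left_ideal_def cvec.subspace_sum)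

lemma left_ideal_span_prod:
  assumes "\<And>u a. a \<in> A \<Longrightarrow> u * a \<in> A"
  shows "left_ideal (span_prod A B)"
  unfolding left_ideal_def span_prod_def
proof (intro conjI allI ballI)
  fix u x
  assume "x \<in> cvec.span {a * b |a b. a \<in> A \<and> b \<in> B}"
  then show "u * x \<in> cvec.span {a * b |a b. a \<in> A \<and> b \<in> B}"
  proof (induction rule: cvec.span_induct_alt)
    case (step c x y)
    then obtain a b where "x = a * b" "a \<in> A" "b \<in> B"
      by blast
    then have "u * x \<in> {a * b |a b. a \<in> A \<and> b \<in> B}"
      using assms [of a u] by (auto simp flip: mult.assoc)
    then show ?case
      using step.IH by (simp add: distrib_left scaleC_mult_right cvec.span_add cvec.span_scale cvec.span_base)
  qed (simp add: cvec.span_zero)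
qed (rule cvec.subspace_span)

lemma left_ideal_plus:
  assumes "left_ideal A" "left_ideal B"
  shows "left_ideal (A + B)"
proof -
  have "A + B = {x + y |x y. x \<in> A \<and> y \<in> B}"
    by (auto simp: set_plus_def)
  moreover have "cvec.subspace {x + y |x y. x \<in> A \<and> y \<in> B}"
    using assms by (auto simp: left_ideal_def intro: cvec.subspace_sums)
  ultimately have "cvec.subspace (A + B)"
    by simp
  then show ?thesis
    using assms by (auto simp: left_ideal_def set_plus_def distrib_left) blast
qed

lemma left_ideal_sum:
  "(\<And>k. k \<in> K \<Longrightarrow> left_ideal (A k)) \<Longrightarrow> left_ideal (\<Sum>k\<in>K. A k)"
proof (induction K rule: infinite_finite_induct)
  case (insert k K)
  then show ?case by (simp add: left_ideal_plus)
qed (auto simp: left_ideal_def cvec.subspace_def)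

lemma span_prod_subset:
  assumes "cvec.subspace Z" "\<And>a b. a \<in> A \<Longrightarrow> b \<in> B \<Longrightarrow> a * b \<in> Z"
  shows "span_prod A B \<subseteq> Z"
  unfolding span_prod_def using assms by (intro cvec.span_minimal) auto

lemma gen_ideal_subset: "two_sided_ideal I \<Longrightarrow> x \<in> I \<Longrightarrow> gen_ideal x \<subseteq> I"
  unfolding gen_ideal_def by (rule hull_minimal) auto

lemma gen_ideal_mem: "x \<in> gen_ideal x"
  and gen_ideal_mult: "a \<in> gen_ideal x \<Longrightarrow> u * a \<in> gen_ideal x" "a \<in> gen_ideal x \<Longrightarrow> a * u \<in> gen_ideal x"
proof -
  show "x \<in> gen_ideal x"
    unfolding gen_ideal_def by (auto simp: hull_def)
  show "u * a \<in> gen_ideal x" "a * u \<in> gen_ideal x" if "a \<in> gen_ideal x"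
    using that unfolding gen_ideal_def by (auto simp: hull_def two_sided_ideal_def)
qed

lemma set_plus_subset:
  fixes Z :: "'g::complex_lie uea set"
  assumes "cvec.subspace Z" "A \<subseteq> Z" "B \<subseteq> Z"
  shows "A + B \<subseteq> Z"
  using assms cvec.subspace_add [of Z] by (auto simp: set_plus_def)

lemma set_sum_subset:
  fixes Z :: "'g::complex_lie uea set"
  assumes "cvec.subspace Z" "\<And>k. k \<in> K \<Longrightarrow> A k \<subseteq> Z"
  shows "(\<Sum>k\<in>K. A k) \<subseteq> Z"
  using assms(2)
proof (induction K rule: infinite_finite_induct)
  case (insert k K)
  then show ?case by (simp add: assms(1) set_plus_subset)
qed (simp_all add: cvec.subspace_0 assms(1))

lemma set_sum_superset:
  fixes A :: "'k \<Rightarrow> 'g::complex_lie uea set"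
  assumes "finite K" "k \<in> K" "\<And>k. k \<in> K \<Longrightarrow> left_ideal (A k)"
  shows "A k \<subseteq> (\<Sum>k\<in>K. A k)"
proof -
  have "0 \<in> (\<Sum>k\<in>K - {k}. A k)"
    using left_ideal_sum [of "K - {k}" A] assms(3) by (auto intro: left_idealD)
  then have "A k \<subseteq> A k + (\<Sum>k\<in>K - {k}. A k)"
    by (force simp: set_plus_def)
  then show ?thesis
    using assms(1,2) by (simp add: sum.remove)
qed

lemma set_plus_superset:
  fixes A B :: "'g::complex_lie uea set"
  shows "left_ideal B \<Longrightarrow> A \<subseteq> A + B" "left_ideal A \<Longrightarrow> B \<subseteq> A + B"
  by (force simp: set_plus_def dest: left_idealD(1))+

section \<open>Linear relations among the generators\<close>

lemma marks_sum_zero: "XU be om = - (XU be al + (\<Sum>i\<in>UNIV. XU be (pt (i::'n::finite))))"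
proof -
  have "UNIV - {be} = range (Some :: 'n marks \<Rightarrow> _)"
    by (auto simp: UNIV_option_conv)
  then have "(\<Sum>a\<in>UNIV. XU be (Some (a :: 'n marks))) = 0"
    using Xgen_sum [of "be :: 'n marks option"] by (simp add: sum.reindex flip: emb_sum emb_lin(1))
  then have "XU be om + (XU be al + (\<Sum>i\<in>UNIV. XU be (pt (i::'n)))) = 0"
    by (simp add: sum_marks add_ac)
  then show ?thesis
    by (rule eq_neg_iff_add_eq_0 [THEN iffD2])
qed

lemma option_minus: "UNIV - {Some c} = insert None (Some ` (UNIV - {c}))"
  by (auto simp: image_iff UNIV_option_conv)

lemma Xgen_Omega:
  assumes "a \<noteq> Omega"
  shows "Xgen (Some a) om = - Xgen be (Some a) - (\<Sum>b\<in>UNIV - {Omega}. Xgen (Some a) (Some (b :: 'n::finite marks)))"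
proof -
  have "(\<Sum>b\<in>UNIV - {Some a}. Xgen (Some a) b)
      = Xgen (Some a) be + (\<Sum>b\<in>UNIV - {a}. Xgen (Some a) (Some b))"
    by (simp add: option_minus sum.reindex)
  also have "(\<Sum>b\<in>UNIV - {a}. Xgen (Some a) (Some b)) = (\<Sum>b\<in>UNIV. Xgen (Some a) (Some b))"
    by (intro sum.mono_neutral_left) (auto simp: Xgen_diag)
  also have "\<dots> = Xgen (Some a) om + (\<Sum>b\<in>UNIV - {Omega}. Xgen (Some a) (Some b))"
    by (simp add: sum.remove [of UNIV Omega])
  finally have "Xgen (Some a) om + (Xgen be (Some a) + (\<Sum>b\<in>UNIV - {Omega}. Xgen (Some a) (Some b))) = 0"
    by (simp add: Xgen_sum Xgen_sym [of be] add_ac)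
  then show ?thesis
    by (simp add: eq_neg_iff_add_eq_0 [symmetric])
qed

text \<open>Sum the relations at all marks other than \<omega>; the relations at \<beta> and at
  \<omega> turn the terms incident with these two points into multiples of
  X_\<beta>\<omega>.\<close>

lemma Xgen_beta_omega_pairs:
  "2 *\<^sub>C Xgen be om = (\<Sum>a\<in>UNIV - {Omega}. \<Sum>b\<in>UNIV - {Omega}. Xgen (Some a) (Some (b :: 'n::finite marks)))"
proof -
  let ?A = "UNIV - {Omega :: 'n marks}"
  have "UNIV - {be} = range (Some :: 'n marks \<Rightarrow> _)"
    by (auto simp: UNIV_option_conv)
  then have "(\<Sum>a\<in>UNIV. Xgen be (Some (a :: 'n marks))) = 0"
    using Xgen_sum [of "be :: 'n marks option"] by (simp add: sum.reindex)
  then have b: "(\<Sum>a\<in>?A. Xgen be (Some a)) = - Xgen be om"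
    by (simp add: sum.remove [of UNIV Omega] eq_neg_iff_add_eq_0 add.commute)
  have "Xgen om be + (\<Sum>a\<in>?A. Xgen om (Some a)) = 0"
    using Xgen_sum [of "om :: 'n marks option"] by (simp add: option_minus sum.reindex)
  then have "Xgen be om + (\<Sum>a\<in>?A. Xgen (Some a) om) = 0"
    by (simp add: Xgen_sym [of om])
  moreover have "(\<Sum>a\<in>?A. Xgen (Some a) om) = - (\<Sum>a\<in>?A. Xgen be (Some a)) - (\<Sum>a\<in>?A. \<Sum>b\<in>?A. Xgen (Some a) (Some b))"
    by (simp add: Xgen_Omega sum_subtractf sum_negf)
  ultimately show ?thesis
    unfolding b by (simp add: scaleC_2 algebra_simps)
qed

text \<open>In \<open>\<pp>\<^sub>m\<^sub>-\<^sub>1\<close> the generators \<open>X\<^sub>a\<^sub>b\<close> with \<open>a, b \<noteq> \<omega>\<close> sum to zero, which expresses the one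
  generator \<open>X\<^sub>\<alpha>\<^sub>n\<close> not prescribed by the section through the others.\<close>

lemma Xgen_sub_Omega:
  assumes "a \<noteq> Omega"
  shows "Xgen a Omega = - (\<Sum>b\<in>UNIV - {Omega}. Xgen a (b :: 'n::finite marks))"
proof -
  have "(\<Sum>b\<in>UNIV - {a}. Xgen a b) = (\<Sum>b\<in>UNIV. Xgen a b)"
    by (intro sum.mono_neutral_left) (auto simp: Xgen_diag)
  also have "\<dots> = Xgen a Omega + (\<Sum>b\<in>UNIV - {Omega}. Xgen a b)"
    by (simp add: sum.remove [of UNIV Omega])
  finally show ?thesis
    by (simp add: Xgen_sum eq_neg_iff_add_eq_0)
qed

lemma Xgen_sub_pairs:
  "(\<Sum>a\<in>UNIV - {Omega}. \<Sum>b\<in>UNIV - {Omega}. Xgen a (b :: 'n::finite marks)) = 0"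
proof -
  have "(\<Sum>a\<in>UNIV - {Omega}. \<Sum>b\<in>UNIV - {Omega}. Xgen a (b :: 'n marks))
      = - (\<Sum>a\<in>UNIV - {Omega}. Xgen Omega a)"
    by (simp add: sum_negf [symmetric] Xgen_sym [of Omega] Xgen_sub_Omega)
  then show ?thesis
    by (simp add: Xgen_sum)
qed

lemma sum_sum_marks:
  assumes "\<And>a b. f a b = f b a" "\<And>a. f a a = 0"
  shows "(\<Sum>a\<in>UNIV - {Omega}. \<Sum>b\<in>UNIV - {Omega}. f a b)
    = 2 *\<^sub>C ((\<Sum>i\<in>UNIV. f Alpha (Pt i)) + (\<Sum>(i, j)\<in>{(i, j). i < j}. f (Pt i) (Pt (j :: 'n::{finite,linorder}))) :: 'a::complex_vec)"
proof -
  have "(\<Sum>i\<in>UNIV. \<Sum>j\<in>UNIV. f (Pt i) (Pt j)) = (\<Sum>(i, j)\<in>UNIV. f (Pt i) (Pt j))"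
    by (simp add: sum.cartesian_product)
  also have "UNIV = {(i, j). i < j} \<union> ({(i, j). j < i} \<union> {(i, j :: 'n). i = j})"
    by auto
  also have "(\<Sum>(i, j)\<in>\<dots>. f (Pt i) (Pt j)) = (\<Sum>(i, j)\<in>{(i, j). i < j}. f (Pt i) (Pt j))
      + ((\<Sum>(i, j)\<in>{(i, j). j < i}. f (Pt i) (Pt j)) + (\<Sum>(i, j)\<in>{(i, j :: 'n). i = j}. f (Pt i) (Pt j)))"
    by (subst sum.union_disjoint, auto)+
  also have "(\<Sum>(i, j)\<in>{(i, j). j < i}. f (Pt i) (Pt j)) = (\<Sum>(i, j)\<in>{(i, j). i < j}. f (Pt i) (Pt j))"
    by (rule sum.reindex_bij_witness [of _ prod.swap prod.swap]) (auto simp: assms(1))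
  also have "(\<Sum>(i, j)\<in>{(i, j :: 'n). i = j}. f (Pt i) (Pt j)) = 0"
    by (rule sum.neutral) (auto simp: assms(2))
  finally show ?thesis
    by (simp add: sum_marks_minus assms(2) assms(1) [of _ Alpha] sum.distrib scaleC_2 add_ac)
qed

text \<open>Used twice: it puts the generator X_\<alpha>n, which the section does not fix, into the
  ideal, and it recombines the contractions by all X_\<alpha>i and X_ij in the equation for
  x_n.\<close>

lemma Xgen_beta_omega: "Xgen be om = (\<Sum>i\<in>UNIV. Xgen al (pt i))
    + (\<Sum>(i, j)\<in>{(i, j). i < j}. Xgen (pt i) (pt (j :: 'n::{finite,linorder})))"
  (is "_ = ?S")
proof -
  have "2 *\<^sub>C Xgen be om = 2 *\<^sub>C ?S"
    unfolding Xgen_beta_omega_pairs by (rule sum_sum_marks) (simp_all add: Xgen_sym Xgen_diag)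
  then show ?thesis
    by (simp add: cvec.scale_cancel_left)
qed

lemma Xgen_sub_zero: "(\<Sum>i\<in>UNIV. Xgen Alpha (Pt i))
    + (\<Sum>(i, j)\<in>{(i, j). i < j}. Xgen (Pt i) (Pt (j :: 'n::{finite,linorder}))) = 0" (is "?S = _")
proof -
  have "2 *\<^sub>C ?S = 0"
    unfolding Xgen_sub_pairs [symmetric]
    by (rule sum_sum_marks [symmetric]) (simp_all add: Xgen_sym Xgen_diag)
  then show ?thesis
    by simp
qed

section \<open>The image of the section\<close>

context
  fixes s :: "'n::{finite,linorder} p_sub \<Rightarrow> 'n p_full"
  assumes beta_sec: "beta_section s"
begin

lemma s_linear: "s 0 = 0" "s (x + y) = s x + s y" "s (c *\<^sub>C x) = c *\<^sub>C s x" "s (- x) = - s x"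
  "s (x - y) = s x - s y" "s (sum f I) = (\<Sum>i\<in>I. s (f i))"
proof -
  interpret Vector_Spaces.linear scaleC scaleC s
    using beta_sec by (simp add: beta_section_def lie_hom_def)
  show "s 0 = 0" "s (x + y) = s x + s y" "s (c *\<^sub>C x) = c *\<^sub>C s x" "s (- x) = - s x"
    "s (x - y) = s x - s y" "s (sum f I) = (\<Sum>i\<in>I. s (f i))"
    by (rule zero add scale neg diff sum)+
qed

lemma s_gens:
  "s (lie_bracket x y) = lie_bracket (s x) (s y)"
  "i < Max UNIV \<Longrightarrow> s (Xgen Alpha (Pt i)) = Xgen al (pt i)"
  "i < j \<Longrightarrow> s (Xgen (Pt i) (Pt j)) = Xgen (pt i) (pt j)"
  using beta_sec by (simp_all add: beta_section_def lie_hom_def)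

text \<open>A left ideal containing x and y contains xy - yx, so it is enough to treat generators of
  p_(m-1); linear relations reduce these to the ones prescribed by the section.\<close>

lemma emb_section_mem:
  assumes I: "left_ideal I"
    and al: "\<And>i. i < Max UNIV \<Longrightarrow> XU al (pt i) \<in> I" and pt: "\<And>i j. i < j \<Longrightarrow> XU (pt i) (pt j) \<in> I"
  shows "emb (s y) \<in> I"
proof (induction y rule: sbraid_induct)
  case zero
  then show ?case by (simp add: s_linear emb_lin left_idealD [OF I])
next
  case (add x y)
  then show ?case by (simp add: s_linear emb_add left_idealD [OF I])
next
  case (scale c x)
  then show ?case by (simp add: s_linear emb_scaleC left_idealD [OF I])
next
  case (bracket x y)
  then show ?case by (simp add: s_gens emb_bracket left_idealD [OF I])
next
  case (gen a b)
  have pts: "emb (s (Xgen (Pt i) (Pt j))) \<in> I" for i j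
  proof (cases i j rule: linorder_cases)
    case greater
    then show ?thesis
      using pt [of j i] by (simp add: s_gens Xgen_sym [of "Pt i"])
  qed (simp_all add: pt s_gens Xgen_diag s_linear emb_lin left_idealD [OF I])
  have alp: "emb (s (Xgen Alpha (Pt i))) \<in> I" for i
  proof (cases "i = Max UNIV")
    case True
    have "Xgen Alpha (Pt i) = - ((\<Sum>k\<in>UNIV - {i}. Xgen Alpha (Pt k))
        + (\<Sum>(i, j)\<in>{(i, j). i < j}. Xgen (Pt i) (Pt j)))"
      using Xgen_sub_zero [where 'n = 'n]
      by (intro eq_neg_iff_add_eq_0 [THEN iffD2]) (simp add: sum.remove [of UNIV i] add.assoc)
    also have "emb (s \<dots>) = - ((\<Sum>k\<in>UNIV - {i}. emb (s (Xgen Alpha (Pt k))))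
        + (\<Sum>(i, j)\<in>{(i, j). i < j}. emb (s (Xgen (Pt i) (Pt j)))))"
      by (simp only: s_linear emb_lin emb_add emb_sum case_prod_unfold)
    also have "\<dots> \<in> I"
    proof (intro left_idealD [OF I] left_ideal_sum_mem [OF I])
      fix k assume "k \<in> UNIV - {i}"
      then have "k < Max UNIV"
        using True Max_ge [of UNIV k] by (simp add: less_le)
      then show "emb (s (Xgen Alpha (Pt k))) \<in> I"
        using al by (simp add: s_gens)
    qed (auto simp: pts)
    finally show ?thesis .
  next
    case False
    then have "i < Max UNIV"
      using Max_ge [of UNIV i] by (simp add: less_le)
    then show ?thesis
      using al by (simp add: s_gens)
  qed
  have AA: "emb (s (Xgen a b)) \<in> I" if "a \<noteq> Omega" "b \<noteq> Omega" for a b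
    using that pts alp
    by (cases a; cases b) (simp_all add: Xgen_diag s_linear emb_lin left_idealD [OF I] Xgen_sym [of _ Alpha])
  have AO: "emb (s (Xgen a Omega)) \<in> I" for a
  proof (cases "a = Omega")
    case False
    then show ?thesis
      unfolding Xgen_sub_Omega [OF False] s_linear emb_lin emb_sum
      by (intro left_idealD [OF I] left_ideal_sum_mem [OF I] AA) auto
  qed (simp add: Xgen_diag s_linear emb_lin left_idealD [OF I])
  show ?case
    by (metis AA AO Xgen_sym)
qed

end

section \<open>The left ideal J and its summands\<close>

definition polylog_ideal :: "('n::{finite,linorder} p_sub \<Rightarrow> 'n p_full) \<Rightarrow> 'n p_full uea set" where
  "polylog_ideal s = span_prod UNIV (range (\<lambda>y. emb (s y))) + span_prod UNIV {XU be om}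
      + (\<Sum>(i, j)\<in>{(i, j). i < j}. span_prod (gen_ideal (XU (pt i) be)) (gen_ideal (XU (pt j) be)))"

lemma left_ideal_summands:
  "left_ideal (span_prod UNIV B)" "left_ideal (span_prod (gen_ideal x) B)"
  "left_ideal (\<Sum>(i, j)\<in>K. span_prod (gen_ideal (f i)) (C j))"
proof -
  show *: "left_ideal (span_prod UNIV B)" "left_ideal (span_prod (gen_ideal x) B)" for x B
    by (auto intro: left_ideal_span_prod gen_ideal_mult(1))
  show "left_ideal (\<Sum>(i, j)\<in>K. span_prod (gen_ideal (f i)) (C j))"
    by (intro left_ideal_sum) (auto intro: *)
qed

lemma left_ideal_polylog_ideal: "left_ideal (polylog_ideal s)"
  unfolding polylog_ideal_def by (intro left_ideal_plus left_ideal_summands)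

lemma span_prod_base: "a \<in> A \<Longrightarrow> b \<in> B \<Longrightarrow> a * b \<in> span_prod A B"
  unfolding span_prod_def by (rule cvec.span_base) blast

lemma polylog_ideal_mem:
  shows "u * emb (s y) \<in> polylog_ideal s" "u * XU be om \<in> polylog_ideal s"
    "i < j \<Longrightarrow> a \<in> gen_ideal (XU (pt i) be) \<Longrightarrow> b \<in> gen_ideal (XU (pt j) be) \<Longrightarrow> a * b \<in> polylog_ideal s"
proof -
  let ?A = "span_prod UNIV (range (\<lambda>y. emb (s y)))" and ?B = "span_prod UNIV {XU be om :: 'a p_full uea}"
    and ?C = "\<Sum>(i, j)\<in>{(i, j). i < j}. span_prod (gen_ideal (XU (pt i) be)) (gen_ideal (XU (pt j) (be :: 'a marks option)))"
  have AB: "?A + ?B \<subseteq> polylog_ideal s"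
    unfolding polylog_ideal_def by (intro set_plus_superset left_ideal_summands)
  have "u * emb (s y) \<in> ?A"
    by (intro span_prod_base) auto
  also have "?A \<subseteq> ?A + ?B"
    by (intro set_plus_superset left_ideal_summands)
  finally show "u * emb (s y) \<in> polylog_ideal s"
    using AB by blast
  have "u * XU be om \<in> ?B"
    by (intro span_prod_base) auto
  also have "?B \<subseteq> ?A + ?B"
    by (intro set_plus_superset left_ideal_summands)
  finally show "u * XU be om \<in> polylog_ideal s"
    using AB by blast
  assume ij: "i < j" and "a \<in> gen_ideal (XU (pt i) be)" "b \<in> gen_ideal (XU (pt j) be)"
  then have "a * b \<in> (\<lambda>(i, j). span_prod (gen_ideal (XU (pt i) be)) (gen_ideal (XU (pt j) be))) (i, j)"
    by (simp add: span_prod_base)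
  also have "\<dots> \<subseteq> ?C"
    using ij by (intro set_sum_superset) (auto intro: left_ideal_summands)
  also have "?C \<subseteq> polylog_ideal s"
    unfolding polylog_ideal_def by (intro set_plus_superset left_ideal_plus left_ideal_summands)
  finally show "a * b \<in> polylog_ideal s" .
qed

section \<open>Words span the quotient by the ideal\<close>

text \<open>Bracket X_ac with the relation at b: only the terms X_ba and X_bc survive.\<close>

lemma lie_generators:
  assumes "distinct [a, b, c]"
  shows "lie_bracket (Xgen a b) (Xgen a c) = lie_bracket (Xgen a c) (Xgen b (c :: 'v::finite))"
proof -
  have "(\<Sum>d\<in>UNIV - {b}. lie_bracket (Xgen a c) (Xgen b d)) = lie_bracket (Xgen a c) (\<Sum>d\<in>UNIV - {b}. Xgen b d)"
    by (simp add: lie_sum_right)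
  also have "\<dots> = 0"
    by (simp add: Xgen_sum lie_simps)
  also have "(\<Sum>d\<in>UNIV - {b}. lie_bracket (Xgen a c) (Xgen b d)) = (\<Sum>d\<in>{a, c}. lie_bracket (Xgen a c) (Xgen b d))"
    using assms by (intro sum.mono_neutral_right) (auto intro!: Xgen_comm)
  finally have "lie_bracket (Xgen a c) (Xgen b c) + lie_bracket (Xgen a c) (Xgen a b) = 0"
    using assms by (simp add: Xgen_sym [of b a] add.commute)
  then show ?thesis
    using lie_antisym [of "Xgen a b" "Xgen a c"] by (simp add: eq_neg_iff_add_eq_0 [symmetric])
qed

abbreviation word_span :: "'n::finite p_full uea set" where
  "word_span \<equiv> cvec.span (range mword)"

lemma word_span_mult:
  assumes "u \<in> word_span" "v \<in> word_span"
  shows "u * v \<in> word_span"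
  using assms(1)
proof (induction rule: cvec.span_induct_alt)
  case (step c x u)
  then obtain w where w: "x = mword w"
    by blast
  have "mword w * v \<in> word_span"
    using assms(2)
  proof (induction rule: cvec.span_induct_alt)
    case (step c x u)
    then obtain w' where "x = mword w'"
      by blast
    then have "mword w * x \<in> word_span"
      by (simp add: cvec.span_base flip: mword_simps(3))
    with step.IH show ?case
      by (simp add: distrib_left scaleC_mult_right cvec.span_add cvec.span_scale)
  qed (simp add: cvec.span_zero)
  with step.IH w show ?case
    by (simp add: distrib_right scaleC_mult_left cvec.span_add cvec.span_scale)
qed (simp add: cvec.span_zero)

lemma letter_word_span: "letter p \<in> word_span"
  by (rule cvec.span_base) (metis mult.right_neutral mword_simps(1,2) rangeI)

lemma beta_word_span: "XU be (Some a) \<in> (word_span :: 'n::finite p_full uea set)"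
proof -
  have Pt: "XU be (pt i) \<in> word_span" for i :: 'n
    using letter_word_span [of "Some i"] by (simp add: Xgen_sym [of be])
  have Om: "XU be om \<in> (word_span :: 'n p_full uea set)"
    using letter_word_span [of None] by simp
  have "XU be al = - (XU be om + (\<Sum>i\<in>UNIV. XU be (pt (i::'n))))"
    by (simp add: marks_sum_zero)
  also have "\<dots> \<in> word_span"
    by (intro cvec.span_neg cvec.span_add cvec.span_sum Om Pt)
  finally show ?thesis
    using Pt Om by (cases a) auto
qed

text \<open>The bracket is zero or, up to sign, the commutator of X_a\<beta> and X_b\<beta>; the
  subalgebra generated by the X_c\<beta> is thus normalised by the other generators.\<close>

lemma commutator_letter:
  "XU (Some a) (Some b) * XU be (Some c) - XU be (Some c) * XU (Some a) (Some b) \<in> (word_span :: 'n::finite p_full uea set)"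
proof -
  have ab: "emb (lie_bracket (Xgen (Some a) (Some b)) (Xgen be (Some a))) \<in> word_span" if "a \<noteq> b" for a b :: "'n marks"
    using lie_generators [of "Some a" "Some b" be] that
    by (simp add: Xgen_sym [of be] emb_bracket)
      (metis Xgen_sym beta_word_span cvec.span_diff word_span_mult)
  consider "a = b" | "a \<noteq> b" "c = a" | "a \<noteq> b" "c = b" | "distinct [Some a, Some b, be, Some c]"
    by auto
  then have "emb (lie_bracket (Xgen (Some a) (Some b)) (Xgen be (Some c))) \<in> word_span"
  proof cases
    case 3
    then show ?thesis
      using ab [of b a] by (simp add: Xgen_sym [of "Some b"])
  qed (simp_all add: ab Xgen_diag Xgen_comm emb_lin lie_simps cvec.span_zero)
  then show ?thesis
    by (simp add: emb_bracket)
qed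

lemma commutator_mword:
  "XU (Some a) (Some b) * mword w - mword w * XU (Some a) (Some b) \<in> (word_span :: 'n::finite p_full uea set)"
proof (induction w)
  case (Cons p w)
  let ?X = "XU (Some a) (Some b) :: 'n p_full uea"
  have "?X * letter p - letter p * ?X \<in> word_span"
    using commutator_letter [of a b] by (cases p) (simp_all add: Xgen_sym [of _ be])
  then have "(?X * letter p - letter p * ?X) * mword w + letter p * (?X * mword w - mword w * ?X) \<in> word_span"
    using Cons letter_word_span by (intro cvec.span_add word_span_mult) (auto intro: cvec.span_base)
  then show ?case
    by (simp add: algebra_simps)
qed (simp add: cvec.span_zero)

context
  fixes s :: "'n::{finite,linorder} p_sub \<Rightarrow> 'n p_full"
  assumes beta_sec: "beta_section s"
begin

text \<open>Except for X_\<alpha>n these are, up to symmetry, values of the section or zero.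
  X_\<alpha>n is X_\<beta>\<omega> minus the others, and here the summand generated by
  X_\<beta>\<omega> enters.\<close>

lemma pair_mem_polylog_ideal:
  assumes "a \<noteq> Omega" "b \<noteq> Omega"
  shows "XU (Some a) (Some b) \<in> polylog_ideal s"
proof -
  note J = left_ideal_polylog_ideal [of s]
  have pt: "XU (pt i) (pt j) \<in> polylog_ideal s" if "i < j" for i j
    using polylog_ideal_mem(1) [of 1 s "Xgen (Pt i) (Pt j)"] that by (simp add: s_gens [OF beta_sec])
  have pts: "XU (pt i) (pt j) \<in> polylog_ideal s" for i j
    using pt [of i j] pt [of j i]
    by (metis Xgen_diag Xgen_sym emb_lin(1) left_idealD(1) [OF J] neqE)
  have alp: "XU al (pt i) \<in> polylog_ideal s" for i
  proof (cases "i = Max UNIV")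
    case True
    have "Xgen be om = Xgen al (pt i) + ((\<Sum>k\<in>UNIV - {i}. Xgen al (pt k))
        + (\<Sum>(i, j)\<in>{(i, j). i < j}. Xgen (pt i) (pt j)))"
      unfolding Xgen_beta_omega by (simp add: sum.remove [of UNIV i] add.assoc)
    then have "XU al (pt i) = XU be om - ((\<Sum>k\<in>UNIV - {i}. XU al (pt k))
        + (\<Sum>(i, j)\<in>{(i, j). i < j}. XU (pt i) (pt j)))"
      by (simp add: emb_add emb_sum case_prod_unfold)
    also have "\<dots> \<in> polylog_ideal s"
    proof (intro left_idealD [OF J] left_ideal_sum_mem [OF J])
      show "XU be om \<in> polylog_ideal s"
        using polylog_ideal_mem(2) [of 1 s] by simp
      fix k assume "k \<in> UNIV - {i}"
      then have "k < Max UNIV"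
        using True Max_ge [of UNIV k] by (simp add: less_le)
      then show "XU al (pt k) \<in> polylog_ideal s"
        using polylog_ideal_mem(1) [of 1 s "Xgen Alpha (Pt k)"] by (simp add: s_gens [OF beta_sec])
    qed (auto simp: pts)
    finally show ?thesis .
  next
    case False
    then have "i < Max UNIV"
      using Max_ge [of UNIV i] by (simp add: less_le)
    then show ?thesis
      using polylog_ideal_mem(1) [of 1 s "Xgen Alpha (Pt i)"] by (simp add: s_gens [OF beta_sec])
  qed
  show ?thesis
    using assms pts alp
    by (cases a; cases b) (simp_all add: Xgen_diag emb_lin left_idealD [OF J] Xgen_sym [of _ al])
qed

definition reachable :: "'n p_full uea set" where
  "reachable = {u + j |u j. u \<in> word_span \<and> j \<in> polylog_ideal s}"

lemma reachable_closed:
  "u \<in> word_span \<Longrightarrow> u \<in> reachable" "j \<in> polylog_ideal s \<Longrightarrow> j \<in> reachable"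
  "x \<in> reachable \<Longrightarrow> y \<in> reachable \<Longrightarrow> x + y \<in> reachable"
  "x \<in> reachable \<Longrightarrow> c *\<^sub>C x \<in> reachable"
  "u \<in> word_span \<Longrightarrow> x \<in> reachable \<Longrightarrow> u * x \<in> reachable"
proof -
  note J = left_ideal_polylog_ideal [of s]
  have sub: "cvec.subspace reachable"
    unfolding reachable_def using J
    by (intro cvec.subspace_sums) (auto simp: left_ideal_def)
  show "x \<in> reachable \<Longrightarrow> y \<in> reachable \<Longrightarrow> x + y \<in> reachable" "x \<in> reachable \<Longrightarrow> c *\<^sub>C x \<in> reachable"
    using sub by (auto intro: cvec.subspace_add cvec.subspace_scale)
  show "u \<in> word_span \<Longrightarrow> u \<in> reachable" "j \<in> polylog_ideal s \<Longrightarrow> j \<in> reachable"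
    unfolding reachable_def using left_idealD(1) [OF J] cvec.span_zero by force+
  show "u \<in> word_span \<Longrightarrow> x \<in> reachable \<Longrightarrow> u * x \<in> reachable"
    unfolding reachable_def using word_span_mult left_idealD(6) [OF J] by (auto simp: distrib_left) blast
qed

lemma XU_marks_reachable: "XU (Some a) (Some b) \<in> reachable"
proof -
  have AO: "XU (Some a) om \<in> reachable" for a
  proof (cases "a = Omega")
    case False
    have "XU (Some a) om = (- 1) *\<^sub>C XU be (Some a) + (- 1) *\<^sub>C (\<Sum>b\<in>UNIV - {Omega}. XU (Some a) (Some b))"
      by (simp add: Xgen_Omega [OF False] emb_lin emb_sum scaleC_one)
    also have "\<dots> \<in> reachable"
      using False pair_mem_polylog_ideal [of a]
      by (intro reachable_closed(3,4) reachable_closed(1) [OF beta_word_span] reachable_closed(2)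
          left_ideal_sum_mem [OF left_ideal_polylog_ideal]) auto
    finally show ?thesis .
  qed (simp add: Xgen_diag emb_lin reachable_closed cvec.span_zero)
  show ?thesis
    by (metis AO Xgen_sym pair_mem_polylog_ideal reachable_closed(2))
qed

text \<open>X_ab moves to the right through a word at the cost of further words, and at the right
  end it is itself a combination of letters modulo the ideal. So \<open>reachable\<close> contains 1
  and is stable under left multiplication by generators.\<close>

lemma reachable_UNIV: "u \<in> reachable"
proof -
  note J = left_ideal_polylog_ideal [of s]
  have "\<forall>x\<in>reachable. u * x \<in> reachable" for u
  proof (induction u rule: uea_induct)
    case (gen a b)
    show ?case
    proof (cases "a = None \<or> b = None")
      case True
      then have "XU a b \<in> word_span"
        using beta_word_span by (cases a; cases b) (auto simp: Xgen_diag emb_lin cvec.span_zero Xgen_sym [of _ be])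
      then show ?thesis
        using reachable_closed(5) by blast
    next
      case False
      then obtain a' b' where ab: "a = Some a'" "b = Some b'"
        by auto
      have w: "XU a b * x \<in> reachable" if "x \<in> word_span" for x
        using that
      proof (induction rule: cvec.span_induct_alt)
        case (step c x y)
        then obtain w where x: "x = mword w"
          by blast
        have "(XU a b * mword w - mword w * XU a b) + mword w * XU a b \<in> reachable"
          using commutator_mword [of a' b' w] XU_marks_reachable [of a' b'] ab
          by (intro reachable_closed(3) reachable_closed(5)) (auto intro: cvec.span_base reachable_closed(1))
        then show ?case
          using step.IH x by (simp add: distrib_left scaleC_mult_right reachable_closed(3,4))
      qed (simp add: reachable_closed cvec.span_zero)
      show ?thesis
      proof
        fix x assume "x \<in> reachable"
        then obtain u j where "x = u + j" "u \<in> word_span" "j \<in> polylog_ideal s"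
          unfolding reachable_def by blast
        then show "XU a b * x \<in> reachable"
          using w [of u] left_idealD(6) [OF J, of j "XU a b"]
          by (simp add: distrib_left reachable_closed(2,3))
      qed
    qed
  next
    case (mult u v)
    then show ?case by (simp add: mult.assoc)
  qed (auto simp: distrib_right scaleC_mult_left reachable_closed cvec.span_zero)
  moreover have "1 \<in> reachable"
    using cvec.span_base [OF rangeI, of mword "[]"] by (intro reachable_closed(1)) simp
  ultimately show ?thesis
    by (metis mult.right_neutral)
qed

text \<open>The two ways of failing to be admissible correspond to the last two summands of the
  ideal.\<close>

lemma mword_mem_polylog_ideal:
  assumes "\<not> adm w"
  shows "mword w \<in> polylog_ideal s"
proof (cases "w \<noteq> [] \<and> last w = None")
  case True
  then have "mword w = mword (butlast w) * XU be om"
    by (metis append_butlast_last_id letter.simps(1) mult.right_neutral mword_simps)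
  then show ?thesis
    by (simp add: polylog_ideal_mem)
next
  case False
  with assms obtain k l i j where kl: "k < l" "l < length w" "w ! k = Some i" "w ! l = Some j" "i < j"
    unfolding adm_def sorted_wrt_iff_nth_less by (auto simp: not_le)
  have *: "w = take l w @ Some j # drop (Suc l) w"
    using kl by (metis id_take_nth_drop)
  moreover have "take l w = take k w @ Some i # drop (Suc k) (take l w)"
    using kl id_take_nth_drop [of k "take l w"] by (simp add: min_def)
  ultimately have "mword w = mword ((take k w @ Some i # drop (Suc k) (take l w)) @ Some j # drop (Suc l) w)"
    by simp
  then have "mword w = (mword (take k w) * (XU (pt i) be * mword (drop (Suc k) (take l w))))
      * (XU (pt j) be * mword (drop (Suc l) w))"
    by (simp only: letter.simps(2) mword_simps(2,3))
  also have "\<dots> \<in> polylog_ideal s"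
    using kl by (intro polylog_ideal_mem(3) [of i j] gen_ideal_mult gen_ideal_mem)
  finally show ?thesis .
qed

lemma adm_expansion_ex:
  "\<exists>F c. finite F \<and> F \<subseteq> Collect adm \<and> u - (\<Sum>w\<in>F. c w *\<^sub>C mword w) \<in> polylog_ideal s"
proof -
  note J = left_ideal_polylog_ideal [of s]
  obtain v j where vj: "u = v + j" "v \<in> word_span" "j \<in> polylog_ideal s"
    using reachable_UNIV [of u] unfolding reachable_def by blast
  obtain T r where T: "finite T" "T \<subseteq> range mword" "v = (\<Sum>a\<in>T. r a *\<^sub>C a)"
    using vj(2) unfolding cvec.span_explicit by blast
  obtain W where W: "finite W" "inj_on mword W" "T = mword ` W"
    using T(1,2) by (metis finite_image_iff subset_image_inj)
  let ?F = "{w\<in>W. adm w}"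
  have "v = (\<Sum>w\<in>W. r (mword w) *\<^sub>C mword w)"
    using W by (simp add: T(3) sum.reindex)
  also have "\<dots> = (\<Sum>w\<in>?F. r (mword w) *\<^sub>C mword w) + (\<Sum>w\<in>W - ?F. r (mword w) *\<^sub>C mword w)"
    using W by (subst sum.subset_diff [of ?F W]) (auto simp: add.commute)
  finally have "u - (\<Sum>w\<in>?F. r (mword w) *\<^sub>C mword w) = (\<Sum>w\<in>W - ?F. r (mword w) *\<^sub>C mword w) + j"
    by (simp add: vj(1))
  also have "\<dots> \<in> polylog_ideal s"
    using vj(3) mword_mem_polylog_ideal
    by (intro left_idealD [OF J] left_ideal_sum_mem [OF J]) auto
  finally show ?thesis
    using W(1) by (intro exI [of _ ?F] exI [of _ "\<lambda>w. r (mword w)"]) auto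
qed

end

section \<open>The coefficient functionals\<close>

lemma rep_vanishing:
  assumes "contr_closed Q" "\<And>p w. Q (p # w) \<Longrightarrow> Q w" "\<And>w. Q (w @ [None]) \<Longrightarrow> Q w"
  shows "rep u \<in> vanishing Q"
  by (induction u rule: uea_induct)
    (simp_all add: rep_simps vanishing_closed gop_vanishing [OF assms])

lemma coef_left_ideal:
  assumes "contr_closed Q" "\<And>p w. Q (p # w) \<Longrightarrow> Q w" "\<And>w. Q (w @ [None]) \<Longrightarrow> Q w"
  shows "left_ideal {u. \<forall>w. Q w \<longrightarrow> coef w u = 0}"
  unfolding left_ideal_def
proof (intro conjI allI ballI)
  show "cvec.subspace {u. \<forall>w. Q w \<longrightarrow> coef w u = 0}"
    by (auto simp: cvec.subspace_def coef_simps)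
  show "v * x \<in> {u. \<forall>w. Q w \<longrightarrow> coef w u = 0}" if "x \<in> {u. \<forall>w. Q w \<longrightarrow> coef w u = 0}" for v x
    using that rep_vanishing [where Q = Q and u = v, OF assms]
    by (auto simp: coef_def rep_simps op_app_simps vanishing_def)
qed

definition no_inversion :: "'n \<Rightarrow> 'n \<Rightarrow> 'n option list \<Rightarrow> bool" where
  "no_inversion i j = sorted_wrt (\<lambda>p q. \<not> (p = Some i \<and> q = Some j))"

text \<open>Elements of the ideal of X_j\<beta> map every series to one supported on words that
  contain this letter. Elements of the ideal of X_i\<beta> map those to series supported on words in
  which X_i\<beta> precedes X_j\<beta>. The sets \<open>K\<close> and \<open>L\<close> express both
  facts and are two-sided ideals.\<close>

lemma coef_prod_ideals:
  fixes i j :: "'n::finite"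
  assumes a: "a \<in> gen_ideal (XU (pt i) be)" and b: "b \<in> gen_ideal (XU (pt j) be)" and w: "no_inversion i j w"
  shows "coef w (a * b) = 0"
proof -
  let ?Q = "\<lambda>w. Some j \<notin> set w"
  have Q: "contr_closed ?Q"
    by (auto simp: contr_closed_def)
  have Qr: "rep u \<in> vanishing ?Q" for u
    by (rule rep_vanishing [OF Q]) auto
  have R: "contr_closed (no_inversion i j)"
    by (auto simp: contr_closed_def no_inversion_def sorted_wrt_append)
  have Rr: "rep u \<in> vanishing (no_inversion i j)" for u
    by (rule rep_vanishing [OF R]) (auto simp: no_inversion_def sorted_wrt_append)
  define K where "K = {u. \<forall>f w. ?Q w \<longrightarrow> op_app (rep u) f w = 0}"
  define L where "L = {u. \<forall>f. (\<forall>w. ?Q w \<longrightarrow> f w = 0) \<longrightarrow> (\<forall>w. no_inversion i j w \<longrightarrow> op_app (rep u) f w = 0)}"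
  have "two_sided_ideal K"
    using Qr by (auto simp: two_sided_ideal_def cvec.subspace_def K_def rep_simps op_app_simps vanishing_def)
  moreover have "XU (pt j) be \<in> K"
  proof -
    have "op_app (lop (Pt j)) f w = 0" if "?Q w" for f w
      using that by (cases w) (auto simp: lop_def kron_def)
    then show ?thesis
      by (simp add: K_def rep_simps)
  qed
  ultimately have "b \<in> K"
    using b gen_ideal_subset by blast
  moreover have "two_sided_ideal L"
    using Qr Rr by (auto simp: two_sided_ideal_def cvec.subspace_def L_def rep_simps op_app_simps vanishing_def)
  moreover have "XU (pt i) be \<in> L"
  proof -
    have "op_app (lop (Pt i)) f w = 0" if "no_inversion i j w" "\<forall>w. ?Q w \<longrightarrow> f w = 0" for f w
      using that by (cases w) (auto simp: lop_def kron_def no_inversion_def)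
    then show ?thesis
      by (simp add: L_def rep_simps)
  qed
  ultimately have "a \<in> L"
    using a gen_ideal_subset by blast
  with \<open>b \<in> K\<close> show ?thesis
    using w by (simp add: coef_def rep_simps op_app_simps K_def L_def)
qed

context
  fixes s :: "'n::{finite,linorder} p_sub \<Rightarrow> 'n p_full"
  assumes beta_sec: "beta_section s"
begin

lemma coef_polylog_ideal:
  assumes "adm w" "u \<in> polylog_ideal s"
  shows "coef w u = 0"
proof -
  \<comment> \<open>X_\<beta>\<omega> and the X_ab with marks other than \<omega> send the series 1
    to multiples of X_\<beta>\<omega>, so for the first two summands of the ideal only the last
    letter of the word matters.\<close>
  let ?Q = "\<lambda>w :: 'n option list. w = [] \<or> last w \<noteq> None"
  let ?Z = "{u. \<forall>w. ?Q w \<longrightarrow> coef w u = 0}"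
  have Z: "left_ideal ?Z"
    by (rule coef_left_ideal) (auto simp: contr_closed_def split: if_splits)
  have Om: "XU be om \<in> ?Z"
    using coef_mword [of _ "[None] :: 'n option list"] by auto
  have "coef w (XU (Some a) (Some b)) = 0" if "a \<noteq> Omega" "b \<noteq> Omega" "?Q w" for a b w
    using that by (auto simp: coef_def rep_simps aop_def op_app_simps dop_one rop_def rmul_one unit_word_def)
  then have pairs: "XU (Some a) (Some b) \<in> ?Z" if "a \<noteq> Omega" "b \<noteq> Omega" for a b
    using that by blast
  have subZ: "cvec.subspace ?Z"
    using Z by (simp add: left_ideal_def)
  let ?V = "{u. coef w u = 0}"
  have sub: "cvec.subspace ?V"
    by (auto simp: cvec.subspace_def coef_simps)
  have "?Q w"
    using assms(1) by (simp add: adm_def)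
  then have ZV: "?Z \<subseteq> ?V"
    by blast
  have "u * emb (s y) \<in> ?Z" for u y
    using emb_section_mem [OF beta_sec Z pairs pairs] left_idealD(6) [OF Z] by blast
  then have 1: "span_prod UNIV (range (\<lambda>y. emb (s y))) \<subseteq> ?Z"
    by (intro span_prod_subset subZ) blast
  have "u * XU be om \<in> ?Z" for u
    using Om left_idealD(6) [OF Z] by blast
  then have 2: "span_prod UNIV {XU be om} \<subseteq> ?Z"
    by (intro span_prod_subset subZ) blast
  have "(\<lambda>(i, j). span_prod (gen_ideal (XU (pt i) be)) (gen_ideal (XU (pt j) be))) k \<subseteq> ?V"
    if ij: "k \<in> {(i, j). i < j}" for k
  proof -
    obtain i j where k: "k = (i, j)" "i < j"
      using ij by auto
    have "no_inversion i j w"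
      unfolding no_inversion_def
    proof (rule sorted_wrt_mono_rel)
      show "sorted_wrt (\<lambda>p q. \<forall>i j. p = Some i \<longrightarrow> q = Some j \<longrightarrow> j \<le> i) w"
        using assms(1) by (simp add: adm_def)
    qed (use k(2) in force)
    then show ?thesis
      unfolding k prod.case by (intro span_prod_subset sub) (auto intro: coef_prod_ideals)
  qed
  then have 3: "(\<Sum>(i, j)\<in>{(i, j). i < j}. span_prod (gen_ideal (XU (pt i) be)) (gen_ideal (XU (pt j) be))) \<subseteq> ?V"
    by (intro set_sum_subset sub)
  have "polylog_ideal s \<subseteq> ?V"
    unfolding polylog_ideal_def using 1 2 3 ZV by (intro set_plus_subset sub) auto
  then show ?thesis
    using assms(2) by blast
qed

text \<open>The dual functionals vanish on the ideal and therefore read off the coefficients of any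
  expansion into admissible words.\<close>

lemma adm_expansion:
  fixes u :: "'n p_full uea"
  defines "F \<equiv> {w. adm w \<and> coef w u \<noteq> 0}"
  shows "finite F" "u - (\<Sum>w\<in>F. coef w u *\<^sub>C mword w) \<in> polylog_ideal s"
proof -
  obtain G c where G: "finite G" "G \<subseteq> Collect adm" "u - (\<Sum>w\<in>G. c w *\<^sub>C mword w) \<in> polylog_ideal s"
    using adm_expansion_ex [OF beta_sec, of u] by blast
  interpret coef: Vector_Spaces.linear scaleC "(*)" "coef w" for w
    by (rule coef_linear)
  have c: "coef w u = of_bool (w \<in> G) * c w" if "adm w" for w
  proof -
    have "coef w u = coef w (\<Sum>v\<in>G. c v *\<^sub>C mword v)"
      using coef_polylog_ideal [OF that G(3)] by (simp add: coef.diff)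
    also have "\<dots> = (\<Sum>v\<in>G. c v * of_bool (w = v))"
      by (simp add: coef.sum coef_simps coef_mword)
    also have "\<dots> = of_bool (w \<in> G) * c w"
      using G(1) by (simp add: of_bool_def if_distrib [of "\<lambda>x. _ * x"] cong: if_cong)
    finally show ?thesis .
  qed
  have FG: "F \<subseteq> G"
    by (auto simp: F_def c)
  then show "finite F"
    using G(1) by (rule finite_subset)
  have "(\<Sum>w\<in>F. coef w u *\<^sub>C mword w) = (\<Sum>w\<in>G. c w *\<^sub>C mword w)"
    using FG G(1,2) by (intro sum.mono_neutral_cong_left) (auto simp: F_def c)
  then show "u - (\<Sum>w\<in>F. coef w u *\<^sub>C mword w) \<in> polylog_ideal s"
    using G(3) by simp
qed

lemma polylog_ideal_eq: "polylog_ideal s = {u. \<forall>w. adm w \<longrightarrow> coef w u = 0}"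
proof (intro equalityI subsetI CollectI)
  fix u :: "'n p_full uea" assume "u \<in> {u. \<forall>w. adm w \<longrightarrow> coef w u = 0}"
  then have "{w. adm w \<and> coef w u \<noteq> 0} = {}"
    by blast
  then show "u \<in> polylog_ideal s"
    using adm_expansion(2) [of u] by simp
qed (use coef_polylog_ideal in blast)

lemma functional_expansion:
  assumes "Vector_Spaces.linear scaleC (*) \<phi>" "\<And>u. u \<in> polylog_ideal s \<Longrightarrow> \<phi> u = 0"
    and G: "finite G" "G \<subseteq> Collect adm" "\<And>w. adm w \<Longrightarrow> w \<notin> G \<Longrightarrow> \<phi> (mword w) = 0"
  shows "\<phi> u = (\<Sum>w\<in>G. \<phi> (mword w) * coef w u)"
proof -
  interpret Vector_Spaces.linear scaleC "(*)" \<phi>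
    by (fact assms(1))
  let ?F = "{w. adm w \<and> coef w u \<noteq> 0}"
  have "\<phi> u = \<phi> (\<Sum>w\<in>?F. coef w u *\<^sub>C mword w)"
    using assms(2) [OF adm_expansion(2)] by (simp add: diff)
  also have "\<dots> = (\<Sum>w\<in>?F. coef w u * \<phi> (mword w))"
    by (simp add: sum scale)
  also have "\<dots> = (\<Sum>w\<in>?F \<inter> G. coef w u * \<phi> (mword w))"
    using adm_expansion(1) [of u] G by (intro sum.mono_neutral_right) auto
  also have "\<dots> = (\<Sum>w\<in>G. coef w u * \<phi> (mword w))"
    using G by (intro sum.mono_neutral_left) auto
  finally show ?thesis
    by (simp add: mult.commute)
qed

end

section \<open>Degrees\<close>

text \<open>Every generator acts homogeneously of degree one: multiplications add a letter, and
  derivations replace one letter by two.\<close>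

lemma gop_degree:
  assumes "\<And>v. Suc (length v) = length w \<Longrightarrow> f v = 0"
  shows "op_app (gop a b) f w = 0"
proof -
  have l: "op_app (lop c) f w = 0" for c
    using assms by (cases w) (simp_all add: lop_def)
  have "deriv_fun \<delta> f w = 0" for \<delta>
    using assms by (induction w arbitrary: f) (auto split: list.split intro!: sum.neutral)
  then have "op_app (dop c d) f w = 0" for c d
    by (simp add: dop_def deriv_op.rep_eq)
  moreover have "op_app rop f w = 0"
    using assms [of "butlast w"] by (auto simp: rop_def op_app_simps rmul.rep_eq)
  ultimately have "op_app (aop c d) f w = 0" for c d
    by (simp add: aop_def op_app_simps)
  then show ?thesis
    using l by (cases a; cases b) (auto simp: op_app_simps oop_def op_app_sum)
qed

lemma coef_degree:
  assumes "u \<in> U_deg k" "length w \<noteq> k"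
  shows "coef w u = 0"
proof -
  have "coef w (prod_list (map (\<lambda>(a, b). XU a b) l)) = 0" if "length w \<noteq> length l" for l w
    using that
  proof (induction l arbitrary: w)
    case (Cons x l)
    then show ?case
      by (cases x) (auto simp: coef_def rep_simps op_app_simps intro!: gop_degree)
  qed (auto simp: coef_def rep_simps op_app_simps unit_word_def)
  moreover have "cvec.subspace {u. coef w u = 0}"
    by (auto simp: cvec.subspace_def coef_simps)
  ultimately have "U_deg k \<subseteq> {u. coef w u = 0}"
    unfolding U_deg_def using assms(2) by (intro cvec.span_minimal) auto
  then show ?thesis
    using assms(1) by blast
qed

lemma coef_homogeneous: "coef w \<in> homogeneous_dual (length w)"
proof -
  have "{k. \<exists>u\<in>U_deg k. coef w u \<noteq> 0} \<subseteq> {length w}"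
    by (auto intro: ccontr dest: coef_degree [of _ _ w])
  then show ?thesis
    unfolding homogeneous_dual_def graded_dual_def
    using coef_linear coef_degree by (auto dest: finite_subset)
qed

lemma coef_graded_dual: "coef w \<in> graded_dual"
  using coef_homogeneous by (auto simp: homogeneous_dual_def)

lemma U_deg_mult: "u \<in> U_deg k \<Longrightarrow> XU a b * u \<in> U_deg (Suc k)"
  unfolding U_deg_def
proof (induction rule: cvec.span_induct_alt)
  case (step c x u)
  then obtain w where w: "x = prod_list (map (\<lambda>(a, b). XU a b) w)" "length w = k"
    by blast
  then have "XU a b * x = prod_list (map (\<lambda>(a, b). XU a b) ((a, b) # w))" "length ((a, b) # w) = Suc k"
    by simp_all
  then have "XU a b * x \<in> cvec.span {prod_list (map (\<lambda>(a, b). XU a b) w) |w. length w = Suc k}"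
    by (intro cvec.span_base) blast
  with step.IH show ?case
    by (simp add: distrib_left scaleC_mult_right cvec.span_add cvec.span_scale)
qed (simp add: cvec.span_zero)

section \<open>Operations on the graded dual\<close>

lemma graded_dual_lin:
  assumes "\<phi> \<in> graded_dual"
  shows "\<phi> 0 = 0" "\<phi> (u + v) = \<phi> u + \<phi> v" "\<phi> (c *\<^sub>C u) = c * \<phi> u" "\<phi> (u - v) = \<phi> u - \<phi> v"
    "\<phi> (- u) = - \<phi> u" "\<phi> (sum f I) = (\<Sum>i\<in>I. \<phi> (f i))"
proof -
  interpret Vector_Spaces.linear scaleC "(*)" \<phi>
    using assms by (simp add: graded_dual_def)
  show "\<phi> 0 = 0" "\<phi> (u + v) = \<phi> u + \<phi> v" "\<phi> (c *\<^sub>C u) = c * \<phi> u" "\<phi> (u - v) = \<phi> u - \<phi> v"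
    "\<phi> (- u) = - \<phi> u" "\<phi> (sum f I) = (\<Sum>i\<in>I. \<phi> (f i))"
    by (rule zero add scale diff neg sum)+
qed

lemma linear_functionalI:
  assumes "\<And>u v. \<phi> (u + v) = \<phi> u + \<phi> v" "\<And>c u. \<phi> (c *\<^sub>C u) = c * \<phi> u"
  shows "Vector_Spaces.linear scaleC (*) (\<phi> :: 'a::complex_vec \<Rightarrow> complex)"
proof -
  interpret vector_space "(*) :: complex \<Rightarrow> complex \<Rightarrow> complex"
    by unfold_locales (simp_all add: algebra_simps)
  show ?thesis
    by unfold_locales (simp_all add: assms)
qed

lemma graded_dual_add:
  assumes "\<phi> \<in> graded_dual" "\<psi> \<in> graded_dual"
  shows "(\<lambda>u. \<phi> u + \<psi> u) \<in> graded_dual"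
proof -
  have "{k. \<exists>u\<in>U_deg k. \<phi> u + \<psi> u \<noteq> 0} \<subseteq> {k. \<exists>u\<in>U_deg k. \<phi> u \<noteq> 0} \<union> {k. \<exists>u\<in>U_deg k. \<psi> u \<noteq> 0}"
    by auto
  then have "finite {k. \<exists>u\<in>U_deg k. \<phi> u + \<psi> u \<noteq> 0}"
    using assms by (auto simp: graded_dual_def intro: finite_subset)
  then show ?thesis
    unfolding graded_dual_def
    by (auto intro!: linear_functionalI simp: graded_dual_lin [OF assms(1)] graded_dual_lin [OF assms(2)] algebra_simps)
qed

lemma graded_dual_scale:
  assumes "\<phi> \<in> graded_dual"
  shows "(\<lambda>u. c * \<phi> u) \<in> graded_dual"
proof -
  have "{k. \<exists>u\<in>U_deg k. c * \<phi> u \<noteq> 0} \<subseteq> {k. \<exists>u\<in>U_deg k. \<phi> u \<noteq> 0}"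
    by auto
  then have "finite {k. \<exists>u\<in>U_deg k. c * \<phi> u \<noteq> 0}"
    using assms by (auto simp: graded_dual_def intro: finite_subset)
  then show ?thesis
    unfolding graded_dual_def
    by (auto intro!: linear_functionalI simp: graded_dual_lin [OF assms(1)] algebra_simps)
qed

lemma graded_dual_sum:
  assumes "\<And>i. i \<in> I \<Longrightarrow> \<phi> i \<in> graded_dual"
  shows "(\<lambda>u. \<Sum>i\<in>I. c i * \<phi> i u) \<in> graded_dual"
  using assms
proof (induction I rule: infinite_finite_induct)
  case (insert i I)
  then show ?case
    using graded_dual_add [OF graded_dual_scale [of "\<phi> i" "c i"]] by simp
qed (auto simp: graded_dual_def intro!: linear_functionalI)

lemma graded_dual_contract:
  assumes "\<phi> \<in> graded_dual"
  shows "contract \<phi> a b \<in> graded_dual"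
proof -
  have "Suc ` {k. \<exists>u\<in>U_deg k. contract \<phi> a b u \<noteq> 0} \<subseteq> {k. \<exists>u\<in>U_deg k. \<phi> u \<noteq> 0}"
    unfolding contract_def using U_deg_mult by blast
  then have "finite {k. \<exists>u\<in>U_deg k. contract \<phi> a b u \<noteq> 0}"
    using assms by (auto simp: graded_dual_def dest: finite_subset intro: finite_imageD)
  then show ?thesis
    unfolding graded_dual_def
    by (auto intro!: linear_functionalI simp: contract_def graded_dual_lin [OF assms] distrib_left scaleC_mult_right)
qed

lemma contract_coef_letter:
  "contract (coef (q # w)) (pt i) be = (\<lambda>u. of_bool (q = Some i) * coef w u)"
  "contract (coef (q # w)) be om = (\<lambda>u. of_bool (q = None) * coef w u)"
  using coef_letter_Cons [of q w "Some i"] coef_letter_Cons [of q w None]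
  by (auto simp: contract_def fun_eq_iff)

lemma coef_Nil: "coef [] = (counit :: 'n::finite p_full uea \<Rightarrow> complex)"
proof
  have "coef [] (XU a b * v) = 0" for a b and v :: "'n p_full uea"
    by (simp add: coef_def rep_simps op_app_simps) (rule gop_degree, simp)
  then have "coef [] (u * v) = counit u * coef [] v" for u v :: "'n p_full uea"
    by (induction u arbitrary: v rule: uea_induct)
      (simp_all add: counit_simps coef_simps distrib_right scaleC_mult_left mult.assoc)
  moreover have "coef [] (1 :: 'n p_full uea) = 1"
    using coef_mword [of "[]" "[] :: 'n option list"] by simp
  ultimately show "coef [] u = counit u" for u :: "'n p_full uea"
    by (metis mult.right_neutral)
qed

text \<open>The ideal is a left ideal, so a contraction of a coefficient functional still vanishes on it and
  is a combination of coefficient functionals.\<close>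

lemma contract_coef_pair:
  fixes s :: "'n::{finite,linorder} p_sub \<Rightarrow> 'n p_full" and w :: "'n option list"
  assumes "beta_section s" "adm w" "a \<noteq> Omega" "b \<noteq> Omega"
  obtains c where "contract (coef w) (Some a) (Some b)
    = (\<lambda>u. \<Sum>v\<in>{v. adm v \<and> v \<noteq> [] \<and> Suc (length v) = length w}. c v * coef v u)"
proof
  let ?\<phi> = "contract (coef w) (Some a) (Some b)"
  let ?G = "{v :: 'n option list. adm v \<and> v \<noteq> [] \<and> Suc (length v) = length w}"
  have "finite {v :: 'n option list. length v \<le> length w}"
    using finite_lists_length_le [of "UNIV :: 'n option set" "length w"] by simp
  then have fin: "finite ?G"
    by (rule finite_subset [rotated]) auto
  have deg: "mword v \<in> U_deg (length v)" for v :: "'n option list"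
  proof (induction v)
    case Nil
    then show ?case by (auto simp: U_deg_def intro!: cvec.span_base)
  next
    case (Cons p v)
    then show ?case by (cases p) (auto intro: U_deg_mult)
  qed
  show "?\<phi> = (\<lambda>u. \<Sum>v\<in>?G. ?\<phi> (mword v) * coef v u)"
  proof
    fix u
    show "?\<phi> u = (\<Sum>v\<in>?G. ?\<phi> (mword v) * coef v u)"
    proof (rule functional_expansion [OF assms(1), where \<phi> = ?\<phi> and G = ?G])
      show "Vector_Spaces.linear scaleC (*) ?\<phi>"
        using graded_dual_contract [OF coef_graded_dual] by (auto simp: graded_dual_def)
      show "?\<phi> u = 0" if "u \<in> polylog_ideal s" for u
        using left_idealD(6) [OF left_ideal_polylog_ideal that] coef_polylog_ideal [OF assms(1,2)]
        by (simp add: contract_def)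
      show "?\<phi> (mword v) = 0" if "adm v" "v \<notin> ?G" for v
      \<comment> \<open>The empty word drops out because X_ab itself lies in the ideal. Since only
        nonempty words remain, the series attached to the contraction will vanish for x_n =
        0.\<close>
      proof (cases "v = []")
        case True
        then show ?thesis
          using pair_mem_polylog_ideal [OF assms(1,3,4)] coef_polylog_ideal [OF assms(1,2)]
          by (simp add: contract_def)
      next
        case False
        then show ?thesis
          using that coef_degree [OF U_deg_mult [OF deg], of w v] by (simp add: contract_def)
      qed
    qed (use fin in auto)
  qed
qed

section \<open>Holomorphic functions on the polydisc\<close>

lemma has_derivative_cart:
  fixes f :: "'a::real_normed_vector \<Rightarrow> 'b::euclidean_space ^ 'n::finite"
  assumes "\<And>i. ((\<lambda>t. f t $ i) has_derivative (\<lambda>h. f' h $ i)) (at a within S)"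
  shows "(f has_derivative f') (at a within S)"
proof (rule has_derivative_componentwise_within [THEN iffD2], rule ballI)
  fix b :: "'b ^ 'n"
  assume "b \<in> Basis"
  then obtain i u where b: "b = axis i u"
    unfolding Basis_vec_def by blast
  show "((\<lambda>x. f x \<bullet> b) has_derivative (\<lambda>x. f' x \<bullet> b)) (at a within S)"
    unfolding b inner_axis using assms [of i] by (rule has_derivative_inner_left)
qed

definition upd :: "'n \<Rightarrow> complex \<Rightarrow> complex ^ 'n \<Rightarrow> complex ^ 'n" where
  "upd k t x = (\<chi> j. if j = k then t else x $ j)"

lemma upd_nth [simp]: "upd k t x $ j = (if j = k then t else x $ j)"
  by (simp add: upd_def)

lemma upd_self [simp]: "upd k (x $ k) x = x"
  by (simp add: vec_eq_iff)

definition punctured :: "(complex ^ 'n) set" where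
  "punctured = {x \<in> polydisc. \<forall>i. x $ i \<noteq> 0}"

lemma polydisc_iff: "x \<in> polydisc \<longleftrightarrow> (\<forall>i. norm (x $ i) < 1)"
  by (simp add: polydisc_def)

lemma punctured_iff: "x \<in> punctured \<longleftrightarrow> (\<forall>i. norm (x $ i) < 1 \<and> x $ i \<noteq> 0)"
  by (auto simp: punctured_def polydisc_def)

lemma punctured_polydisc: "x \<in> punctured \<Longrightarrow> x \<in> polydisc"
  by (simp add: punctured_def)

lemma open_polydisc: "open (polydisc :: (complex ^ 'n::finite) set)"
proof -
  have "polydisc = (\<Inter>i. {x :: complex ^ 'n. norm (x $ i) < 1})"
    by (auto simp: polydisc_def)
  moreover have "open (\<Inter>i. {x :: complex ^ 'n. norm (x $ i) < 1})"
    by (intro open_INT ballI open_Collect_less continuous_intros) auto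
  ultimately show ?thesis
    by simp
qed

lemma isCont_polydisc: "continuous_on polydisc f \<Longrightarrow> x \<in> polydisc \<Longrightarrow> isCont f x"
  using continuous_on_eq_continuous_at [OF open_polydisc] by blast

lemma holo_chain:
  fixes \<gamma> :: "complex \<Rightarrow> complex ^ 'n::finite"
  assumes f: "f \<in> holo_polydisc" and \<gamma>: "\<gamma> t \<in> polydisc"
    and \<gamma>': "\<And>i. ((\<lambda>t. \<gamma> t $ i) has_field_derivative \<gamma>' i) (at t)"
  shows "((\<lambda>t. f (\<gamma> t)) has_field_derivative (\<Sum>i\<in>UNIV. pderiv_at i f (\<gamma> t) * \<gamma>' i)) (at t)"
proof -
  obtain c where c: "(f has_derivative (\<lambda>h. \<Sum>i\<in>UNIV. c $ i * h $ i)) (at (\<gamma> t))"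
    using f \<gamma> unfolding holo_polydisc_def by blast
  \<comment> \<open>Stated for an arbitrary curve because it is applied twice: to
    \<open>\<gamma>\<close>, and to the coordinate lines, which identify \<open>c\<close> with the
    partial derivatives.\<close>
  have chain: "((\<lambda>t. f (\<delta> t)) has_field_derivative (\<Sum>i\<in>UNIV. c $ i * \<delta>' i)) (at u)"
    if "\<delta> u = \<gamma> t" "\<And>i. ((\<lambda>t. \<delta> t $ i) has_field_derivative \<delta>' i) (at u)" for \<delta> :: "complex \<Rightarrow> complex ^ 'n" and \<delta>' u
  proof -
    have "(\<delta> has_derivative (\<lambda>h. \<chi> i. \<delta>' i * h)) (at u)"
      by (rule has_derivative_cart) (use that(2) in \<open>simp add: has_field_derivative_def\<close>)
    then have "((\<lambda>t. f (\<delta> t)) has_derivative (\<lambda>h. \<Sum>i\<in>UNIV. c $ i * (\<delta>' i * h))) (at u)"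
      using has_derivative_compose [of \<delta> _ u UNIV f] c that(1) by fastforce
    moreover have "(\<lambda>h. \<Sum>i\<in>UNIV. c $ i * (\<delta>' i * h)) = (*) (\<Sum>i\<in>UNIV. c $ i * \<delta>' i)"
      by (simp add: fun_eq_iff sum_distrib_right mult.assoc)
    ultimately show ?thesis
      by (simp add: has_field_derivative_def)
  qed
  have "pderiv_at k f (\<gamma> t) = c $ k" for k
  proof -
    have "((\<lambda>s. upd k s (\<gamma> t) $ i) has_field_derivative of_bool (i = k)) (at (\<gamma> t $ k))" for i
      by (cases "i = k") auto
    then have "((\<lambda>s. f (upd k s (\<gamma> t))) has_field_derivative (\<Sum>i\<in>UNIV. c $ i * of_bool (i = k))) (at (\<gamma> t $ k))"
      by (intro chain) simp_all
    then have "((\<lambda>s. f (upd k s (\<gamma> t))) has_field_derivative c $ k) (at (\<gamma> t $ k))"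
      by (simp add: of_bool_def if_distrib [of "\<lambda>x. _ * x"] cong: if_cong)
    then show ?thesis
      unfolding pderiv_at_def by (simp add: upd_def DERIV_imp_deriv)
  qed
  then show ?thesis
    using chain [OF HOL.refl \<gamma>'] by simp
qed

lemma holo_continuous_on: "f \<in> holo_polydisc \<Longrightarrow> continuous_on polydisc f"
  by (rule continuous_at_imp_continuous_on)
    (auto simp: holo_polydisc_def dest!: has_derivative_continuous)

lemma holo_upd:
  assumes "f \<in> holo_polydisc" "upd k t x \<in> polydisc"
  shows "((\<lambda>t. f (upd k t x)) has_field_derivative pderiv_at k f (upd k t x)) (at t)"
proof -
  have "((\<lambda>t. upd k t x $ i) has_field_derivative of_bool (i = k)) (at t)" for i
    by (cases "i = k") auto
  from holo_chain [OF assms this] show ?thesis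
    by (simp add: of_bool_def if_distrib [of "\<lambda>x. _ * x"] cong: if_cong)
qed

lemma continuous_on_upd: "continuous_on S (\<lambda>t. upd k t x)"
proof -
  have "continuous_on S (\<lambda>t. if j = k then t else x $ j)" for j
    by (cases "j = k") (auto intro!: continuous_intros)
  then show ?thesis
    unfolding upd_def by (intro continuous_on_vec_lambda)
qed

text \<open>Replace the vanishing coordinates by \<epsilon> and let \<epsilon> tend to 0.\<close>

lemma punctured_dense:
  fixes x :: "complex ^ 'n::finite"
  assumes "continuous_on polydisc f" "continuous_on polydisc g" "\<And>x. x \<in> punctured \<Longrightarrow> f x = (g x :: complex)"
    and x: "x \<in> polydisc"
  shows "f x = g x"
proof -
  define \<gamma> :: "complex \<Rightarrow> complex ^ 'n" where "\<gamma> \<epsilon> = (\<chi> j. if x $ j = 0 then \<epsilon> else x $ j)" for \<epsilon>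
  have \<gamma>: "(\<gamma> \<longlongrightarrow> x) (at 0)"
  proof (rule vec_tendstoI)
    show "((\<lambda>\<epsilon>. \<gamma> \<epsilon> $ i) \<longlongrightarrow> x $ i) (at 0)" for i
      by (cases "x $ i = 0") (auto simp: \<gamma>_def intro!: tendsto_eq_intros)
  qed
  have ev: "eventually (\<lambda>\<epsilon>. \<gamma> \<epsilon> \<in> punctured) (at 0)"
  proof -
    have "eventually (\<lambda>\<epsilon>::complex. \<epsilon> \<in> ball 0 1 \<and> \<epsilon> \<noteq> 0) (at 0)"
      by (intro eventually_conj eventually_at_in_open' [OF open_ball] eventually_neq_at_within) auto
    then show ?thesis
      by eventually_elim (use x in \<open>auto simp: punctured_iff polydisc_iff \<gamma>_def\<close>)
  qed
  have "isCont f x" "isCont g x"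
    using assms(1,2) x by (auto intro: isCont_polydisc)
  then have f: "((\<lambda>\<epsilon>. f (\<gamma> \<epsilon>)) \<longlongrightarrow> f x) (at 0)" and g: "((\<lambda>\<epsilon>. g (\<gamma> \<epsilon>)) \<longlongrightarrow> g x) (at 0)"
    using \<gamma> by (auto intro: isCont_tendsto_compose)
  have "((\<lambda>\<epsilon>. f (\<gamma> \<epsilon>)) \<longlongrightarrow> g x) (at 0)"
    by (rule Lim_transform_eventually [OF g]) (use ev assms(3) in \<open>auto elim: eventually_mono\<close>)
  then show ?thesis
    using f tendsto_unique [OF trivial_limit_at] by blast
qed

text \<open>The segment from the origin to a punctured point leaves the punctured polydisc only at
  the origin, a single exceptional parameter; density gives the other points.\<close>

lemma holo_constant:
  assumes f: "f \<in> holo_polydisc" and D: "\<And>k x. x \<in> punctured \<Longrightarrow> pderiv_at k f x = 0" and x: "x \<in> polydisc"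
  shows "f x = f 0"
proof (rule punctured_dense [OF holo_continuous_on [OF f] continuous_on_const _ x])
  fix x :: "complex ^ 'a"
  assume x: "x \<in> punctured"
  define h where "h t = f (\<chi> i. complex_of_real t * x $ i)" for t :: real
  have mem: "(\<chi> i. complex_of_real t * x $ i) \<in> polydisc" if "t \<in> {0..1}" for t
  proof -
    have "norm (complex_of_real t * x $ i) < 1" for i
    proof -
      have "norm (complex_of_real t * x $ i) \<le> norm (x $ i)"
        using that by (simp add: norm_mult mult_left_le_one_le)
      also have "\<dots> < 1"
        using x by (simp add: punctured_iff)
      finally show ?thesis .
    qed
    then show ?thesis
      by (simp add: polydisc_iff)
  qed
  have "h 1 = h 0"
  proof (rule has_derivative_zero_unique_strong_interval [where k="{0}" and a=0 and b=1])
    have "continuous_on {0..1} (\<lambda>t. \<chi> i. complex_of_real t * x $ i)"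
      by (intro continuous_on_vec_lambda continuous_intros)
    then show "continuous_on {0..1} h"
      unfolding h_def by (rule continuous_on_compose2 [OF holo_continuous_on [OF f]]) (use mem in auto)
  next
    fix t :: real
    assume t: "t \<in> {0..1} - {0}"
    have p: "(\<chi> i. complex_of_real t * x $ i) \<in> punctured"
      using mem [of t] t x by (auto simp: punctured_def)
    then have "((\<lambda>s. f (\<chi> i. s * x $ i)) has_field_derivative
        (\<Sum>i\<in>UNIV. pderiv_at i f (\<chi> i. complex_of_real t * x $ i) * x $ i)) (at (complex_of_real t))"
      using mem [of t] t by (intro holo_chain [OF f]) (auto intro!: derivative_eq_intros)
    then have "((\<lambda>s. f (\<chi> i. s * x $ i)) has_field_derivative 0) (at (complex_of_real t))"
      using D [OF p] by simp
    from has_vector_derivative_real_field [OF this]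
    have "(h has_vector_derivative 0) (at t within {0..1})"
      unfolding h_def by simp
    then show "(h has_derivative (\<lambda>h. 0)) (at t within {0..1})"
      by (simp add: has_vector_derivative_def)
  qed auto
  moreover have "(\<chi> i. x $ i) = x" "(\<chi> i. 0 * x $ i) = 0"
    by (simp_all add: vec_eq_iff)
  ultimately show "f x = f 0"
    by (simp add: h_def zero_vec_def)
qed

text \<open>The function is holomorphic in the k-th coordinate near 0, so t times its derivative
  tends to 0.\<close>

lemma euler_deriv_zero:
  assumes f: "f \<in> holo_polydisc" and x: "upd k 0 x \<in> polydisc"
    and s: "isCont s 0" "\<And>t. t \<noteq> 0 \<Longrightarrow> norm t < 1 \<Longrightarrow> t * pderiv_at k f (upd k t x) = s t"
  shows "s 0 = 0"
proof -
  have mem: "upd k t x \<in> polydisc" if "norm t < 1" for t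
    using x that by (auto simp: polydisc_iff split: if_splits)
  let ?g = "\<lambda>t. f (upd k t x)"
  have "?g holomorphic_on ball 0 1"
    unfolding holomorphic_on_open [OF open_ball]
    by (intro ballI exI, rule holo_upd [OF f mem]) simp
  then have "deriv ?g holomorphic_on ball 0 1"
    by (intro holomorphic_deriv) auto
  then have "isCont (deriv ?g) 0"
    by (meson centre_in_ball continuous_on_eq_continuous_at holomorphic_on_imp_continuous_on open_ball zero_less_one)
  then have "((\<lambda>t. t * deriv ?g t) \<longlongrightarrow> 0 * deriv ?g 0) (at 0)"
    by (intro tendsto_intros) (simp add: isCont_def)
  moreover have "eventually (\<lambda>t. t * deriv ?g t = s t) (at 0)"
  proof -
    have "eventually (\<lambda>t::complex. t \<in> ball 0 1 \<and> t \<noteq> 0) (at 0)"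
      by (intro eventually_conj eventually_at_in_open' [OF open_ball] eventually_neq_at_within) auto
    then show ?thesis
      by eventually_elim (use s(2) DERIV_imp_deriv [OF holo_upd [OF f mem]] in auto)
  qed
  ultimately have "(s \<longlongrightarrow> 0) (at 0)"
    by (auto intro: Lim_transform_eventually)
  then show ?thesis
    using s(1) unfolding isCont_def using tendsto_unique [OF trivial_limit_at] by blast
qed

lemma upd_punctured: "x \<in> punctured \<Longrightarrow> t \<noteq> 0 \<Longrightarrow> norm t < 1 \<Longrightarrow> upd k t x \<in> punctured"
  by (auto simp: punctured_iff)

lemma isCont_upd:
  assumes "continuous_on polydisc f" "upd k t x \<in> polydisc"
  shows "isCont (\<lambda>t. f (upd k t x)) t"
proof (rule isCont_o2)
  show "isCont (\<lambda>t. upd k t x) t"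
    using continuous_on_upd [of UNIV k x] by (simp add: continuous_on_eq_continuous_at)
  show "isCont f (upd k t x)"
    using assms by (rule isCont_polydisc)
qed

text \<open>Downward induction on the degree in the logarithms. Once the higher coefficients vanish,
  the coefficient at \<open>p\<close> is a constant c. The equation for the monomial with one factor
  log x_k less, restricted to x_k = 0, equates p_k c with 0 or with \<open>S k\<close>, and the
  latter tends to 0 at the origin.\<close>

lemma logpoly_no_logs:
  fixes F :: "'n::finite logpoly"
  assumes F: "F \<in> logpolys" and S: "\<And>k. continuous_on polydisc (S k)" "\<And>k. S k 0 = 0"
    and D: "\<And>k p x. x \<in> punctured \<Longrightarrow> x $ k * logpoly_deriv k F p x = (if p = (\<lambda>_. 0) then S k x else 0)"
  shows "p \<noteq> (\<lambda>_. 0) \<Longrightarrow> F p = (\<lambda>_. 0)"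
    and "x \<in> punctured \<Longrightarrow> x $ k * pderiv_at k (F (\<lambda>_. 0)) x = S k x"
proof -
  have holo: "F p \<in> holo_polydisc" for p
    using F by (simp add: logpolys_def)
  have fin: "finite {p. F p \<noteq> (\<lambda>_. 0)}"
    using F by (simp add: logpolys_def)
  have D': "x $ k * pderiv_at k (F p) x + of_nat (p k + 1) * F (p(k := p k + 1)) x = (if p = (\<lambda>_. 0) then S k x else 0)"
    if "x \<in> punctured" for k p x
    using D [OF that, of k p] that by (simp add: logpoly_deriv_def distrib_left punctured_iff)
  \<comment> \<open>Bounds the total degree in the logarithms, so that the downward induction
    starts.\<close>
  define N where "N = Max (insert 0 ((\<lambda>p. sum p UNIV) ` {p. F p \<noteq> (\<lambda>_. 0)}))"
  have N: "F p = (\<lambda>_. 0)" if "sum p UNIV > N" for p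
  proof (rule ccontr)
    assume "F p \<noteq> (\<lambda>_. 0)"
    then have "sum p UNIV \<le> N"
      unfolding N_def using fin by (intro Max_ge) auto
    then show False
      using that by simp
  qed
  have main: "F p = (\<lambda>_. 0)" if "p \<noteq> (\<lambda>_. 0)" for p
    using that
  proof (induction "N - sum p UNIV" arbitrary: p rule: less_induct)
    case less
    show ?case
    proof (cases "sum p UNIV > N")
      case True
      then show ?thesis by (rule N)
    next
      case False
      have up: "F (p(k := p k + 1)) = (\<lambda>_. 0)" for k
      proof -
        have s: "sum (p(k := p k + 1)) UNIV = sum p UNIV + 1"
        proof -
          have "sum (p(k := p k + 1)) (UNIV - {k}) = sum p (UNIV - {k})"
            by (rule sum.cong) auto
          then show ?thesis
            by (simp add: sum.remove [of UNIV k])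
        qed
        show ?thesis
        proof (cases "sum p UNIV + 1 > N")
          case True
          then show ?thesis
            by (intro N) (simp only: s)
        next
          case False
          then show ?thesis
          proof (intro less.hyps)
            show "N - sum (p(k := p k + 1)) UNIV < N - sum p UNIV"
              using False unfolding s by linarith
            show "p(k := p k + 1) \<noteq> (\<lambda>_. 0)"
              by (metis Suc_eq_plus1 fun_upd_same nat.distinct(1))
          qed
        qed
      qed
      define c where "c = F p 0"
      have "pderiv_at k (F p) x = 0" if "x \<in> punctured" for k x
        using D' [OF that, of k p] less.prems that up [of k] by (simp add: punctured_iff)
      then have const: "F p x = c" if "x \<in> polydisc" for x
        unfolding c_def using holo_constant [OF holo _ that] by blast
      obtain k where k: "p k \<noteq> 0"
        using less.prems by (auto simp: fun_eq_iff)
      define q where "q = p(k := p k - 1)"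
      have q: "q k + 1 = p k" "q(k := p k) = p"
        using k by (auto simp: q_def)
      \<comment> \<open>The equation for \<open>q\<close> and the coordinate \<open>k\<close> on x_k
        = 0, where the Euler derivative of a holomorphic function vanishes.\<close>
      have eq: "(if q = (\<lambda>_. 0) then S k (upd k 0 x) else 0) = of_nat (p k) * c" if x: "x \<in> punctured" for x
      proof -
        let ?s = "\<lambda>t. (if q = (\<lambda>_. 0) then S k (upd k t x) else 0) - of_nat (p k) * c"
        have x0: "upd k 0 x \<in> polydisc"
          using x by (auto simp: punctured_iff polydisc_iff)
        have "?s 0 = 0"
        proof (rule euler_deriv_zero [OF holo x0, where s = ?s])
          show "isCont ?s 0"
            by (cases "q = (\<lambda>_. 0)") (auto intro!: continuous_intros isCont_upd S x0)
          fix t :: complex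
          assume t: "t \<noteq> 0" "norm t < 1"
          show "t * pderiv_at k (F q) (upd k t x) = ?s t"
            using D' [OF upd_punctured [OF x t], of k k q] const [OF punctured_polydisc [OF upd_punctured [OF x t]]]
            unfolding q by (simp add: eq_diff_eq)
        qed
        then show ?thesis
          by simp
      qed
      have "of_nat (p k) * c = 0"
      proof (cases "q = (\<lambda>_. 0)")
        case False
        have "(\<chi> i. 1 / 2) \<in> (punctured :: (complex ^ 'n) set)"
          by (auto simp: punctured_iff)
        then show ?thesis
          using eq False by fastforce
      next
        case True
        \<comment> \<open>Punctured points tending to the origin; the entries 1 / (n + 2) are less
          than 1 from the start.\<close>
        let ?x = "\<lambda>n. (\<chi> i. complex_of_real (inverse (of_nat (Suc (Suc n))))) :: complex ^ 'n"
        have "?x n \<in> punctured" for n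
          unfolding punctured_iff by (simp add: norm_inverse del: of_nat_Suc) (simp add: divide_simps)
        then have "S k (upd k 0 (?x n)) = of_nat (p k) * c" for n
          using eq [of "?x n"] True by simp
        moreover have "(\<lambda>n. S k (upd k 0 (?x n))) \<longlonglongrightarrow> S k 0"
        proof (rule isCont_tendsto_compose [where g = "S k"])
          show "isCont (S k) 0"
            by (intro isCont_polydisc S) (simp add: polydisc_iff)
          have "(\<lambda>n. complex_of_real (inverse (of_nat (Suc (Suc n))))) \<longlonglongrightarrow> of_real 0"
            by (intro tendsto_of_real LIMSEQ_Suc [OF LIMSEQ_inverse_real_of_nat])
          then have "(\<lambda>n. upd k 0 (?x n) $ i) \<longlonglongrightarrow> 0 $ i" for i
            by (cases "i = k") simp_all
          then show "(\<lambda>n. upd k 0 (?x n)) \<longlonglongrightarrow> 0"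
            by (rule vec_tendstoI)
        qed
        ultimately show ?thesis
          using S(2) by (simp add: LIMSEQ_const_iff)
      qed
      then have "c = 0"
        using k by simp
      show ?thesis
      proof
        show "F p x = 0" for x
          using const [of x] \<open>c = 0\<close> holo [of p] by (cases "x \<in> polydisc") (auto simp: holo_polydisc_def)
      qed
    qed
  qed
  then show "p \<noteq> (\<lambda>_. 0) \<Longrightarrow> F p = (\<lambda>_. 0)" .
  have "F ((\<lambda>_. 0)(k := 1)) = (\<lambda>_. 0)"
    by (rule main) (metis fun_upd_same zero_neq_one)
  then show "x $ k * pderiv_at k (F (\<lambda>_. 0)) x = S k x" if "x \<in> punctured"
    using D' [OF that, of k "\<lambda>_. 0"] by simp
qed

section \<open>The logarithmic forms\<close>

text \<open>The quotient z_i / z_j, as a monomial so that it makes sense where z_j = 0.\<close>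

definition zprod :: "'n \<Rightarrow> 'n \<Rightarrow> complex ^ 'n::{finite,linorder} \<Rightarrow> complex" where
  "zprod i j x = (\<Prod>l\<in>{i..<j}. x $ l)"

lemma zcoord_split:
  assumes "i \<le> j"
  shows "zcoord i x = zprod i j x * zcoord j x"
proof -
  have "{i..<j} \<union> {j..} = {i..}"
    using assms by auto
  moreover have "(\<Prod>l\<in>{i..<j} \<union> {j..}. x $ l) = (\<Prod>l\<in>{i..<j}. x $ l) * (\<Prod>l\<in>{j..}. x $ l)"
    by (intro prod.union_disjoint) auto
  ultimately show ?thesis
    by (simp add: zcoord_def zprod_def)
qed

lemma norm_prod_lt_1:
  assumes "x \<in> polydisc" "A \<noteq> {}" "finite A"
  shows "norm (\<Prod>l\<in>A. x $ l) < 1"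
proof -
  obtain a where a: "a \<in> A"
    using assms(2) by blast
  have "norm (\<Prod>l\<in>A - {a}. x $ l) \<le> 1"
    unfolding prod_norm [symmetric] using assms(1) by (intro prod_le_1) (auto simp: polydisc_iff less_imp_le)
  then have "norm (x $ a) * norm (\<Prod>l\<in>A - {a}. x $ l) \<le> norm (x $ a) * 1"
    by (intro mult_left_mono) auto
  also have "\<dots> < 1"
    using assms(1) by (simp add: polydisc_iff)
  finally show ?thesis
    using a assms(3) by (simp add: prod.remove norm_mult)
qed

lemma norm_zcoord: "x \<in> polydisc \<Longrightarrow> norm (zcoord i x) < 1"
  unfolding zcoord_def by (rule norm_prod_lt_1) auto

lemma norm_zprod: "x \<in> polydisc \<Longrightarrow> i < j \<Longrightarrow> norm (zprod i j x) < 1"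
  unfolding zprod_def by (rule norm_prod_lt_1) auto

lemma zcoord_neq_1: "x \<in> polydisc \<Longrightarrow> zcoord i x \<noteq> 1"
  using norm_zcoord [of x i] by auto

lemma zprod_neq_1: "x \<in> polydisc \<Longrightarrow> i < j \<Longrightarrow> zprod i j x \<noteq> 1"
  using norm_zprod [of x i j] by auto

lemma zcoord_neq_0: "x \<in> punctured \<Longrightarrow> zcoord i x \<noteq> 0"
  by (simp add: zcoord_def punctured_iff)

lemma zcoord_diff: "i \<le> j \<Longrightarrow> zcoord i x - zcoord j x = zcoord j x * (zprod i j x - 1)"
  by (simp add: zcoord_split algebra_simps)

lemma continuous_on_zcoord: "continuous_on S (zcoord i)"
  unfolding zcoord_def by (intro continuous_intros)

lemma continuous_on_zprod: "continuous_on S (zprod i j)"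
  unfolding zprod_def by (intro continuous_intros)

lemma zcoord_upd: "zcoord i (upd k t x) = (if i \<le> k then t * (\<Prod>l\<in>{i..} - {k}. x $ l) else zcoord i x)"
proof (cases "i \<le> k")
  case True
  then have "zcoord i (upd k t x) = t * (\<Prod>l\<in>{i..} - {k}. upd k t x $ l)"
    unfolding zcoord_def by (subst prod.remove [of _ k]) auto
  also have "(\<Prod>l\<in>{i..} - {k}. upd k t x $ l) = (\<Prod>l\<in>{i..} - {k}. x $ l)"
    by (intro prod.cong) auto
  finally show ?thesis
    using True by simp
next
  case False
  then show ?thesis
    unfolding zcoord_def by (auto intro!: prod.cong)
qed

lemma zcoord_has_derivative:
  assumes "x $ k \<noteq> 0"
  shows "((\<lambda>t. zcoord i (upd k t x)) has_field_derivative of_bool (i \<le> k) * zcoord i x / x $ k) (at (x $ k))"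
proof (cases "i \<le> k")
  case True
  have "zcoord i x = x $ k * (\<Prod>l\<in>{i..} - {k}. x $ l)"
    using zcoord_upd [of i k "x $ k" x] True by simp
  then show ?thesis
    using True assms by (auto simp: zcoord_upd intro!: derivative_eq_intros)
qed (simp add: zcoord_upd)

lemma dlog_coeff_upd:
  assumes "((\<lambda>t. f (upd k t x)) has_field_derivative D) (at (x $ k))"
  shows "dlog_coeff k f x = D / f x"
  using DERIV_imp_deriv [OF assms] by (simp add: dlog_coeff_def pderiv_at_def upd_def)

lemma dlog_forms:
  assumes x: "x \<in> punctured"
  shows "x $ k * dlog_coeff k (zcoord i) x = of_bool (i \<le> k)"
    and "x $ k * dlog_coeff k (\<lambda>y. zcoord i y - 1) x = of_bool (i \<le> k) * zcoord i x / (zcoord i x - 1)"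
    and "x $ k * dlog_coeff k (\<lambda>y. zcoord i y - zcoord j y) x
      = (of_bool (i \<le> k) * zcoord i x - of_bool (j \<le> k) * zcoord j x) / (zcoord i x - zcoord j x)"
proof -
  have k: "x $ k \<noteq> 0"
    using x by (simp add: punctured_iff)
  note D = zcoord_has_derivative [where k = k, OF k]
  show "x $ k * dlog_coeff k (zcoord i) x = of_bool (i \<le> k)"
    using zcoord_neq_0 [OF x, of i] k dlog_coeff_upd [OF D [of i]] by simp
  have "((\<lambda>t. zcoord i (upd k t x) - 1) has_field_derivative of_bool (i \<le> k) * zcoord i x / x $ k) (at (x $ k))"
    by (auto intro!: derivative_eq_intros D)
  from dlog_coeff_upd [where f = "\<lambda>y. zcoord i y - 1", OF this]
  show "x $ k * dlog_coeff k (\<lambda>y. zcoord i y - 1) x = of_bool (i \<le> k) * zcoord i x / (zcoord i x - 1)"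
    using k by simp
  have "((\<lambda>t. zcoord i (upd k t x) - zcoord j (upd k t x)) has_field_derivative
      of_bool (i \<le> k) * zcoord i x / x $ k - of_bool (j \<le> k) * zcoord j x / x $ k) (at (x $ k))"
    by (intro DERIV_diff D)
  from dlog_coeff_upd [where f = "\<lambda>y. zcoord i y - zcoord j y", OF this]
  show "x $ k * dlog_coeff k (\<lambda>y. zcoord i y - zcoord j y) x
      = (of_bool (i \<le> k) * zcoord i x - of_bool (j \<le> k) * zcoord j x) / (zcoord i x - zcoord j x)"
    using k by (simp add: diff_divide_distrib [symmetric])
qed

text \<open>Cancelling z_j leaves an expression that is continuous on the whole polydisc.\<close>

lemma dlog_form_diff:
  assumes x: "x \<in> punctured" and "i < j"
  shows "x $ k * dlog_coeff k (\<lambda>y. zcoord i y - zcoord j y) x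
      = (of_bool (i \<le> k) * zprod i j x - of_bool (j \<le> k)) / (zprod i j x - 1)"
proof -
  have "of_bool (i \<le> k) * zcoord i x - of_bool (j \<le> k) * zcoord j x
      = zcoord j x * (of_bool (i \<le> k) * zprod i j x - of_bool (j \<le> k))"
    using \<open>i < j\<close> zcoord_split [of i j x] by (simp add: algebra_simps)
  then show ?thesis
    unfolding dlog_forms(3) [OF x] using zcoord_diff [of i j x] \<open>i < j\<close> zcoord_neq_0 [OF x, of j]
    by simp
qed

section \<open>Restriction to the hyperplane \<open>x\<^sub>n = 0\<close>\<close>

text \<open>The equations hold only off the hyperplane, so move parallel to it at height \<tau>.
  Along s v the derivative is the sum of the \<open>S k\<close> / s with k other than n, uniformly
  small as \<tau> tends to 0 because the \<open>S k\<close> vanish at height 0. In the limit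
  \<open>f\<close> is constant on the rays of the hyperplane, hence equal to its value at the
  origin.\<close>

lemma vanish_on_hyperplane:
  fixes f :: "complex ^ 'n::finite \<Rightarrow> complex"
  assumes f: "f \<in> holo_polydisc" "f 0 = 0" and S: "\<And>k. continuous_on polydisc (S k)"
    and S0: "\<And>k x. x \<in> polydisc \<Longrightarrow> x $ n = 0 \<Longrightarrow> S k x = 0"
    and D: "\<And>k x. x \<in> punctured \<Longrightarrow> x $ k * pderiv_at k f x = S k x"
    and x: "x \<in> polydisc" "x $ n = 0"
  shows "f x = 0"
proof -
  have p: "f (upd n 0 v) = 0" if v: "v \<in> punctured" for v
  proof -
    define \<gamma> :: "complex \<Rightarrow> complex \<Rightarrow> complex ^ 'n" where "\<gamma> s \<tau> = upd n \<tau> (\<chi> i. s * v $ i)" for s \<tau>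
    have mem: "\<gamma> s \<tau> \<in> polydisc" if "norm s \<le> 1" "norm \<tau> < 1" for s \<tau>
    proof -
      have "norm (s * v $ i) < 1" for i
      proof -
        have "norm (s * v $ i) \<le> norm (v $ i)"
          using that by (simp add: norm_mult mult_left_le_one_le)
        also have "\<dots> < 1"
          using v by (simp add: punctured_iff)
        finally show ?thesis .
      qed
      then show ?thesis
        using that by (simp add: polydisc_iff \<gamma>_def)
    qed
    have pmem: "\<gamma> s \<tau> \<in> punctured" if "norm s \<le> 1" "norm \<tau> < 1" "s \<noteq> 0" "\<tau> \<noteq> 0" for s \<tau>
      using mem [OF that(1,2)] that v by (auto simp: punctured_def \<gamma>_def)
    have cont: "continuous_on T (\<lambda>p. \<gamma> (of_real (fst p)) (of_real (snd p)))" for T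
    proof -
      have "continuous_on T (\<lambda>p. if j = n then of_real (snd p) else of_real (fst p) * v $ j :: complex)" for j
        by (cases "j = n") (auto intro!: continuous_intros)
      then show ?thesis
        unfolding \<gamma>_def upd_def vec_lambda_beta by (rule continuous_on_vec_lambda)
    qed
    have eq: "f (\<gamma> 1 0) = f (\<gamma> (of_real \<delta>) 0)" if \<delta>: "0 < \<delta>" "\<delta> \<le> 1" for \<delta> :: real
    proof -
      \<comment> \<open>A compact rectangle for uniform continuity: \<delta> > 0 keeps the division
        by s harmless, and 1/2 keeps the last parameter inside the unit disc.\<close>
      define K where "K = {\<delta>..1} \<times> {0..1/2::real}"
      define \<Psi> where "\<Psi> p = (\<Sum>k\<in>UNIV - {n}. S k (\<gamma> (of_real (fst p)) (of_real (snd p))) / of_real (fst p))" for p :: "real \<times> real"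
      have memK: "\<gamma> (of_real (fst p)) (of_real (snd p)) \<in> polydisc" if "p \<in> K" for p
        using that \<delta> by (intro mem) (auto simp: K_def)
      have "continuous_on K \<Psi>"
        unfolding \<Psi>_def using \<delta>
        by (intro continuous_intros continuous_on_compose2 [OF S cont]) (use memK in \<open>auto simp: K_def\<close>)
      moreover have "compact K"
        unfolding K_def by (intro compact_Times compact_Icc)
      ultimately have uc: "uniformly_continuous_on K \<Psi>"
        by (rule compact_uniformly_continuous)
      have \<Psi>0: "\<Psi> (s, 0) = 0" if "(s, 0) \<in> K" for s
        unfolding \<Psi>_def using memK [OF that] by (intro sum.neutral) (auto simp: S0 \<gamma>_def)
      have small: "norm (f (\<gamma> 1 0) - f (\<gamma> (of_real \<delta>) 0)) \<le> e" if "e > 0" for e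
      proof -
        obtain d where d: "d > 0" "\<And>p q. p \<in> K \<Longrightarrow> q \<in> K \<Longrightarrow> dist q p < d \<Longrightarrow> dist (\<Psi> q) (\<Psi> p) < e"
          using uc \<open>e > 0\<close> unfolding uniformly_continuous_on_def by metis
        have bound: "norm (f (\<gamma> 1 (of_real \<tau>)) - f (\<gamma> (of_real \<delta>) (of_real \<tau>))) \<le> e"
          if \<tau>: "0 < \<tau>" "\<tau> < min d (1/2)" for \<tau>
        proof -
          let ?L = "closed_segment (complex_of_real \<delta>) (complex_of_real 1)"
          have L: "\<exists>r\<in>{\<delta>..1}. s = of_real r" if "s \<in> ?L" for s
            using that \<delta> unfolding closed_segment_of_real by (auto simp: closed_segment_eq_real_ivl)
          let ?f' = "\<lambda>s. \<Sum>k\<in>UNIV. pderiv_at k f (\<gamma> s (of_real \<tau>)) * (if k = n then 0 else v $ k)"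
          have "norm (f (\<gamma> (of_real 1) (of_real \<tau>)) - f (\<gamma> (of_real \<delta>) (of_real \<tau>)))
              \<le> e * norm (complex_of_real 1 - complex_of_real \<delta>)"
          proof (rule field_differentiable_bound [where S = ?L and f' = ?f'])
            fix s assume s: "s \<in> ?L"
            obtain r where r: "s = of_real r" "r \<in> {\<delta>..1}"
              using L [OF s] by blast
            have ns: "norm s \<le> 1" "s \<noteq> 0"
              using r \<delta> by auto
            have nt: "norm (complex_of_real \<tau>) < 1" "complex_of_real \<tau> \<noteq> 0"
              using \<tau> by auto
            have "((\<lambda>s. \<gamma> s (of_real \<tau>) $ k) has_field_derivative (if k = n then 0 else v $ k)) (at s)" for k
              by (cases "k = n") (auto simp: \<gamma>_def intro!: derivative_eq_intros)
            from holo_chain [OF f(1) mem [OF ns(1) nt(1)] this]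
            show "((\<lambda>s. f (\<gamma> s (of_real \<tau>))) has_field_derivative ?f' s) (at s within ?L)"
              by (rule has_field_derivative_at_within)
            have K: "(r, \<tau>) \<in> K" "(r, 0) \<in> K"
              using r \<tau> by (auto simp: K_def)
            have "?f' s = (\<Sum>k\<in>UNIV - {n}. pderiv_at k f (\<gamma> s (of_real \<tau>)) * v $ k)"
              by (intro sum.mono_neutral_cong_right) auto
            also have "\<dots> = \<Psi> (r, \<tau>)"
              unfolding \<Psi>_def
            proof (rule sum.cong)
              fix k assume "k \<in> UNIV - {n}"
              then have "s * v $ k * pderiv_at k f (\<gamma> s (of_real \<tau>)) = S k (\<gamma> s (of_real \<tau>))"
                using D [OF pmem [OF ns(1) nt(1) ns(2) nt(2)], of k] by (simp add: \<gamma>_def)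
              then show "pderiv_at k f (\<gamma> s (of_real \<tau>)) * v $ k =
                  S k (\<gamma> (of_real (fst (r, \<tau>))) (of_real (snd (r, \<tau>)))) / of_real (fst (r, \<tau>))"
                using ns(2) by (simp add: r(1) field_simps)
            qed simp
            also have "norm \<dots> \<le> e"
              using d(2) [OF K(2) K(1)] \<tau> \<Psi>0 [OF K(2)] by (simp add: dist_Pair_Pair dist_norm)
            finally show "norm (?f' s) \<le> e" .
          qed auto
          also have "\<dots> \<le> e * 1"
            using \<open>e > 0\<close> \<delta> unfolding of_real_diff [symmetric] norm_of_real by (intro mult_left_mono) auto
          finally show ?thesis
            by simp
        qed
        have lim: "((\<lambda>\<tau>. f (\<gamma> s (of_real \<tau>))) \<longlongrightarrow> f (\<gamma> s 0)) (at_right 0)" if "norm s \<le> 1" for s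
        proof -
          have "upd n 0 (\<chi> i. s * v $ i) \<in> polydisc"
            using mem [of s 0] that by (simp add: \<gamma>_def)
          then have "isCont (\<lambda>\<tau>. f (upd n \<tau> (\<chi> i. s * v $ i))) 0"
            by (rule isCont_upd [OF holo_continuous_on [OF f(1)]])
          moreover have "(complex_of_real \<longlongrightarrow> 0) (at_right 0)"
            by (auto intro!: tendsto_eq_intros)
          ultimately show ?thesis
            unfolding \<gamma>_def by (rule isCont_tendsto_compose)
        qed
        have "((\<lambda>\<tau>. norm (f (\<gamma> 1 (of_real \<tau>)) - f (\<gamma> (of_real \<delta>) (of_real \<tau>))))
            \<longlongrightarrow> norm (f (\<gamma> 1 0) - f (\<gamma> (of_real \<delta>) 0))) (at_right 0)"
          using \<delta> by (intro tendsto_intros lim) auto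
        moreover have "eventually (\<lambda>\<tau>. norm (f (\<gamma> 1 (of_real \<tau>)) - f (\<gamma> (of_real \<delta>) (of_real \<tau>))) \<le> e) (at_right 0)"
          using bound d(1) unfolding eventually_at_right_field by (intro exI [of _ "min d (1/2)"]) auto
        ultimately show ?thesis
          by (rule tendsto_upperbound) simp
      qed
      show ?thesis
        using field_le_epsilon [of "norm (f (\<gamma> 1 0) - f (\<gamma> (of_real \<delta>) 0))" 0] small by simp
    qed
    \<comment> \<open>The value along the ray is the same for all s in (0, 1]; continuity at s = 0
      compares it with the origin.\<close>
    have "isCont (\<lambda>s. f (\<gamma> s 0)) 0"
    proof (rule isCont_o2 [where f = "\<lambda>s. \<gamma> s 0"])
      have "continuous_on UNIV (\<lambda>s. if j = n then 0 else s * v $ j)" for j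
        by (cases "j = n") (auto intro!: continuous_intros)
      then have "continuous_on UNIV (\<lambda>s. \<gamma> s 0)"
        unfolding \<gamma>_def upd_def vec_lambda_beta by (rule continuous_on_vec_lambda)
      then show "isCont (\<lambda>s. \<gamma> s 0) 0"
        by (simp add: continuous_on_eq_continuous_at)
      show "isCont f (\<gamma> 0 0)"
        by (intro isCont_polydisc holo_continuous_on f mem) auto
    qed
    moreover have "(complex_of_real \<longlongrightarrow> 0) (at_right 0)"
      by (auto intro!: tendsto_eq_intros)
    ultimately have "((\<lambda>\<delta>. f (\<gamma> (of_real \<delta>) 0)) \<longlongrightarrow> f (\<gamma> 0 0)) (at_right 0)"
      by (rule isCont_tendsto_compose)
    moreover have "eventually (\<lambda>\<delta>. f (\<gamma> (of_real \<delta>) 0) = f (\<gamma> 1 0)) (at_right 0)"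
      unfolding eventually_at_right_field using eq by (intro exI [of _ 1]) auto
    ultimately have "f (\<gamma> 0 0) = f (\<gamma> 1 0)"
      by (intro tendsto_unique [OF trivial_limit_at_right_real _ tendsto_eventually])
    moreover have "\<gamma> 0 0 = 0" "\<gamma> 1 0 = upd n 0 v"
      by (simp_all add: \<gamma>_def vec_eq_iff)
    ultimately show ?thesis
      using f(2) by simp
  qed
  have c: "continuous_on polydisc (\<lambda>x. f (upd n 0 x))"
  proof (rule continuous_on_compose2 [OF holo_continuous_on [OF f(1)]])
    have "continuous_on polydisc (\<lambda>x. if j = n then 0 else x $ j :: complex)" for j
      by (cases "j = n") (auto intro!: continuous_intros)
    then show "continuous_on polydisc (\<lambda>x. upd n 0 x)"
      unfolding upd_def by (intro continuous_on_vec_lambda)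
  qed (auto simp: polydisc_iff)
  have "f (upd n 0 x) = 0"
    by (rule punctured_dense [OF c continuous_on_const p x(1)])
  moreover have "upd n 0 x = x"
    using x(2) by (auto simp: vec_eq_iff)
  ultimately show ?thesis
    by simp
qed

section \<open>The series attached to a word\<close>

text \<open>\<open>hom_part w K z\<close> is the part of degree \<open>K\<close> in \<open>z\<close> of the function attached to \<open>w\<close>: the letter
  \<open>X\<^sub>\<beta>\<^sub>\<omega>\<close> inverts the Euler operator, and \<open>X\<^sub>i\<^sub>\<beta>\<close> in addition multiplies by \<open>z\<^sub>i / (z\<^sub>i - 1)\<close>.\<close>

fun hom_part :: "'n option list \<Rightarrow> nat \<Rightarrow> ('n \<Rightarrow> complex) \<Rightarrow> complex" where
  "hom_part [] K z = of_bool (K = 0)"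
| "hom_part (None # w) K z = hom_part w K z / of_nat K"
| "hom_part (Some i # w) K z = - (\<Sum>J<K. hom_part w J z * z i ^ (K - J)) / of_nat K"

lemma hom_part_0: "w \<noteq> [] \<Longrightarrow> hom_part w 0 z = 0"
  by (cases "(w, 0 :: nat, z)" rule: hom_part.cases) auto

text \<open>A letter X_i\<beta> sums K terms of size at most r^K, which the division by K
  compensates.\<close>

lemma hom_part_bound:
  assumes "0 \<le> r" "\<And>i. norm (z i) \<le> r"
  shows "norm (hom_part w K z) \<le> r ^ K"
proof (induction w arbitrary: K)
  case (Cons q w)
  show ?case
  proof (cases "K = 0")
    case False
    show ?thesis
    proof (cases q)
      case None
      have "norm (hom_part w K z) / of_nat K \<le> norm (hom_part w K z) / 1"
        using False by (intro divide_left_mono) auto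
      also have "\<dots> \<le> r ^ K"
        using Cons by simp
      finally show ?thesis
        using None by (simp add: norm_divide)
    next
      case (Some i)
      have "norm (\<Sum>J<K. hom_part w J z * z i ^ (K - J)) \<le> (\<Sum>J<K. r ^ K)"
      proof (rule sum_norm_le)
        fix J assume "J \<in> {..<K}"
        then have "r ^ K = r ^ J * r ^ (K - J)"
          by (simp flip: power_add)
        moreover have "norm (hom_part w J z * z i ^ (K - J)) \<le> r ^ J * r ^ (K - J)"
          unfolding norm_mult norm_power using assms Cons by (intro mult_mono power_mono) auto
        ultimately show "norm (hom_part w J z * z i ^ (K - J)) \<le> r ^ K"
          by simp
      qed
      then have "norm (\<Sum>J<K. hom_part w J z * z i ^ (K - J)) / of_nat K \<le> r ^ K"
        using False by (simp add: divide_simps mult.commute)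
      then show ?thesis
        using Some by (simp add: norm_divide)
    qed
  qed (simp add: hom_part_0)
qed (use assms(1) in simp)

lemma hom_part_homogeneous: "hom_part w K (\<lambda>i. t * z i) = t ^ K * hom_part w K z"
proof (induction w arbitrary: K)
  case (Cons q w)
  show ?case
  proof (cases q)
    case (Some i)
    have "(\<Sum>J<K. (t ^ J * hom_part w J z) * (t * z i) ^ (K - J)) = (\<Sum>J<K. t ^ K * (hom_part w J z * z i ^ (K - J)))"
    proof (rule sum.cong)
      fix J assume "J \<in> {..<K}"
      then have "t ^ K = t ^ J * t ^ (K - J)"
        by (simp flip: power_add)
      then show "(t ^ J * hom_part w J z) * (t * z i) ^ (K - J) = t ^ K * (hom_part w J z * z i ^ (K - J))"
        by (simp add: power_mult_distrib mult_ac)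
    qed simp
    then show ?thesis
      using Some by (simp add: Cons sum_distrib_left)
  qed (simp add: Cons)
qed (simp add: of_bool_def)

definition word_series :: "'n option list \<Rightarrow> complex ^ 'n::{finite,linorder} \<Rightarrow> complex" where
  "word_series w x = (\<Sum>K. hom_part w K (\<lambda>i. zcoord i x))"

lemma norm_zcoord_le:
  assumes "\<And>i. norm (x $ i) \<le> r" "r \<le> 1"
  shows "norm (zcoord i x) \<le> r"
proof -
  have "norm (\<Prod>l\<in>{i..} - {i}. x $ l) \<le> 1"
    unfolding prod_norm [symmetric] using assms order_trans by (intro prod_le_1) fastforce
  then have "norm (x $ i) * norm (\<Prod>l\<in>{i..} - {i}. x $ l) \<le> norm (x $ i) * 1"
    by (intro mult_left_mono) auto
  then show ?thesis
    unfolding zcoord_def using assms(1) [of i] by (simp add: prod.remove [of "{i..}" i] norm_mult)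
qed

lemma polydisc_radius:
  fixes x :: "complex ^ 'n::finite"
  assumes "x \<in> polydisc"
  obtains r where "0 < r" "r < 1" "\<And>i. norm (x $ i) < r"
proof -
  define m where "m = Max (insert 0 (range (\<lambda>i. norm (x $ i))))"
  have "m < 1"
    using assms by (simp add: m_def polydisc_iff)
  have le: "0 \<le> m"
    by (simp add: m_def)
  have "norm (x $ i) \<le> m" for i
    unfolding m_def by (rule Max_ge) auto
  moreover obtain r where "m < r" "r < 1"
    using dense [OF \<open>m < 1\<close>] by blast
  ultimately show ?thesis
    using that [of r] le by (meson le_less_trans)
qed

lemma hom_part_summable:
  assumes "x \<in> polydisc"
  shows "summable (\<lambda>K. norm (hom_part w K (\<lambda>i. zcoord i x)))"
proof -
  obtain r where r: "0 < r" "r < 1" "\<And>i. norm (x $ i) < r"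
    using polydisc_radius [OF assms] by metis
  have "norm (hom_part w K (\<lambda>i. zcoord i x)) \<le> r ^ K" for K
    using r by (intro hom_part_bound norm_zcoord_le) (auto intro: less_imp_le)
  then have "norm (norm (hom_part w K (\<lambda>i. zcoord i x))) \<le> r ^ K" for K
    by simp
  moreover have "summable (\<lambda>K. r ^ K)"
    using r by (intro summable_geometric) auto
  ultimately show ?thesis
    by (meson summable_comparison_test')
qed

lemma continuous_on_hom_part: "continuous_on S (\<lambda>x. hom_part w K (\<lambda>i. zcoord i x))"
proof (induction w arbitrary: K)
  case (Cons q w)
  then show ?case
    by (cases q; cases "K = 0") (auto simp: hom_part_0 intro!: continuous_intros continuous_on_zcoord)
qed (auto intro!: continuous_intros)

lemma continuous_on_word_series:
  fixes w :: "'n::{finite,linorder} option list"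
  shows "continuous_on polydisc (word_series w)"
proof (rule continuous_at_imp_continuous_on, rule ballI)
  fix x :: "complex ^ 'n::{finite,linorder}"
  assume "x \<in> polydisc"
  then obtain r where r: "0 < r" "r < 1" "\<And>i. norm (x $ i) < r"
    using polydisc_radius by metis
  define U :: "(complex ^ 'n::{finite,linorder}) set" where "U = (\<Inter>i. {y. norm (y $ i) < r})"
  have U: "open U"
    unfolding U_def by (intro open_INT ballI open_Collect_less continuous_intros) auto
  have "uniform_limit U (\<lambda>n x. \<Sum>K<n. hom_part w K (\<lambda>i. zcoord i x)) (\<lambda>x. \<Sum>K. hom_part w K (\<lambda>i. zcoord i x)) sequentially"
  proof (rule Weierstrass_m_test [where M = "\<lambda>K. r ^ K"])
    show "norm (hom_part w K (\<lambda>i. zcoord i y)) \<le> r ^ K" if "y \<in> U" for K y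
      using that r by (intro hom_part_bound norm_zcoord_le) (auto simp: U_def intro: less_imp_le)
    show "summable (\<lambda>K. r ^ K)"
      using r by (intro summable_geometric) auto
  qed
  then have "continuous_on U (\<lambda>x. \<Sum>K. hom_part w K (\<lambda>i. zcoord i x))"
    by (rule uniform_limit_theorem [rotated])
      (auto intro!: always_eventually continuous_on_sum continuous_on_hom_part)
  then have "continuous_on U (word_series w)"
    by (simp add: word_series_def [abs_def])
  moreover have "x \<in> U"
    using r by (simp add: U_def)
  ultimately show "isCont (word_series w) x"
    using U by (simp add: continuous_on_eq_continuous_at)
qed

lemma word_series_Nil: "word_series [] x = 1"
proof -
  have "(\<lambda>K. hom_part [] K (\<lambda>i. zcoord i x)) sums (\<Sum>K\<in>{0}. hom_part [] K (\<lambda>i. zcoord i x))"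
    by (rule sums_finite) auto
  then show ?thesis
    by (simp add: word_series_def sums_iff)
qed

text \<open>Every z_i contains the factor x_n.\<close>

lemma word_series_hyperplane:
  assumes "w \<noteq> []" "x $ Max UNIV = 0"
  shows "word_series w x = 0"
proof -
  have z: "zcoord i x = 0" for i
    unfolding zcoord_def using assms(2) by (intro prod_zero) auto
  have "hom_part w K (\<lambda>i. zcoord i x) = 0" for K
  proof (cases "K = 0")
    case False
    have "norm (hom_part w K (\<lambda>i. zcoord i x)) \<le> 0 ^ K"
      by (rule hom_part_bound) (simp_all add: z)
    also have "\<dots> = 0"
      using False by simp
    finally show ?thesis
      by simp
  qed (simp add: hom_part_0 assms)
  then show ?thesis
    by (simp add: word_series_def)
qed

text \<open>Each z_i contains x_n exactly once, so the part of degree K is a multiple of t^K and the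
  series is a power series in t. The Euler operator multiplies by K, which cancels the denominator
  in \<open>hom_part\<close>; for X_i\<beta> the remaining sum is a Cauchy product with the
  expansion of z / (z - 1).\<close>

lemma word_series_deriv:
  fixes x :: "complex ^ 'n::{finite,linorder}"
  defines "n \<equiv> Max (UNIV :: 'n set)"
  assumes x: "x \<in> polydisc" and t: "norm t < 1" and w: "q = None \<Longrightarrow> w \<noteq> []"
  obtains D where "((\<lambda>t. word_series (q # w) (upd n t x)) has_field_derivative D) (at t)"
    and "t * D = (case q of None \<Rightarrow> word_series w (upd n t x)
      | Some i \<Rightarrow> word_series w (upd n t x) * (zcoord i (upd n t x) / (zcoord i (upd n t x) - 1)))"
proof -
  define \<zeta> where "\<zeta> i = (\<Prod>l\<in>{i..} - {n}. x $ l)" for i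
  have z: "zcoord i (upd n t x) = t * \<zeta> i" for i t
    by (simp add: zcoord_upd n_def \<zeta>_def)
  have \<zeta>: "norm (\<zeta> i) \<le> 1" for i
    unfolding \<zeta>_def prod_norm [symmetric] using x by (intro prod_le_1) (auto simp: polydisc_iff less_imp_le)
  have hp: "hom_part v K (\<lambda>i. zcoord i (upd n t x)) = hom_part v K \<zeta> * t ^ K" for v K t
    by (simp add: z hom_part_homogeneous mult.commute)
  have bound: "norm (hom_part v K \<zeta>) \<le> 1" for v K
    using hom_part_bound [of 1 \<zeta> v K] \<zeta> by simp
  have sum: "summable (\<lambda>K. norm (hom_part v K \<zeta> * t ^ K))" if "norm t < 1" for v t
  proof (rule summable_comparison_test' [where N = 0 and g = "\<lambda>K. norm t ^ K"])
    show "summable (\<lambda>K. norm t ^ K)"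
      using that by (intro summable_geometric) auto
    show "norm (norm (hom_part v K \<zeta> * t ^ K)) \<le> norm t ^ K" for K
      using bound [of v K] by (simp add: norm_mult norm_power mult_left_le_one_le)
  qed
  define a where "a K = hom_part (q # w) K \<zeta>" for K
  have sa: "summable (\<lambda>K. a K * s ^ K)" if "norm s < 1" for s
    unfolding a_def using summable_norm_cancel [OF sum [OF that]] .
  define D where "D = (\<Sum>K. diffs a K * t ^ K)"
  show ?thesis
  proof (rule that [of D])
    have "((\<lambda>t. \<Sum>K. a K * t ^ K) has_field_derivative D) (at t)"
      unfolding D_def by (rule termdiffs_strong' [of 1]) (use sa t in auto)
    then show "((\<lambda>t. word_series (q # w) (upd n t x)) has_field_derivative D) (at t)"
      by (simp add: word_series_def hp a_def)
    have "summable (\<lambda>K. diffs a K * t ^ K)"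
      by (rule termdiff_converges [of _ 1]) (use sa t in auto)
    from sums_mult [OF diffs_equiv [OF this], of t]
    have "(\<lambda>K. t * (of_nat K * a K * t ^ (K - Suc 0))) sums (t * D)"
      by (simp add: D_def)
    moreover have "t * (of_nat K * a K * t ^ (K - Suc 0)) = of_nat K * a K * t ^ K" for K
      by (cases K) auto
    ultimately have tD: "(\<lambda>K. of_nat K * a K * t ^ K) sums (t * D)"
      by simp
    show "t * D = (case q of None \<Rightarrow> word_series w (upd n t x)
      | Some i \<Rightarrow> word_series w (upd n t x) * (zcoord i (upd n t x) / (zcoord i (upd n t x) - 1)))"
    proof (cases q)
      case None
      \<comment> \<open>For K = 0 both sides vanish because \<open>w\<close> is nonempty; division
        by zero would hide a constant term.\<close>
      have "(\<lambda>K. of_nat K * a K * t ^ K) = (\<lambda>K. hom_part w K \<zeta> * t ^ K)"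
      proof
        show "of_nat K * a K * t ^ K = hom_part w K \<zeta> * t ^ K" for K
          using None w by (cases "K = 0") (simp_all add: a_def hom_part_0)
      qed
      with tD have "(\<lambda>K. hom_part w K \<zeta> * t ^ K) sums (t * D)"
        by simp
      then show ?thesis
        unfolding word_series_def hp None by (simp add: sums_iff)
    next
      case (Some i)
      \<comment> \<open>The geometric series without its constant term, so that the Cauchy product
        runs over J < K as in \<open>hom_part\<close>.\<close>
      define b where "b m = (if m = 0 then 0 else (t * \<zeta> i) ^ m)" for m :: nat
      have nz: "norm (t * \<zeta> i) < 1"
        using t \<zeta> [of i] by (metis mult_left_le norm_ge_zero norm_mult order.strict_trans1)
      have b': "(\<lambda>m. (t * \<zeta> i) ^ Suc m) sums (t * \<zeta> i * (1 / (1 - t * \<zeta> i)))"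
        using sums_mult [OF geometric_sums [OF nz], of "t * \<zeta> i"] by simp
      have bs: "b sums (t * \<zeta> i / (1 - t * \<zeta> i))"
        by (rule sums_Suc_imp) (use b' in \<open>simp_all add: b_def\<close>)
      have "summable (\<lambda>m. norm (t * \<zeta> i) ^ m)"
        using nz by (intro summable_geometric) auto
      then have "summable (\<lambda>m. norm (b m))"
        by (rule summable_comparison_test' [where N = 0]) (auto simp: b_def norm_power norm_mult power_mult_distrib)
      from Cauchy_product_sums [OF sum [OF t, of w] this]
      have "(\<lambda>K. \<Sum>J\<le>K. hom_part w J \<zeta> * t ^ J * b (K - J)) sums (word_series w (upd n t x) * (t * \<zeta> i / (1 - t * \<zeta> i)))"
        using bs by (simp add: word_series_def hp sums_iff)
      from sums_minus [OF this]
      have "(\<lambda>K. - (\<Sum>J\<le>K. hom_part w J \<zeta> * t ^ J * b (K - J))) sums (word_series w (upd n t x) * (t * \<zeta> i / (t * \<zeta> i - 1)))"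
        by (simp only: minus_diff_eq minus_divide_right mult_minus_right [symmetric])
      moreover have "- (\<Sum>J\<le>K. hom_part w J \<zeta> * t ^ J * b (K - J)) = of_nat K * a K * t ^ K" for K
      proof -
        have "(\<Sum>J\<le>K. hom_part w J \<zeta> * t ^ J * b (K - J)) = (\<Sum>J<K. hom_part w J \<zeta> * t ^ J * b (K - J))"
          by (simp add: lessThan_Suc_atMost [symmetric] b_def)
        also have "\<dots> = (\<Sum>J<K. t ^ K * (hom_part w J \<zeta> * \<zeta> i ^ (K - J)))"
        proof (rule sum.cong)
          fix J assume J: "J \<in> {..<K}"
          then have "t ^ K = t ^ J * t ^ (K - J)"
            by (simp flip: power_add)
          then show "hom_part w J \<zeta> * t ^ J * b (K - J) = t ^ K * (hom_part w J \<zeta> * \<zeta> i ^ (K - J))"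
            using J by (simp add: b_def power_mult_distrib mult_ac)
        qed simp
        finally show ?thesis
          using Some by (cases "K = 0") (simp_all add: a_def sum_distrib_left [symmetric])
      qed
      ultimately have "(\<lambda>K. of_nat K * a K * t ^ K) sums (word_series w (upd n t x) * (t * \<zeta> i / (t * \<zeta> i - 1)))"
        by simp
      then show ?thesis
        using tD Some by (simp add: z sums_unique2)
    qed
  qed
qed

section \<open>Iterated integrals of coefficient functionals\<close>

context
  fixes \<iota> :: "('n::{finite,linorder} p_full uea \<Rightarrow> complex) \<Rightarrow> 'n logpoly"
  assumes iim: "iterated_integral_map \<iota>"
begin

lemma iota_logpolys: "\<phi> \<in> graded_dual \<Longrightarrow> \<iota> \<phi> \<in> logpolys"
  and iota_add: "\<phi> \<in> graded_dual \<Longrightarrow> \<psi> \<in> graded_dual \<Longrightarrow> \<iota> (\<lambda>u. \<phi> u + \<psi> u) = (\<lambda>p x. \<iota> \<phi> p x + \<iota> \<psi> p x)"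
  and iota_scale: "\<phi> \<in> graded_dual \<Longrightarrow> \<iota> (\<lambda>u. c * \<phi> u) = (\<lambda>p x. c * \<iota> \<phi> p x)"
  and iota_counit: "\<iota> counit = of_holo (\<lambda>_. 1)"
  and iota_init: "0 < d \<Longrightarrow> \<phi> \<in> homogeneous_dual d \<Longrightarrow> \<iota> \<phi> (\<lambda>_. 0) 0 = 0"
  using iim unfolding iterated_integral_map_def by blast+

lemma iota_deriv:
  assumes "\<phi> \<in> graded_dual" "x \<in> punctured"
  shows "logpoly_deriv k (\<iota> \<phi>) p x =
          (\<Sum>i\<in>UNIV. \<iota> (contract \<phi> al (pt i)) p x * dlog_coeff k (zcoord i) x
                   + \<iota> (contract \<phi> (pt i) be) p x * dlog_coeff k (\<lambda>y. zcoord i y - 1) x)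
          + (\<Sum>(i, j)\<in>{(i, j). i < j}.
               \<iota> (contract \<phi> (pt i) (pt j)) p x * dlog_coeff k (\<lambda>y. zcoord i y - zcoord j y) x)"
  using iim assms unfolding iterated_integral_map_def punctured_def by blast

lemma iota_euler:
  assumes "\<phi> \<in> graded_dual" "x \<in> punctured"
  shows "x $ k * logpoly_deriv k (\<iota> \<phi>) p x =
          (\<Sum>i\<in>UNIV. \<iota> (contract \<phi> al (pt i)) p x * of_bool (i \<le> k)
                   + \<iota> (contract \<phi> (pt i) be) p x * (of_bool (i \<le> k) * zcoord i x / (zcoord i x - 1)))
          + (\<Sum>(i, j)\<in>{(i, j). i < j}. \<iota> (contract \<phi> (pt i) (pt j)) p x *
               ((of_bool (i \<le> k) * zprod i j x - of_bool (j \<le> k)) / (zprod i j x - 1)))"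
proof -
  have *: "x $ k * (a * d) = a * (x $ k * d)" for a d
    by (simp add: mult_ac)
  show ?thesis
    unfolding iota_deriv [OF assms] distrib_left sum_distrib_left
    by (intro arg_cong2 [of _ _ _ _ "(+)"] sum.cong HOL.refl)
      (auto simp: * dlog_forms(1,2) [OF assms(2)] dlog_form_diff [OF assms(2)] distrib_left)
qed

lemma iota_zero: "\<iota> (\<lambda>u. 0) = (\<lambda>p x. 0)"
  using iota_scale [OF coef_graded_dual, of 0 "[]"] by simp

lemma iota_sum:
  assumes "\<And>i. i \<in> I \<Longrightarrow> \<phi> i \<in> graded_dual"
  shows "\<iota> (\<lambda>u. \<Sum>i\<in>I. c i * \<phi> i u) = (\<lambda>p x. \<Sum>i\<in>I. c i * \<iota> (\<phi> i) p x)"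
  using assms
proof (induction I rule: infinite_finite_induct)
  case (insert i I)
  then show ?case
    using iota_add [OF graded_dual_scale [of "\<phi> i" "c i"] graded_dual_sum [of I \<phi> c]]
    by (simp add: iota_scale)
qed (simp_all add: iota_zero)

lemma contract_beta_omega:
  assumes "\<phi> \<in> graded_dual"
  shows "\<iota> (contract \<phi> be om) = (\<lambda>p x. (\<Sum>i\<in>UNIV. \<iota> (contract \<phi> al (pt i)) p x)
    + (\<Sum>(i, j)\<in>{(i, j). i < j}. \<iota> (contract \<phi> (pt i) (pt j)) p x))"
proof -
  have "contract \<phi> be om = (\<lambda>u. (\<Sum>i\<in>UNIV. 1 * contract \<phi> al (pt i) u)
      + (\<Sum>e\<in>{(i, j). i < j}. 1 * contract \<phi> (pt (fst e)) (pt (snd e)) u))"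
    by (simp add: contract_def Xgen_beta_omega emb_add emb_sum distrib_right sum_distrib_right
        graded_dual_lin [OF assms] case_prod_unfold)
  then have "\<iota> (contract \<phi> be om) = (\<lambda>p x. \<iota> (\<lambda>u. \<Sum>i\<in>UNIV. 1 * contract \<phi> al (pt i) u) p x
      + \<iota> (\<lambda>u. \<Sum>e\<in>{(i, j). i < j}. 1 * contract \<phi> (pt (fst e)) (pt (snd e)) u) p x)"
    by (simp only:) (intro iota_add graded_dual_sum graded_dual_contract assms)
  then show ?thesis
    by (simp only: iota_sum graded_dual_contract assms) (simp add: case_prod_unfold)
qed

lemma of_holo_apply: "x \<in> polydisc \<Longrightarrow> of_holo f p x = (if p = (\<lambda>_. 0) then f x else 0)"
  by (simp add: of_holo_def)

text \<open>Induction on the length. The equation for x_n is explicit, since the letters contract by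
  removal; the Euler equations of the other variables serve to exclude logarithms and to fix the
  initial value on x_n = 0.\<close>

lemma iota_coef:
  fixes s :: "'n p_sub \<Rightarrow> 'n p_full"
  assumes s: "beta_section s" and "adm w"
  shows "\<iota> (coef w) = of_holo (word_series w)"
  using assms(2)
proof (induction w rule: measure_induct_rule [of length])
  case (less w)
  define n where "n = Max (UNIV :: 'n set)"
  have le_n: "i \<le> n" for i
    by (simp add: n_def)
  show ?case
  proof (cases w)
    case Nil
    then show ?thesis
      by (simp add: coef_Nil iota_counit word_series_Nil [abs_def])
  next
    case (Cons q w')
    have adm': "adm w'" and ne: "q = None \<Longrightarrow> w' \<noteq> []"
      using less.prems Cons by (auto simp: adm_def split: if_splits)
    have IH': "\<iota> (coef w') = of_holo (word_series w')"
      using less.IH adm' Cons by simp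
    \<comment> \<open>The contractions by X_\<alpha>i and X_ij come with unspecified coefficients,
      so they are carried as functions with just the properties used below: continuity, vanishing
      for x_n = 0, and absence of logarithms.\<close>
    define good where "good a b P \<longleftrightarrow> continuous_on polydisc P \<and> (\<forall>x\<in>polydisc. x $ n = 0 \<longrightarrow> P x = 0) \<and>
        (\<forall>p. \<forall>x\<in>polydisc. \<iota> (contract (coef w) (Some a) (Some b)) p x = (if p = (\<lambda>_. 0) then P x else 0))"
      for a b and P :: "complex ^ 'n::{finite,linorder} \<Rightarrow> complex"
    have ex_good: "\<exists>P. good a b P" if ab: "a \<noteq> Omega" "b \<noteq> Omega" for a b
    proof -
      let ?G = "{v :: 'n option list. adm v \<and> v \<noteq> [] \<and> Suc (length v) = length w}"
      obtain c where c: "contract (coef w) (Some a) (Some b) = (\<lambda>u. \<Sum>v\<in>?G. c v * coef v u)"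
        using contract_coef_pair [OF s less.prems ab] by blast
      define P where "P x = (\<Sum>v\<in>?G. c v * word_series v x)" for x
      have "continuous_on polydisc P"
        unfolding P_def by (intro continuous_intros continuous_on_word_series)
      moreover have "P x = 0" if "x $ n = 0" for x
        unfolding P_def using that by (intro sum.neutral) (auto simp: word_series_hyperplane n_def)
      moreover have "\<iota> (contract (coef w) (Some a) (Some b)) p x = (if p = (\<lambda>_. 0) then P x else 0)"
        if "x \<in> polydisc" for p x
      proof -
        have "\<iota> (contract (coef w) (Some a) (Some b)) p x = (\<Sum>v\<in>?G. c v * \<iota> (coef v) p x)"
          unfolding c by (subst iota_sum) (simp_all add: coef_graded_dual)
        also have "\<dots> = (\<Sum>v\<in>?G. c v * of_holo (word_series v) p x)"
          by (intro sum.cong HOL.refl) (use less.IH in auto)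
        finally show ?thesis
          using that by (simp add: of_holo_apply P_def)
      qed
      ultimately show ?thesis
        unfolding good_def by blast
    qed
    define P where "P a b = (SOME P. good a b P)" for a b
    have "good a b (P a b)" if "a \<noteq> Omega" "b \<noteq> Omega" for a b
      unfolding P_def by (rule someI_ex [OF ex_good [OF that]])
    then have P: "\<And>a b. a \<noteq> Omega \<Longrightarrow> b \<noteq> Omega \<Longrightarrow> continuous_on polydisc (P a b)"
      "\<And>a b x. a \<noteq> Omega \<Longrightarrow> b \<noteq> Omega \<Longrightarrow> x \<in> polydisc \<Longrightarrow> x $ n = 0 \<Longrightarrow> P a b x = 0"
      "\<And>a b p x. a \<noteq> Omega \<Longrightarrow> b \<noteq> Omega \<Longrightarrow> x \<in> polydisc \<Longrightarrow>
        \<iota> (contract (coef w) (Some a) (Some b)) p x = (if p = (\<lambda>_. 0) then P a b x else 0)"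
      unfolding good_def by blast+
    define B where "B i x = of_bool (q = Some i) * word_series w' x" for i x
    have B: "\<iota> (contract (coef w) (pt i) be) p x = (if p = (\<lambda>_. 0) then B i x else 0)" if "x \<in> polydisc" for i p x
      using that by (simp add: Cons contract_coef_letter iota_scale coef_graded_dual IH' of_holo_apply B_def)
    define S where "S k x = (\<Sum>i\<in>UNIV. P Alpha (Pt i) x * of_bool (i \<le> k)
          + B i x * (of_bool (i \<le> k) * zcoord i x / (zcoord i x - 1)))
        + (\<Sum>(i, j)\<in>{(i, j). i < j}. P (Pt i) (Pt j) x *
            ((of_bool (i \<le> k) * zprod i j x - of_bool (j \<le> k)) / (zprod i j x - 1)))" for k x
    have S_cont: "continuous_on polydisc (S k)" for k
      unfolding S_def B_def case_prod_unfold
      by (intro continuous_intros P continuous_on_word_series continuous_on_zcoord continuous_on_zprod)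
        (auto simp: zcoord_neq_1 zprod_neq_1)
    have S_zero: "S k x = 0" if "x \<in> polydisc" "x $ n = 0" for k x
    proof -
      have "zcoord i x = 0" for i
        unfolding zcoord_def using that(2) le_n by (intro prod_zero) auto
      then show ?thesis
        unfolding S_def using that by (simp add: P(2) case_prod_unfold)
    qed
    have DE: "x $ k * logpoly_deriv k (\<iota> (coef w)) p x = (if p = (\<lambda>_. 0) then S k x else 0)"
      if "x \<in> punctured" for k p x
      unfolding iota_euler [OF coef_graded_dual that] S_def
      using punctured_polydisc [OF that] by (simp add: P(3) B case_prod_unfold)
    have S0: "S k 0 = 0" for k
      by (rule S_zero) (simp_all add: polydisc_iff)
    have no_logs1: "\<iota> (coef w) p = (\<lambda>_. 0)" if "p \<noteq> (\<lambda>_. 0)" for p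
      using that by (rule logpoly_no_logs(1) [OF iota_logpolys [OF coef_graded_dual] S_cont S0, rotated]) (rule DE)
    have no_logs2: "x $ k * pderiv_at k (\<iota> (coef w) (\<lambda>_. 0)) x = S k x" if "x \<in> punctured" for k x
      using that by (rule logpoly_no_logs(2) [OF iota_logpolys [OF coef_graded_dual] S_cont S0, rotated]) (rule DE)
    define f where "f = \<iota> (coef w) (\<lambda>_. 0)"
    have f: "f \<in> holo_polydisc"
      using iota_logpolys [OF coef_graded_dual, of w] by (simp add: f_def logpolys_def)
    have f0: "f 0 = 0"
      unfolding f_def by (rule iota_init [OF _ coef_homogeneous]) (simp add: Cons)
    have fD: "x $ k * pderiv_at k f x = S k x" if "x \<in> punctured" for k x
      using no_logs2 [OF that] by (simp add: f_def)
    have f_hyper: "f x = 0" if "x \<in> polydisc" "x $ n = 0" for x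
    proof (rule vanish_on_hyperplane [where S = S and n = n, OF f f0 S_cont])
    qed (use S_zero fD that in auto)
    \<comment> \<open>For k = n all comparisons with k hold, and numerator and denominator of the
      form belonging to X_ij cancel. All X_\<alpha>i and X_ij then have coefficient 1 and add up to
      X_\<beta>\<omega>.\<close>
    have Sn: "S n x = (case q of None \<Rightarrow> word_series w' x
        | Some i \<Rightarrow> word_series w' x * (zcoord i x / (zcoord i x - 1)))" if x: "x \<in> polydisc" for x
    proof -
      have "S n x = (\<Sum>i\<in>UNIV. P Alpha (Pt i) x) + (\<Sum>(i, j)\<in>{(i, j). i < j}. P (Pt i) (Pt j) x)
          + (\<Sum>i\<in>UNIV. B i x * (zcoord i x / (zcoord i x - 1)))"
      proof -
        have "(\<Sum>(i, j)\<in>{(i, j). i < j}. P (Pt i) (Pt j) x * ((of_bool (i \<le> n) * zprod i j x - of_bool (j \<le> n)) / (zprod i j x - 1)))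
            = (\<Sum>(i, j)\<in>{(i, j). i < j}. P (Pt i) (Pt j) x)"
          by (intro sum.cong) (auto simp: le_n zprod_neq_1 [OF x])
        then show ?thesis
          by (simp add: S_def le_n sum.distrib)
      qed
      also have "(\<Sum>i\<in>UNIV. P Alpha (Pt i) x) + (\<Sum>(i, j)\<in>{(i, j). i < j}. P (Pt i) (Pt j) x)
          = \<iota> (contract (coef w) be om) (\<lambda>_. 0) x"
        using x by (simp add: contract_beta_omega coef_graded_dual P(3) case_prod_unfold)
      also have "\<dots> = of_bool (q = None) * word_series w' x"
        using x by (simp add: Cons contract_coef_letter iota_scale coef_graded_dual IH' of_holo_apply)
      also have "(\<Sum>i\<in>UNIV. B i x * (zcoord i x / (zcoord i x - 1)))
          = (case q of None \<Rightarrow> 0 | Some i \<Rightarrow> word_series w' x * (zcoord i x / (zcoord i x - 1)))"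
      proof (cases q)
        case (Some j)
        have "(\<Sum>i\<in>UNIV. B i x * (zcoord i x / (zcoord i x - 1))) = (\<Sum>i\<in>{j}. B i x * (zcoord i x / (zcoord i x - 1)))"
          using Some by (intro sum.mono_neutral_right) (auto simp: B_def)
        then show ?thesis
          using Some by (simp add: B_def)
      qed (simp add: B_def)
      finally show ?thesis
        by (cases q) simp_all
    qed
    have "f x = word_series w x" if x: "x \<in> punctured" for x
    proof -
      have mem: "upd n t x \<in> polydisc" if "t \<in> ball 0 1" for t
        using x that by (auto simp: punctured_iff polydisc_iff)
      \<comment> \<open>On the line in the direction of x_n the difference has zero derivative off t
        = 0, and at t = 0 both functions vanish.\<close>
      define h where "h t = f (upd n t x) - word_series w (upd n t x)" for t
      have D: "\<exists>D. (h has_field_derivative D) (at t) \<and> t * D = 0" if t: "t \<in> ball 0 1" "t \<noteq> 0" for t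
      proof -
        have nt: "norm t < 1"
          using t by simp
        obtain D where D: "((\<lambda>t. word_series w (upd n t x)) has_field_derivative D) (at t)"
          "t * D = S n (upd n t x)"
          using word_series_deriv [OF punctured_polydisc [OF x] nt, of q w'] ne Sn [OF mem [OF t(1)]]
          unfolding Cons n_def by metis
        have "t * pderiv_at n f (upd n t x) = S n (upd n t x)"
          using fD [OF upd_punctured [OF x t(2) nt], of n n] by simp
        then have "t * (pderiv_at n f (upd n t x) - D) = 0"
          using D(2) by (simp add: right_diff_distrib)
        moreover have "(h has_field_derivative pderiv_at n f (upd n t x) - D) (at t)"
          unfolding h_def by (rule DERIV_diff [OF holo_upd [OF f mem [OF t(1)]] D(1)])
        ultimately show ?thesis
          by blast
      qed
      have "continuous_on (ball 0 1) h"
        unfolding h_def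
        by (intro continuous_intros continuous_on_compose2 [OF holo_continuous_on [OF f] continuous_on_upd]
            continuous_on_compose2 [OF continuous_on_word_series continuous_on_upd]) (use mem in auto)
      moreover have "\<forall>t\<in>ball 0 1 - {0}. DERIV h t :> 0"
        using D by fastforce
      ultimately obtain c where c: "\<And>t. t \<in> ball 0 1 \<Longrightarrow> h t = c"
        using DERIV_zero_connected_constant [of "ball 0 1" "{0}" h] by auto
      have "c = h 0"
        using c [of 0] by simp
      also have "h 0 = 0"
        using f_hyper [OF mem] word_series_hyperplane [of w "upd n 0 x"] Cons by (simp add: h_def n_def)
      finally have "h (x $ n) = 0"
        using c [of "x $ n"] x by (simp add: punctured_iff)
      then show ?thesis
        by (simp add: h_def)
    qed
    then have eq: "f x = word_series w x" if "x \<in> polydisc" for x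
      using punctured_dense [OF holo_continuous_on [OF f] continuous_on_word_series _ that] by blast
    show ?thesis
    proof (rule ext, rule ext)
      fix p x
      show "\<iota> (coef w) p x = of_holo (word_series w) p x"
      proof (cases "p = (\<lambda>_. 0)")
        case True
        then show ?thesis
          using eq f by (cases "x \<in> polydisc") (auto simp: of_holo_def f_def holo_polydisc_def)
      next
        case False
        then show ?thesis
          using no_logs1 [OF False] by (simp add: of_holo_def)
      qed
    qed
  qed
qed

end

section \<open>Polylogarithms as series attached to words\<close>

text \<open>The usual word of an iterated integral: an exponent \<open>a\<close> at the index
  \<open>i\<close> gives a - 1 letters X_\<beta>\<omega> followed by X_i\<beta>.\<close>

fun pair_word :: "(nat \<times> 'n) list \<Rightarrow> 'n option list" where
  "pair_word [] = []"
| "pair_word ((a, i) # P) = replicate (a - 1) None @ Some i # pair_word P"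

text \<open>Reversed, because the largest summation index belongs to the outermost integration, that
  is, to the first letters.\<close>

definition index_word :: "nat list \<Rightarrow> 'n list \<Rightarrow> 'n option list" where
  "index_word a \<kappa> = pair_word (rev (zip a \<kappa>))"

lemma index_word_snoc: "length a = length \<kappa> \<Longrightarrow>
    index_word (a @ [b]) (\<kappa> @ [q]) = replicate (b - 1) None @ Some q # index_word a \<kappa>"
  by (simp add: index_word_def)

lemma hom_part_replicate: "hom_part (replicate m None @ w) K z = hom_part w K z / of_nat K ^ m"
  by (induction m) simp_all

text \<open>The default 0 is the convention k_0 = 0: positivity of the first index becomes a case of
  strict increase, and \<open>K - last0 k\<close> is the right exponent also for the empty
  list.\<close>

definition last0 :: "nat list \<Rightarrow> nat" where
  "last0 k = (if k = [] then 0 else last k)"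

definition kset :: "nat \<Rightarrow> nat list set" where
  "kset N = {k. length k = N \<and> sorted_wrt (<) k \<and> (\<forall>r\<in>set k. 0 < r)}"

text \<open>The last index is the degree of the summand in the z_i, because all factors but the last
  are powers of quotients z_i / z_j. So this is the grouping used by
  \<open>hom_part\<close>.\<close>

definition klast :: "nat \<Rightarrow> nat \<Rightarrow> nat list set" where
  "klast N K = {k \<in> kset N. last0 k = K}"

lemma kset_0: "kset 0 = {[]}"
  by (auto simp: kset_def)

lemma le_last0: "sorted_wrt (<) k \<Longrightarrow> r \<in> set k \<Longrightarrow> r \<le> last0 k"
  by (induction k rule: rev_induct) (auto simp: last0_def sorted_wrt_append)

lemma kset_snoc: "k @ [K] \<in> kset (Suc N) \<longleftrightarrow> k \<in> kset N \<and> last0 k < K"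
proof
  assume "k @ [K] \<in> kset (Suc N)"
  then show "k \<in> kset N \<and> last0 k < K"
    by (auto simp: kset_def sorted_wrt_append last0_def)
next
  assume k: "k \<in> kset N \<and> last0 k < K"
  then have "\<forall>r\<in>set k. r < K"
    using le_last0 [of k] by (auto simp: kset_def intro: le_less_trans)
  then show "k @ [K] \<in> kset (Suc N)"
    using k by (auto simp: kset_def sorted_wrt_append)
qed

lemma finite_klast: "finite (klast N K)"
proof -
  have "klast N K \<subseteq> {k. set k \<subseteq> {..K} \<and> length k = N}"
    using le_last0 by (auto simp: klast_def kset_def)
  then show ?thesis
    by (rule finite_subset) (rule finite_lists_length_eq [OF finite_atMost])
qed

lemma klast_Suc: "klast (Suc N) K = (\<lambda>k. k @ [K]) ` (\<Union>J<K. klast N J)"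
proof (intro equalityI subsetI)
  fix k assume k: "k \<in> klast (Suc N) K"
  then have "k \<noteq> []"
    by (auto simp: klast_def kset_def)
  then obtain k' where k': "k = k' @ [K]"
    using k by (cases k rule: rev_cases) (auto simp: klast_def last0_def)
  then show "k \<in> (\<lambda>k. k @ [K]) ` (\<Union>J<K. klast N J)"
    using k by (auto simp: klast_def kset_snoc)
qed (auto simp: klast_def kset_snoc last0_def)

definition polylog_term :: "nat list \<Rightarrow> 'n list \<Rightarrow> complex ^ 'n::{finite,linorder} \<Rightarrow> nat list \<Rightarrow> complex" where
  "polylog_term a \<kappa> x k = (\<Prod>i<length a. ykap \<kappa> i x ^ (k ! i) / of_nat (k ! i) ^ (a ! i))"

text \<open>Appending q divides the formerly last factor z by z_q, to the power of the former last
  index, and adds a factor z_q^K; together they give the exponent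
  \<open>K - last0 k\<close>.\<close>

lemma polylog_term_snoc:
  assumes len: "length a = length \<kappa>" "length k = length \<kappa>" and sorted: "sorted (\<kappa> @ [q])" and K: "last0 k \<le> K"
  shows "polylog_term (a @ [b]) (\<kappa> @ [q]) x (k @ [K]) = polylog_term a \<kappa> x k * zcoord q x ^ (K - last0 k) / of_nat K ^ b"
proof -
  let ?N = "length \<kappa>"
  have "polylog_term (a @ [b]) (\<kappa> @ [q]) x (k @ [K])
      = (\<Prod>i<?N. ykap (\<kappa> @ [q]) i x ^ (k ! i) / of_nat (k ! i) ^ (a ! i)) * (zcoord q x ^ K / of_nat K ^ b)"
    using len by (simp add: polylog_term_def nth_append ykap_def)
  moreover have "(\<Prod>i<?N. ykap (\<kappa> @ [q]) i x ^ (k ! i) / of_nat (k ! i) ^ (a ! i)) * zcoord q x ^ K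
      = polylog_term a \<kappa> x k * zcoord q x ^ (K - last0 k)"
  proof (cases ?N)
    case 0
    then show ?thesis
      using len by (simp add: polylog_term_def last0_def)
  next
    case (Suc M)
    have M: "M < ?N" "k \<noteq> []"
      using Suc len by auto
    have l: "last0 k = k ! M"
      using M Suc len by (simp add: last0_def last_conv_nth)
    have init: "ykap (\<kappa> @ [q]) i x = ykap \<kappa> i x" if "i < M" for i
      using that Suc by (simp add: ykap_def nth_append)
    have "\<kappa> ! M \<le> q"
      using sorted M(1) by (simp add: sorted_append)
    then have y: "ykap \<kappa> M x = ykap (\<kappa> @ [q]) M x * zcoord q x"
      using Suc by (simp add: ykap_def nth_append zcoord_split zprod_def)
    have zK: "zcoord q x ^ K = zcoord q x ^ (k ! M) * zcoord q x ^ (K - last0 k)"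
      using K l by (simp flip: power_add)
    have "(\<Prod>i<?N. ykap (\<kappa> @ [q]) i x ^ (k ! i) / of_nat (k ! i) ^ (a ! i))
        = (\<Prod>i<M. ykap \<kappa> i x ^ (k ! i) / of_nat (k ! i) ^ (a ! i)) * (ykap (\<kappa> @ [q]) M x ^ (k ! M) / of_nat (k ! M) ^ (a ! M))"
      by (simp add: Suc init)
    moreover have "polylog_term a \<kappa> x k
        = (\<Prod>i<M. ykap \<kappa> i x ^ (k ! i) / of_nat (k ! i) ^ (a ! i)) * (ykap \<kappa> M x ^ (k ! M) / of_nat (k ! M) ^ (a ! M))"
      by (simp add: polylog_term_def len Suc)
    ultimately show ?thesis
      unfolding zK y by (simp add: power_mult_distrib mult_ac)
  qed
  ultimately show ?thesis
    by simp
qed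

text \<open>Removing the last index turns the sum into the recursion of \<open>hom_part\<close>;
  each of the letters X_i\<beta> contributes one sign, from z / (z - 1) = - (z + z^2 + ...).\<close>

lemma sum_polylog_term:
  assumes "polylog_index a \<kappa>"
  shows "(\<Sum>k\<in>klast (length a) K. polylog_term a \<kappa> x k)
    = (- 1) ^ length a * hom_part (index_word a \<kappa>) K (\<lambda>i. zcoord i x)"
  using assms
proof (induction a arbitrary: \<kappa> K rule: rev_induct)
  case Nil
  have "klast 0 K = (if K = 0 then {[]} else {})"
    by (auto simp: klast_def kset_0 last0_def)
  then show ?case
    using Nil by (simp add: polylog_index_def index_word_def polylog_term_def)
next
  case (snoc b a)
  obtain \<kappa>' q where \<kappa>: "\<kappa> = \<kappa>' @ [q]" "length a = length \<kappa>'"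
    using snoc.prems by (cases \<kappa> rule: rev_cases) (auto simp: polylog_index_def)
  have idx: "polylog_index a \<kappa>'" and b: "b = Suc (b - 1)" and sorted: "sorted (\<kappa>' @ [q])"
    using snoc.prems \<kappa> by (auto simp: polylog_index_def sorted_append)
  let ?h = "\<lambda>J. hom_part (index_word a \<kappa>') J (\<lambda>i. zcoord i x)"
  have "(\<Sum>k\<in>klast (length (a @ [b])) K. polylog_term (a @ [b]) \<kappa> x k)
      = (\<Sum>k\<in>(\<Union>J<K. klast (length a) J). polylog_term (a @ [b]) (\<kappa>' @ [q]) x (k @ [K]))"
    unfolding length_append_singleton klast_Suc \<kappa>(1) by (subst sum.reindex) (auto simp: inj_on_def)
  also have "\<dots> = (\<Sum>J<K. \<Sum>k\<in>klast (length a) J. polylog_term (a @ [b]) (\<kappa>' @ [q]) x (k @ [K]))"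
    by (rule sum.UNION_disjoint) (simp, simp add: finite_klast, auto simp: klast_def)
  also have "\<dots> = (\<Sum>J<K. \<Sum>k\<in>klast (length a) J. polylog_term a \<kappa>' x k * (zcoord q x ^ (K - J) / of_nat K ^ b))"
  proof (intro sum.cong HOL.refl)
    fix J k assume "J \<in> {..<K}" "k \<in> klast (length a) J"
    then have "last0 k = J" "last0 k \<le> K" "length k = length \<kappa>'"
      using \<kappa>(2) by (auto simp: klast_def kset_def)
    then show "polylog_term (a @ [b]) (\<kappa>' @ [q]) x (k @ [K]) = polylog_term a \<kappa>' x k * (zcoord q x ^ (K - J) / of_nat K ^ b)"
      using polylog_term_snoc [OF \<kappa>(2) _ sorted] by simp
  qed
  also have "\<dots> = (\<Sum>J<K. (- 1) ^ length a * ?h J * (zcoord q x ^ (K - J) / of_nat K ^ b))"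
    unfolding sum_distrib_right [symmetric] snoc.IH [OF idx] ..
  also have "\<dots> = (- 1) ^ length a * (\<Sum>J<K. ?h J * zcoord q x ^ (K - J)) / of_nat K ^ b"
    by (simp add: sum_distrib_left sum_divide_distrib mult.assoc)
  also have "\<dots> = (- 1) ^ length (a @ [b]) * hom_part (index_word (a @ [b]) \<kappa>) K (\<lambda>i. zcoord i x)"
  proof -
    have "of_nat K ^ b = of_nat K * (of_nat K :: complex) ^ (b - 1)"
      by (subst b) simp
    then show ?thesis
      by (simp add: \<kappa> index_word_snoc hom_part_replicate)
  qed
  finally show ?case .
qed

lemma norm_polylog_term:
  "of_real (norm (polylog_term a \<kappa> x k)) = polylog_term a \<kappa> (\<chi> i. of_real (norm (x $ i))) k"
proof -
  have "of_real (norm (ykap \<kappa> i x)) = ykap \<kappa> i (\<chi> i. of_real (norm (x $ i)))" for i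
    by (cases "Suc i < length \<kappa>") (simp_all add: ykap_def zcoord_def prod_norm [symmetric])
  then show ?thesis
    by (simp add: polylog_term_def prod_norm [symmetric] norm_divide norm_power)
qed

text \<open>Applied to the absolute values of the coordinates, the identity for finite blocks bounds
  the sum of the norms over a block by r^K. This gives absolute summability, which justifies
  summation by blocks.\<close>

lemma polylog_eq_word_series:
  assumes idx: "polylog_index a \<kappa>" and x: "x \<in> polydisc"
  shows "polylog a \<kappa> x = (- 1) ^ length a * word_series (index_word a \<kappa>) x"
proof -
  let ?T = "polylog_term a \<kappa> x" and ?N = "length a"
  obtain r where r: "0 < r" "r < 1" "\<And>i. norm (x $ i) < r"
    using polydisc_radius [OF x] by metis
  let ?x = "\<chi> i. complex_of_real (norm (x $ i))"
  have bound: "(\<Sum>k\<in>klast ?N K. norm (?T k)) \<le> r ^ K" for K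
  proof -
    have "complex_of_real (\<Sum>k\<in>klast ?N K. norm (?T k)) = (\<Sum>k\<in>klast ?N K. polylog_term a \<kappa> ?x k)"
      by (simp add: norm_polylog_term)
    also have "\<dots> = (- 1) ^ ?N * hom_part (index_word a \<kappa>) K (\<lambda>i. zcoord i ?x)"
      by (rule sum_polylog_term [OF idx])
    finally have "norm (complex_of_real (\<Sum>k\<in>klast ?N K. norm (?T k))) = norm (hom_part (index_word a \<kappa>) K (\<lambda>i. zcoord i ?x))"
      by (simp only: norm_mult norm_power norm_minus_cancel norm_one power_one mult_1)
    also have "\<dots> \<le> r ^ K"
      using r by (intro hom_part_bound norm_zcoord_le) (auto intro: less_imp_le)
    finally show ?thesis
      by (simp only: norm_of_real)
  qed
  have kset: "kset ?N = (\<Union>K. klast ?N K)"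
    by (auto simp: klast_def)
  have "(\<lambda>k. norm (?T k)) summable_on kset ?N"
  proof (rule nonneg_bdd_above_summable_on)
    show "bdd_above (sum (\<lambda>k. norm (?T k)) ` {F. F \<subseteq> kset ?N \<and> finite F})"
    proof (rule bdd_aboveI2)
      fix F assume F: "F \<in> {F. F \<subseteq> kset ?N \<and> finite F}"
      define M where "M = Max (insert 0 (last0 ` F))"
      have "F \<subseteq> (\<Union>K\<le>M. klast ?N K)"
        using F by (auto simp: M_def klast_def intro!: Max_ge)
      then have "(\<Sum>k\<in>F. norm (?T k)) \<le> (\<Sum>k\<in>(\<Union>K\<le>M. klast ?N K). norm (?T k))"
        by (intro sum_mono2) (auto simp: finite_klast)
      also have "\<dots> = (\<Sum>K\<le>M. \<Sum>k\<in>klast ?N K. norm (?T k))"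
        by (rule sum.UNION_disjoint) (simp, simp add: finite_klast, auto simp: klast_def)
      also have "\<dots> \<le> (\<Sum>K\<le>M. r ^ K)"
        by (intro sum_mono bound)
      also have "\<dots> \<le> (\<Sum>K. r ^ K)"
        using r by (intro sum_le_suminf summable_geometric) auto
      finally show "(\<Sum>k\<in>F. norm (?T k)) \<le> (\<Sum>K. r ^ K)" .
    qed
  qed simp
  then have "?T summable_on kset ?N"
    by (rule abs_summable_summable)
  then have "(?T has_sum infsum ?T (kset ?N)) (kset ?N)"
    by (rule has_sum_infsum)
  \<comment> \<open>Decomposition of the index set into the disjoint finite blocks of given last
    index.\<close>
  moreover have "kset ?N = snd ` Sigma UNIV (klast ?N)"
    unfolding kset by force
  ultimately have "(?T has_sum infsum ?T (kset ?N)) (snd ` Sigma UNIV (klast ?N))"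
    by metis
  moreover have "inj_on snd (Sigma UNIV (klast ?N))"
    by (auto simp: inj_on_def klast_def)
  ultimately have "((?T \<circ> snd) has_sum infsum ?T (kset ?N)) (Sigma UNIV (klast ?N))"
    by (simp only: has_sum_reindex)
  then have "((\<lambda>K. \<Sum>k\<in>klast ?N K. ?T k) has_sum infsum ?T (kset ?N)) UNIV"
    by (rule has_sum_Sigma [OF isUCont_plus]) (simp add: finite_klast)
  then have "(\<lambda>K. (- 1) ^ ?N * hom_part (index_word a \<kappa>) K (\<lambda>i. zcoord i x)) sums infsum ?T (kset ?N)"
    unfolding sum_polylog_term [OF idx] by (rule has_sum_imp_sums)
  moreover have "(\<lambda>K. (- 1) ^ ?N * hom_part (index_word a \<kappa>) K (\<lambda>i. zcoord i x)) sums
      ((- 1) ^ ?N * word_series (index_word a \<kappa>) x)"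
    unfolding word_series_def using summable_norm_cancel [OF hom_part_summable [OF x]]
    by (intro sums_mult summable_sums)
  ultimately have "infsum ?T (kset ?N) = (- 1) ^ ?N * word_series (index_word a \<kappa>) x"
    by (rule sums_unique2)
  moreover have "polylog a \<kappa> x = infsum ?T (kset ?N)"
    by (simp add: polylog_def polylog_term_def [abs_def] kset_def)
  ultimately show ?thesis
    by simp
qed

section \<open>Admissible words and polylogarithm indices\<close>

lemma set_pair_word: "Some i \<in> set (pair_word P) \<longleftrightarrow> i \<in> snd ` set P"
  by (induction P rule: pair_word.induct) auto

lemma sorted_wrt_replicate_None:
  "sorted_wrt (\<lambda>p q. \<forall>i j. p = Some i \<longrightarrow> q = Some j \<longrightarrow> j \<le> i) (replicate m None @ w)
    \<longleftrightarrow> sorted_wrt (\<lambda>p q. \<forall>i j. p = Some i \<longrightarrow> q = Some (j :: 'n::linorder) \<longrightarrow> j \<le> i) w"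
  by (induction m) auto

lemma adm_pair_word:
  assumes "sorted_wrt (\<ge>) (map snd P)"
  shows "adm (pair_word P)"
  using assms
proof (induction P rule: pair_word.induct)
  case (2 a i P)
  have "i \<ge> j" if "Some j \<in> set (pair_word P)" for j
    using 2 that by (auto simp: set_pair_word)
  with 2 show ?case
    unfolding pair_word.simps adm_def sorted_wrt_replicate_None by auto
qed (simp add: adm_def)

lemma adm_index_word: "polylog_index a \<kappa> \<Longrightarrow> adm (index_word a \<kappa>)"
  unfolding index_word_def
  by (rule adm_pair_word) (simp add: polylog_index_def rev_map [symmetric] sorted_wrt_rev)

text \<open>Built up from the right end: X_i\<beta> opens a new pair with exponent 1, and
  X_\<beta>\<omega> raises the exponent of the first pair, which exists because the word does not
  end in X_\<beta>\<omega>.\<close>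

lemma index_word_surj:
  assumes "adm w"
  obtains a \<kappa> where "polylog_index a \<kappa>" "w = index_word a \<kappa>"
proof -
  have "\<exists>P. w = pair_word P \<and> sorted_wrt (\<ge>) (map snd P) \<and> (\<forall>a\<in>fst ` set P. 1 \<le> a)"
    using assms
  proof (induction w)
    case (Cons q w)
    have "adm w"
      using Cons.prems by (auto simp: adm_def split: if_splits)
    then obtain P where P: "w = pair_word P" "sorted_wrt (\<ge>) (map snd P)" "\<forall>a\<in>fst ` set P. 1 \<le> a"
      using Cons.IH by blast
    show ?case
    proof (cases q)
      case None
      then have "w \<noteq> []"
        using Cons.prems by (auto simp: adm_def)
      then obtain a i P' where P': "P = (a, i) # P'"
        using P(1) by (cases P) auto
      then have "q # w = pair_word ((Suc a, i) # P')"
        using P None by (cases a) auto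
      then show ?thesis
        using P P' by (intro exI [of _ "(Suc a, i) # P'"]) auto
    next
      case (Some i)
      have "j \<le> i" if "j \<in> snd ` set P" for j
      proof -
        have "Some j \<in> set w"
          using that P(1) by (simp add: set_pair_word)
        then show ?thesis
          using Cons.prems Some by (auto simp: adm_def)
      qed
      then show ?thesis
        using P Some by (intro exI [of _ "(1, i) # P"]) auto
    qed
  qed (auto intro: exI [of _ "[]"])
  then obtain P where P: "w = pair_word P" "sorted_wrt (\<ge>) (map snd P)" "\<forall>a\<in>fst ` set P. 1 \<le> a"
    by blast
  show ?thesis
  proof (rule that)
    show "w = index_word (map fst (rev P)) (map snd (rev P))"
      by (simp add: index_word_def zip_map_fst_snd P(1))
    show "polylog_index (map fst (rev P)) (map snd (rev P))"
      using P by (auto simp: polylog_index_def rev_map [symmetric] sorted_wrt_rev)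
  qed
qed

section \<open>Logarithmic derivatives of polynomials\<close>

text \<open>Taylor expansion at \<open>t\<close>, in the field of Laurent series so that quotients,
  orders and residues are available.\<close>

definition germ :: "complex \<Rightarrow> complex poly \<Rightarrow> complex fls" where
  "germ t p = fps_to_fls (fps_of_poly (pcompose p [:t, 1:]))"

lemma germ_simps:
  "germ t (p + q) = germ t p + germ t q" "germ t (p - q) = germ t p - germ t q"
  "germ t (p * q) = germ t p * germ t q" "germ t 1 = 1" "germ t 0 = 0"
  "germ t (smult c p) = fls_const c * germ t p" "germ t (pderiv p) = fls_deriv (germ t p)"
  by (simp_all add: germ_def one_pCons pcompose_add pcompose_diff pcompose_mult pcompose_smult fps_of_poly_add
      fps_of_poly_diff fps_of_poly_mult fps_of_poly_smult fls_deriv_fps_to_fls pderiv_pcompose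
      fls_times_fps_to_fls pderiv_pCons flip: fps_of_poly_pderiv)

lemma germ_sum: "germ t (\<Sum>e\<in>E. p e) = (\<Sum>e\<in>E. germ t (p e))"
  by (induction E rule: infinite_finite_induct) (simp_all add: germ_simps)

lemma germ_prod: "germ t (\<Prod>e\<in>E. p e) = (\<Prod>e\<in>E. germ t (p e))"
  by (induction E rule: infinite_finite_induct) (simp_all add: germ_simps)

lemma germ_eq_iff: "germ t p = germ t q \<longleftrightarrow> p = q"
proof -
  have "germ t p = 0 \<longleftrightarrow> p = 0" for p
    by (simp add: germ_def pcompose_eq_0_iff)
  from this [of "p - q"] show ?thesis
    by (simp add: germ_simps)
qed

lemma germ_eq_0_iff: "germ t p = 0 \<longleftrightarrow> p = 0"
  using germ_eq_iff [of t p 0] by (simp add: germ_simps)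

definition ord_at :: "complex \<Rightarrow> complex poly \<Rightarrow> int" where
  "ord_at t p = fls_subdegree (germ t p)"

lemma ord_at_mult: "p \<noteq> 0 \<Longrightarrow> q \<noteq> 0 \<Longrightarrow> ord_at t (p * q) = ord_at t p + ord_at t q"
  by (simp add: ord_at_def germ_simps germ_eq_0_iff)

lemma ord_at_prod: "finite A \<Longrightarrow> (\<And>a. a \<in> A \<Longrightarrow> p a \<noteq> 0) \<Longrightarrow> ord_at t (\<Prod>a\<in>A. p a) = (\<Sum>a\<in>A. ord_at t (p a))"
proof (induction A rule: finite_induct)
  case empty
  then show ?case by (simp add: ord_at_def germ_simps)
qed (simp add: ord_at_mult)

lemma ord_at_eq_0_iff: "p \<noteq> 0 \<Longrightarrow> ord_at t p = 0 \<longleftrightarrow> poly p t \<noteq> 0"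
proof -
  assume "p \<noteq> 0"
  then have "fps_of_poly (pcompose p [:t, 1:]) \<noteq> 0"
    by (simp add: pcompose_eq_0_iff)
  moreover have "fps_nth (fps_of_poly (pcompose p [:t, 1:])) 0 = poly p t"
    by (simp add: poly_0_coeff_0 [symmetric] poly_pcompose)
  ultimately show ?thesis
    by (simp add: ord_at_def germ_def fls_subdegree_fls_to_fps subdegree_eq_0_iff)
qed

text \<open>The hypothesis says that the quotient g / f has derivative zero, hence is constant as a
  Laurent series at 0.\<close>

lemma pderiv_proportional:
  assumes "f \<noteq> 0" "f * pderiv g = pderiv f * (g :: complex poly)"
  obtains c where "g = smult c f"
proof -
  let ?f = "germ 0 f" and ?g = "germ 0 g"
  define h where "h = ?g / ?f"
  have f: "?f \<noteq> 0"
    using assms(1) by (simp add: germ_eq_0_iff)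
  then have g: "?g = h * ?f"
    by (simp add: h_def)
  have "germ 0 (f * pderiv g) = germ 0 (pderiv f * g)"
    using assms(2) by simp
  then have "?f * fls_deriv (h * ?f) = fls_deriv ?f * (h * ?f)"
    by (simp only: germ_simps g)
  then have "fls_deriv h * (?f * ?f) = 0"
    by (simp add: algebra_simps)
  then have "fls_deriv h = 0"
    using f by simp
  then obtain c where "h = fls_const c"
    unfolding fls_deriv_eq_0_iff by blast
  then have "germ 0 g = germ 0 (smult c f)"
    using g by (simp add: germ_simps)
  then show ?thesis
    using that by (simp add: germ_eq_iff)
qed

text \<open>The equation is \<open>\<Sum>\<^sub>e c\<^sub>e p\<^sub>e' / p\<^sub>e = (g / f)'\<close> with the denominators cleared.\<close>

lemma logarithmic_residues:
  assumes "finite E" "\<And>e. e \<in> E \<Longrightarrow> p e \<noteq> 0" "f \<noteq> 0"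
    and eq: "f * f * (\<Sum>e\<in>E. smult (c e) (pderiv (p e) * (\<Prod>d\<in>E - {e}. p d)))
      = (pderiv g * f - g * pderiv f) * (\<Prod>e\<in>E. p e)"
  shows "(\<Sum>e\<in>E. c e * of_int (ord_at t (p e))) = 0"
proof -
  let ?f = "germ t f" and ?g = "germ t g" and ?p = "\<lambda>e. germ t (p e)"
  define h where "h = ?g / ?f"
  have f: "?f \<noteq> 0"
    using assms(3) by (simp add: germ_eq_0_iff)
  then have g: "?g = h * ?f"
    by (simp add: h_def)
  have p: "?p e \<noteq> 0" if "e \<in> E" for e
    using assms(2) that by (simp add: germ_eq_0_iff)
  let ?N = "\<Sum>e\<in>E. fls_const (c e) * (fls_deriv (?p e) * (\<Prod>d\<in>E - {e}. ?p d))"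
  have "?f * ?f * ?N = (fls_deriv ?g * ?f - ?g * fls_deriv ?f) * (\<Prod>e\<in>E. ?p e)"
    using arg_cong [OF eq, of "germ t"] by (simp add: germ_simps germ_sum germ_prod)
  also have "\<dots> = ?f * ?f * (fls_deriv h * (\<Prod>e\<in>E. ?p e))"
    unfolding g by (simp add: algebra_simps)
  finally have N: "?N = fls_deriv h * (\<Prod>e\<in>E. ?p e)"
    using f by simp
  have P: "(\<Prod>e\<in>E. ?p e) \<noteq> 0"
    using p assms(1) by simp
  have "?N = (\<Sum>e\<in>E. fls_const (c e) * (fls_deriv (?p e) * inverse (?p e))) * (\<Prod>e\<in>E. ?p e)"
    unfolding sum_distrib_right
  proof (rule sum.cong)
    fix e assume e: "e \<in> E"
    then have "(\<Prod>e\<in>E. ?p e) = ?p e * (\<Prod>d\<in>E - {e}. ?p d)"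
      using assms(1) by (rule prod.remove [rotated])
    then show "fls_const (c e) * (fls_deriv (?p e) * (\<Prod>d\<in>E - {e}. ?p d))
        = fls_const (c e) * (fls_deriv (?p e) * inverse (?p e)) * (\<Prod>e\<in>E. ?p e)"
      using p [OF e] by (simp add: mult_ac)
  qed simp
  with N P have "(\<Sum>e\<in>E. fls_const (c e) * (fls_deriv (?p e) * inverse (?p e))) = fls_deriv h"
    by simp
  \<comment> \<open>A derivative has residue zero, while p' / p has the order of p as its
    residue.\<close>
  then have "fls_residue (\<Sum>e\<in>E. fls_const (c e) * (fls_deriv (?p e) * inverse (?p e))) = 0"
    using fls_residue_deriv [of h] by simp
  also have "fls_residue (\<Sum>e\<in>E. fls_const (c e) * (fls_deriv (?p e) * inverse (?p e)))
      = (\<Sum>e\<in>E. fls_residue (fls_const (c e) * (fls_deriv (?p e) * inverse (?p e))))"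
    by (induction E rule: infinite_finite_induct) simp_all
  also have "\<dots> = (\<Sum>e\<in>E. c e * of_int (ord_at t (p e)))"
    by (simp only: fls_residue_fls_const_times fls_residue_deriv_times_inverse_eq_subdegree ord_at_def)
  finally show ?thesis .
qed

lemma interpolation_poly:
  assumes "finite T"
  shows "\<exists>p :: 'a::field poly. \<forall>t\<in>T. poly p t = v t"
  using assms
proof (induction T rule: finite_induct)
  case (insert s T)
  then obtain p where p: "\<forall>t\<in>T. poly p t = v t"
    by blast
  let ?q = "\<Prod>t\<in>T. [:- t, 1:]"
  have "poly ?q s \<noteq> 0"
    using insert by (auto simp: poly_prod)
  moreover have "poly ?q t = 0" if "t \<in> T" for t
    using that insert(1) by (auto simp: poly_prod intro: prod_zero)
  ultimately have "\<forall>t\<in>insert s T. poly (p + smult ((v s - poly p s) / poly ?q s) ?q) t = v t"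
    using p by simp
  then show ?case
    by blast
qed simp

section \<open>A curve separating the logarithmic forms\<close>

text \<open>Common index of the logarithmic forms and of the degree-one basis: dlog z_i with
  X_\<alpha>i, dlog (z_i - 1) with X_i\<beta>, dlog (z_i - z_j) with X_ij.\<close>

datatype 'n edge = EA 'n | EB 'n | EP 'n 'n

definition edges :: "'n::linorder edge set" where
  "edges = range EA \<union> range EB \<union> (\<lambda>(i, j). EP i j) ` {(i, j). i < j}"

lemma finite_edges: "finite (edges :: 'n::{finite,linorder} edge set)"
  by (simp add: edges_def)

lemma edges_cases:
  assumes "e \<in> edges"
  obtains i where "e = EA i" | i where "e = EB i" | i j where "e = EP i j" "i < j"
  using assms by (auto simp: edges_def)

lemma edges_mem [simp]: "EA i \<in> edges" "EB i \<in> edges" "EP i j \<in> edges \<longleftrightarrow> i < j"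
  by (auto simp: edges_def)

lemma sum_edges:
  "(\<Sum>e\<in>edges. f e) = (\<Sum>i\<in>UNIV. f (EA i) + f (EB i)) + (\<Sum>(i, j)\<in>{(i, j). i < j}. f (EP i (j :: 'n::{finite,linorder})))"
proof -
  have "(\<Sum>e\<in>edges. f e) = (\<Sum>e\<in>range EA \<union> range EB. f e) + (\<Sum>e\<in>(\<lambda>(i, j). EP i j) ` {(i, j). i < j}. f e)"
    unfolding edges_def by (rule sum.union_disjoint) auto
  also have "(\<Sum>e\<in>range EA \<union> range EB. f e) = (\<Sum>e\<in>range EA. f e) + (\<Sum>e\<in>range EB. f e)"
    by (rule sum.union_disjoint) auto
  also have "(\<Sum>e\<in>(\<lambda>(i, j). EP i j) ` {(i, j). i < j}. f e) = (\<Sum>(i, j)\<in>{(i, j). i < j}. f (EP i j))"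
    by (subst sum.reindex) (auto simp: inj_on_def case_prod_unfold)
  finally show ?thesis
    by (simp add: sum.reindex inj_def sum.distrib)
qed

fun edge_poly :: "('n \<Rightarrow> complex poly) \<Rightarrow> 'n::{finite,linorder} edge \<Rightarrow> complex poly" where
  "edge_poly X (EA i) = (\<Prod>l\<in>{i..}. X l)"
| "edge_poly X (EB i) = (\<Prod>l\<in>{i..}. X l) - 1"
| "edge_poly X (EP i j) = (\<Prod>l\<in>{i..}. X l) - (\<Prod>l\<in>{j..}. X l)"

text \<open>At the point belonging to \<open>EB i\<close> or \<open>EP i j\<close> the product of the coordinates over the interval
  starting in \<open>i\<close> is 1, and no product over another set is; at that of \<open>EA i\<close> only the \<open>i\<close>-th
  coordinate vanishes.\<close>

fun edge_set :: "'n::{finite,linorder} edge \<Rightarrow> 'n set" where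
  "edge_set (EA i) = {}"
| "edge_set (EB i) = {i..}"
| "edge_set (EP i j) = {i..<j}"

text \<open>Exponents of the prescribed values. For i in I the total over I is 0; a nonempty proper
  subset of I has negative sum if it contains i and positive sum otherwise; and one element outside
  I outweighs everything negative.\<close>

definition weight :: "'n::finite set \<Rightarrow> 'n \<Rightarrow> 'n \<Rightarrow> int" where
  "weight I i k = (if k \<in> I then 1 - of_bool (k = i) * int (card I) else int CARD('n))"

lemma sum_weight_eq_0_iff:
  fixes I K :: "'n::finite set"
  assumes "i \<in> I" "K \<noteq> {}"
  shows "(\<Sum>k\<in>K. weight I i k) = 0 \<longleftrightarrow> K = I"
proof -
  have sub: "(\<Sum>k\<in>L. weight I i k) = int (card L) - of_bool (i \<in> L) * int (card I)" if "L \<subseteq> I" for L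
  proof -
    have "(\<Sum>k\<in>L. weight I i k) = (\<Sum>k\<in>L. 1 - of_bool (k = i) * int (card I))"
      using that by (intro sum.cong) (auto simp: weight_def)
    also have "\<dots> = int (card L) - (\<Sum>k\<in>L. of_bool (k = i)) * int (card I)"
      by (simp add: sum_subtractf sum_distrib_right)
    also have "(\<Sum>k\<in>L. of_bool (k = i)) = (of_bool (i \<in> L) :: int)"
      by (simp add: of_bool_def)
    finally show ?thesis .
  qed
  show ?thesis
  proof (cases "K \<subseteq> I")
    case True
    then have "card K \<le> card I" "card K = card I \<longrightarrow> K = I" "card K > 0"
      using card_mono [of I K] card_subset_eq [of I K] assms(2) by (auto simp: card_gt_0_iff)
    then show ?thesis
      using assms(1) by (auto simp: sub [OF True] of_bool_def)
  next
    case False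
    have "(\<Sum>k\<in>K. weight I i k) = (\<Sum>k\<in>K \<inter> I. weight I i k) + (\<Sum>k\<in>K - I. weight I i k)"
      by (rule sum.Int_Diff) simp
    also have "(\<Sum>k\<in>K - I. weight I i k) = int (card (K - I)) * int CARD('n)"
      by (simp add: weight_def)
    also have "(\<Sum>k\<in>K \<inter> I. weight I i k) = int (card (K \<inter> I)) - of_bool (i \<in> K \<inter> I) * int (card I)"
      by (rule sub) auto
    finally have eq: "(\<Sum>k\<in>K. weight I i k) = int (card (K \<inter> I)) - of_bool (i \<in> K \<inter> I) * int (card I)
      + int (card (K - I)) * int CARD('n)" .
    have "1 \<le> card (K - I)"
      using False by (simp add: Suc_le_eq card_gt_0_iff)
    define a where "a = int (card (K - I)) * int CARD('n)"
    have "1 * int CARD('n) \<le> a"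
      unfolding a_def using \<open>1 \<le> card (K - I)\<close> by (intro mult_right_mono) auto
    moreover have "int (card I) \<le> int CARD('n)"
      by (auto intro: card_mono)
    moreover have "0 < a"
      using \<open>1 * int CARD('n) \<le> a\<close> zero_less_card_finite [where 'a = 'n] by linarith
    moreover have "i \<in> K \<inter> I \<Longrightarrow> 0 < card (K \<inter> I)"
      by (auto simp: card_gt_0_iff)
    ultimately have "(\<Sum>k\<in>K. weight I i k) > 0"
      unfolding eq a_def [symmetric] by (cases "i \<in> K \<inter> I") auto
    then show ?thesis
      using False by auto
  qed
qed

text \<open>Finitely many values are prescribed and interpolated. The value 1/2 at the parameter 0
  makes the curve meet the punctured polydisc; exponentials of the weights single out one interval
  as the only nonempty set of coordinates with product 1.\<close>

lemma separating_curve: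
  obtains X :: "'n::{finite,linorder} \<Rightarrow> complex poly" and \<tau>
  where "\<And>k. poly (X k) 0 = 1 / 2"
    and "\<And>e K. e \<in> edges \<Longrightarrow> edge_set e \<noteq> {} \<Longrightarrow> K \<noteq> {} \<Longrightarrow> (\<Prod>k\<in>K. poly (X k) (\<tau> e)) = 1 \<longleftrightarrow> K = edge_set e"
    and "\<And>e k. e \<in> edges \<Longrightarrow> poly (X k) (\<tau> e) = 0 \<longleftrightarrow> e = EA k"
proof -
  obtain f :: "'n edge \<Rightarrow> nat" where f: "inj_on f edges"
    using finite_imp_inj_to_nat_seg [OF finite_edges] by metis
  \<comment> \<open>\<open>Suc\<close> avoids the parameter 0, where 1/2 is prescribed.\<close>
  define \<tau> where "\<tau> e = complex_of_nat (Suc (f e))" for e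
  have \<tau>: "inj_on \<tau> edges" "\<tau> e \<noteq> 0" for e
    using f by (auto simp: inj_on_def \<tau>_def simp del: of_nat_Suc)
  define V :: "'n edge \<Rightarrow> 'n \<Rightarrow> complex" where "V e k = (case e of EA i \<Rightarrow> if k = i then 0 else 1
      | EB i \<Rightarrow> exp (of_int (weight {i..} i k)) | EP i j \<Rightarrow> exp (of_int (weight {i..<j} i k)))" for e :: "'n edge" and k
  define W :: "'n \<Rightarrow> complex \<Rightarrow> complex" where "W k t = (if t = 0 then 1 / 2 else V (the_inv_into edges \<tau> t) k)" for k t
  have "\<forall>k. \<exists>p. \<forall>t\<in>insert 0 (\<tau> ` edges). poly p t = W k t"
    using finite_edges by (intro allI interpolation_poly) auto
  then obtain X where X: "\<And>k t. t \<in> insert 0 (\<tau> ` edges) \<Longrightarrow> poly (X k) t = W k t"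
    by metis
  have XV: "poly (X k) (\<tau> e) = V e k" if "e \<in> edges" for e k
    using that \<tau> by (simp add: X W_def the_inv_into_f_f)
  show ?thesis
  proof (rule that)
    show "poly (X k) 0 = 1 / 2" for k
      by (simp add: X W_def)
    show "(\<Prod>k\<in>K. poly (X k) (\<tau> e)) = 1 \<longleftrightarrow> K = edge_set e"
      if e: "e \<in> edges" and ne: "edge_set e \<noteq> {}" and K: "K \<noteq> {}" for e K
    proof -
      obtain i where i: "i \<in> edge_set e" "\<And>k. V e k = exp (of_int (weight (edge_set e) i k))"
        using e ne by (cases e) (auto simp: V_def)
      have "(\<Prod>k\<in>K. poly (X k) (\<tau> e)) = exp (of_real (of_int (\<Sum>k\<in>K. weight (edge_set e) i k)))"
        by (simp add: XV e i(2) exp_sum)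
      \<comment> \<open>The exponents are real, so the period of the exponential adds no
        solutions.\<close>
      moreover have "exp (complex_of_real r) = 1 \<longleftrightarrow> r = 0" for r
        by (metis exp_eq_one_iff exp_of_real of_real_eq_1_iff)
      ultimately show ?thesis
        using sum_weight_eq_0_iff [OF i(1) K] by (simp only: of_int_eq_0_iff)
    qed
    show "poly (X k) (\<tau> e) = 0 \<longleftrightarrow> e = EA k" if "e \<in> edges" for e k
      using that by (cases e) (auto simp: XV V_def)
  qed
qed

text \<open>\<open>ord_at t\<close> is the residue at \<open>t\<close> of the form pulled back to
  the curve, so the second condition is linear independence of the forms through their residues. The
  first one places the parameter 0 in \<open>curve_dom\<close>.\<close>

definition separating :: "('n::{finite,linorder} \<Rightarrow> complex poly) \<Rightarrow> bool" where
  "separating X \<longleftrightarrow> (\<forall>k. poly (X k) 0 = 1 / 2) \<and>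
    (\<forall>c. (\<forall>t. (\<Sum>e\<in>edges. c e * of_int (ord_at t (edge_poly X e))) = (0 :: complex)) \<longrightarrow> (\<forall>e\<in>edges. c e = 0))"

lemma interval_neq:
  fixes i j k :: "'n::linorder"
  assumes "i < j"
  shows "{i..<j} \<noteq> {k..}" "{k..} \<noteq> {i..<j}"
proof -
  show "{k..} \<noteq> {i..<j}"
  proof
    assume eq: "{k..} = {i..<j}"
    then have "k \<in> {i..<j}"
      by auto
    then have "j \<in> {k..}"
      by auto
    then show False
      unfolding eq by simp
  qed
  then show "{i..<j} \<noteq> {k..}"
    by simp
qed

lemma edge_poly_EP:
  assumes "i < j"
  shows "edge_poly X (EP i j) = (\<Prod>l\<in>{j..}. X l) * ((\<Prod>l\<in>{i..<j}. X l) - 1)"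
proof -
  have "{i..<j} \<union> {j..} = {i..}"
    using assms by auto
  moreover have "(\<Prod>l\<in>{i..<j} \<union> {j..}. X l) = (\<Prod>l\<in>{i..<j}. X l) * (\<Prod>l\<in>{j..}. X l)"
    by (intro prod.union_disjoint) auto
  ultimately show ?thesis
    by (simp add: algebra_simps)
qed

text \<open>Evaluate at 0, where a product of coordinates is a power of 1/2 and a nonempty one has
  norm less than 1.\<close>

lemma edge_poly_nonzero:
  assumes "\<And>k. poly (X k) 0 = 1 / 2" "e \<in> edges"
  shows "edge_poly X e \<noteq> 0"
proof -
  have P: "poly (\<Prod>l\<in>A. X l) 0 = (1 / 2) ^ card A" for A
    by (simp add: poly_prod assms(1))
  have lt: "poly ((\<Prod>l\<in>A. X l) - 1) 0 \<noteq> 0" if "A \<noteq> {}" for A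
  proof -
    have "1 < (2 :: real) ^ card A"
      using that by (intro one_less_power) (auto simp: card_gt_0_iff)
    moreover have "norm ((1 / 2 :: complex) ^ card A) = 1 / 2 ^ card A"
      by (simp add: norm_power norm_divide power_divide)
    ultimately have "norm ((1 / 2 :: complex) ^ card A) \<noteq> 1"
      by (metis divide_eq_1_iff less_irrefl)
    then show ?thesis
      unfolding poly_diff P by auto
  qed
  have nz: "(\<Prod>l\<in>A. X l) \<noteq> 0" for A
    using P [of A] by (metis divide_eq_0_iff poly_0 power_not_zero zero_neq_numeral zero_neq_one)
  from assms(2) show ?thesis
  proof (cases rule: edges_cases)
    case (1 i)
    then show ?thesis using nz by simp
  next
    case (2 i)
    then show ?thesis using lt [of "{i..}"] by (metis atLeast_iff edge_poly.simps(2) empty_iff order_refl poly_0)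
  next
    case (3 i j)
    then have "(\<Prod>l\<in>{i..<j}. X l) - 1 \<noteq> 0"
      using lt [of "{i..<j}"] by (metis atLeastLessThan_empty_iff poly_0)
    then show ?thesis
      using 3 nz unfolding 3(1) edge_poly_EP [OF 3(2)] by simp
  qed
qed

text \<open>At the point of \<open>EB i\<close> or \<open>EP i j\<close> only its own polynomial
  vanishes, which kills its coefficient. At the point of \<open>EA l\<close> exactly the z_i with i
  \<le> l vanish, so the remaining system is triangular.\<close>

lemma separating_exists: "\<exists>X :: 'n::{finite,linorder} \<Rightarrow> complex poly. separating X"
proof -
  obtain X :: "'n \<Rightarrow> complex poly" and \<tau>
    where half: "\<And>k. poly (X k) 0 = 1 / 2"
      and one: "\<And>e K. e \<in> edges \<Longrightarrow> edge_set e \<noteq> {} \<Longrightarrow> K \<noteq> {} \<Longrightarrow> (\<Prod>k\<in>K. poly (X k) (\<tau> e)) = 1 \<longleftrightarrow> K = edge_set e"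
      and zero: "\<And>e k. e \<in> edges \<Longrightarrow> poly (X k) (\<tau> e) = 0 \<longleftrightarrow> e = EA k"
    using separating_curve by blast
  note nz = edge_poly_nonzero [where X = X, OF half]
  have ord0: "e \<in> edges \<Longrightarrow> ord_at t (edge_poly X e) = 0 \<longleftrightarrow> poly (edge_poly X e) t \<noteq> 0" for e t
    by (rule ord_at_eq_0_iff [OF nz])
  have "c e = 0" if c: "\<And>t. (\<Sum>e\<in>edges. c e * of_int (ord_at t (edge_poly X e))) = (0 :: complex)" and e: "e \<in> edges" for c e
  proof -
    have I: "c e = 0" if e: "e \<in> edges" "edge_set e \<noteq> {}" for e
    proof -
      let ?t = "\<tau> e"
      have X0: "poly (X k) ?t \<noteq> 0" for k
        using zero [OF e(1), of k] e(2) by auto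
      have pe: "poly (edge_poly X d) ?t = 0 \<longleftrightarrow> d = e" if d: "d \<in> edges" for d
        using d
      proof (cases rule: edges_cases)
        case (1 i)
        then show ?thesis using X0 e(2) by (auto simp: poly_prod)
      next
        case (2 i)
        have "poly (edge_poly X d) ?t = 0 \<longleftrightarrow> {i..} = edge_set e"
          using one [OF e, of "{i..}"] 2 by (auto simp: poly_prod)
        also have "\<dots> \<longleftrightarrow> d = e"
          using e(1) by (cases rule: edges_cases) (use 2 in \<open>auto simp: atLeast_eq_iff interval_neq\<close>)
        finally show ?thesis .
      next
        case (3 i j)
        have "poly (edge_poly X d) ?t = 0 \<longleftrightarrow> {i..<j} = edge_set e"
          using one [OF e, of "{i..<j}"] 3 X0 unfolding 3(1) edge_poly_EP [OF 3(2)] by (auto simp: poly_prod)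
        also have "\<dots> \<longleftrightarrow> d = e"
          using e(1) by (cases rule: edges_cases) (use 3 in \<open>auto simp: atLeastLessThan_eq_iff interval_neq\<close>)
        finally show ?thesis .
      qed
      have "(\<Sum>d\<in>edges. c d * of_int (ord_at ?t (edge_poly X d))) = (\<Sum>d\<in>{e}. c d * of_int (ord_at ?t (edge_poly X d)))"
        using e(1) ord0 pe finite_edges by (intro sum.mono_neutral_right) auto
      then have "c e * of_int (ord_at ?t (edge_poly X e)) = 0"
        using c [of ?t] by simp
      moreover have "ord_at ?t (edge_poly X e) \<noteq> 0"
        using ord0 [OF e(1)] pe [OF e(1)] by simp
      ultimately show ?thesis
        by simp
    qed
    have EB: "c (EB i) = 0" for i
      by (rule I) auto
    have EP: "c (EP i j) = 0" if "i < j" for i j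
      by (rule I) (use that in auto)
    have EA: "c (EA l) = 0" for l
    proof (induction l rule: measure_induct_rule [of "\<lambda>l. card {..<l}"])
      case (less l)
      have IH: "c (EA i) = 0" if "i < l" for i
        by (rule less.IH, rule psubset_card_mono) (use that in auto)
      let ?t = "\<tau> (EA l)"
      have Xnz: "X k \<noteq> 0" for k
        using half [of k] by auto
      have oX: "ord_at ?t (X k) = 0 \<longleftrightarrow> k \<noteq> l" for k
        using ord_at_eq_0_iff [OF Xnz] zero [of "EA l" k] by auto
      have oA: "ord_at ?t (edge_poly X (EA i)) = (if i \<le> l then ord_at ?t (X l) else 0)" for i
      proof -
        have "ord_at ?t (edge_poly X (EA i)) = (\<Sum>k\<in>{i..}. ord_at ?t (X k))"
          using Xnz by (simp add: ord_at_prod)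
        also have "\<dots> = (\<Sum>k\<in>{i..} \<inter> {l}. ord_at ?t (X k))"
          using oX by (intro sum.mono_neutral_right) auto
        finally show ?thesis
          by (auto simp: Int_insert_right)
      qed
      have "(\<Sum>e\<in>edges. c e * of_int (ord_at ?t (edge_poly X e))) = (\<Sum>i\<in>UNIV. c (EA i) * of_int (ord_at ?t (edge_poly X (EA i))))"
        by (simp add: sum_edges EB EP case_prod_unfold del: edge_poly.simps)
      also have "\<dots> = (\<Sum>i\<in>{l}. c (EA i) * of_int (ord_at ?t (edge_poly X (EA i))))"
        using IH by (intro sum.mono_neutral_right) (auto simp: oA simp del: edge_poly.simps)
      finally have "c (EA l) * of_int (ord_at ?t (X l)) = 0"
        using c [of ?t] by (simp add: oA del: edge_poly.simps)
      then show ?case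
        using oX [of l] by simp
    qed
    show ?thesis
      using e EA EB EP by (cases rule: edges_cases) auto
  qed
  then have "separating X"
    using half by (auto simp: separating_def)
  then show ?thesis
    by blast
qed

section \<open>Injectivity of the iterated integral map\<close>

fun edge_gen :: "'n::finite edge \<Rightarrow> 'n p_full uea" where
  "edge_gen (EA i) = XU al (pt i)"
| "edge_gen (EB i) = XU (pt i) be"
| "edge_gen (EP i j) = XU (pt i) (pt j)"

fun edge_fun :: "'n edge \<Rightarrow> complex ^ 'n::{finite,linorder} \<Rightarrow> complex" where
  "edge_fun (EA i) = zcoord i"
| "edge_fun (EB i) = (\<lambda>x. zcoord i x - 1)"
| "edge_fun (EP i j) = (\<lambda>x. zcoord i x - zcoord j x)"

definition edge_word :: "'n::finite edge list \<Rightarrow> 'n p_full uea" where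
  "edge_word w = prod_list (map edge_gen w)"

lemma edge_word_simps [simp]: "edge_word [] = 1" "edge_word (e # w) = edge_gen e * edge_word w"
  by (simp_all add: edge_word_def)

text \<open>The degree-one elements indexed by edges span all generators, so words in them are
  enough to test functionals.\<close>

lemma edge_gen_span: "XU a b \<in> cvec.span (edge_gen ` (edges :: 'n::{finite,linorder} edge set))"
proof -
  let ?S = "cvec.span (edge_gen ` (edges :: 'n edge set))"
  have base: "edge_gen e \<in> ?S" if "e \<in> edges" for e
    using that by (intro cvec.span_base) auto
  have pb: "XU be (pt i) \<in> ?S" for i
    using base [of "EB i"] by (simp add: Xgen_sym [of be])
  have ap: "XU al (pt i) \<in> ?S" for i
    using base [of "EA i"] by simp
  have pp: "XU (pt i) (pt j) \<in> ?S" for i j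
    using base [of "EP i j"] base [of "EP j i"]
    by (cases i j rule: linorder_cases) (auto simp: Xgen_diag emb_lin cvec.span_zero Xgen_sym [of "pt i" "pt j"])
  have bo: "XU be om \<in> ?S"
    unfolding Xgen_beta_omega emb_add emb_sum case_prod_unfold
    by (intro cvec.span_add cvec.span_sum ap pp)
  have ba: "XU be al \<in> ?S"
  proof -
    have "XU be al = - (XU be om + (\<Sum>i\<in>UNIV. XU be (pt (i::'n))))"
      by (simp add: marks_sum_zero)
    also have "\<dots> \<in> ?S"
      by (intro cvec.span_neg cvec.span_add cvec.span_sum bo pb)
    finally show ?thesis .
  qed
  have AA: "XU (Some c) (Some d) \<in> ?S" if "c \<noteq> Omega" "d \<noteq> Omega" for c d
    using that ap pp by (cases c; cases d) (auto simp: Xgen_diag emb_lin cvec.span_zero Xgen_sym [of "pt _" al])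
  have bM: "XU be (Some c) \<in> ?S" for c
    using bo ba pb by (cases c) auto
  have AO: "XU (Some c) om \<in> ?S" for c
  proof (cases "c = Omega")
    case False
    then show ?thesis
      unfolding Xgen_Omega [OF False] emb_lin emb_sum
      by (intro cvec.span_diff cvec.span_neg cvec.span_sum bM AA) auto
  qed (simp add: Xgen_diag emb_lin cvec.span_zero)
  have MM: "XU (Some c) (Some d) \<in> ?S" for c d
    using AA [of c d] AO [of c] AO [of d] by (metis Xgen_sym)
  show ?thesis
    using bM MM by (cases a; cases b) (auto simp: Xgen_diag emb_lin cvec.span_zero Xgen_sym [of "Some _" be])
qed

lemma edge_word_span: "u \<in> cvec.span (edge_word ` lists (edges :: 'n::{finite,linorder} edge set))"
proof -
  let ?S = "cvec.span (edge_word ` lists (edges :: 'n edge set))"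
  have "\<forall>x\<in>?S. u * x \<in> ?S" for u
  proof (induction u rule: uea_induct)
    case (gen a b)
    have w: "XU a b * edge_word w \<in> ?S" if "w \<in> lists edges" for w :: "'n edge list"
      using edge_gen_span [of a b]
    proof (induction rule: cvec.span_induct_alt)
      case (step c x y)
      then obtain e where e: "e \<in> edges" "x = edge_gen e"
        by blast
      have "x * edge_word w = edge_word (e # w)"
        using e by simp
      also have "\<dots> \<in> ?S"
        using e that by (intro cvec.span_base imageI) auto
      finally show ?case
        using step.IH by (simp add: distrib_right scaleC_mult_left cvec.span_add cvec.span_scale)
    qed (simp add: cvec.span_zero)
    have *: "XU a b * x \<in> ?S" if "x \<in> ?S" for x
      using that
    proof (induction rule: cvec.span_induct_alt)
      case (step c x y)
      then show ?case
        by (auto simp: distrib_left scaleC_mult_right intro!: cvec.span_add cvec.span_scale w)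
    qed (simp add: cvec.span_zero)
    then show ?case by blast
  next
    case (mult u v)
    then show ?case by (simp add: mult.assoc)
  qed (auto simp: distrib_right scaleC_mult_left cvec.span_add cvec.span_scale cvec.span_zero)
  moreover have "1 \<in> ?S"
    by (rule cvec.span_base) (metis edge_word_simps(1) image_eqI lists.Nil)
  ultimately show ?thesis
    by (metis mult.right_neutral)
qed

section \<open>Restriction to a polynomial curve\<close>

definition curve :: "('n \<Rightarrow> complex poly) \<Rightarrow> complex \<Rightarrow> complex ^ 'n" where
  "curve X t = (\<chi> k. poly (X k) t)"

definition curve_dom :: "('n::finite \<Rightarrow> complex poly) \<Rightarrow> complex set" where
  "curve_dom X = {t. curve X t \<in> punctured}"

lemma curve_dom_iff: "t \<in> curve_dom X \<longleftrightarrow> (\<forall>k. norm (poly (X k) t) < 1 \<and> poly (X k) t \<noteq> 0)"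
  by (simp add: curve_dom_def punctured_iff curve_def)

lemma open_curve_dom: "open (curve_dom X)"
proof -
  have "curve_dom X = (\<Inter>k. {t. norm (poly (X k) t) < 1} \<inter> {t. poly (X k) t \<noteq> 0})"
    by (auto simp: curve_dom_iff)
  moreover have "open (\<Inter>k. {t. norm (poly (X k) t) < 1} \<inter> {t. poly (X k) t \<noteq> 0})"
    by (intro open_INT open_Int ballI open_Collect_less open_Collect_neq continuous_intros) auto
  ultimately show ?thesis
    by simp
qed

lemma zcoord_curve: "zcoord i (curve X t) = poly (\<Prod>l\<in>{i..}. X l) t"
  by (simp add: zcoord_def curve_def poly_prod)

lemma edge_fun_curve: "edge_fun e (curve X t) = poly (edge_poly X e) t"
  by (cases e) (simp_all add: zcoord_curve)

lemma edge_fun_nonzero: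
  assumes "e \<in> edges" "x \<in> punctured"
  shows "edge_fun e x \<noteq> 0"
  using assms(1)
proof (cases rule: edges_cases)
  case (3 i j)
  then show ?thesis
    using zcoord_diff [of i j x] zcoord_neq_0 [OF assms(2)] zprod_neq_1 [OF punctured_polydisc [OF assms(2)]] by simp
qed (use zcoord_neq_0 [OF assms(2)] zcoord_neq_1 [OF punctured_polydisc [OF assms(2)]] in auto)

text \<open>The pullback of dlog of an edge function is the logarithmic derivative of the edge
  polynomial; the Euler coefficients are matched with the logarithmic derivatives of the
  coordinates.\<close>

lemma curve_dlog:
  assumes t: "t \<in> curve_dom X"
  shows "(\<Sum>k\<in>UNIV. poly (pderiv (X k)) t * dlog_coeff k (edge_fun e) (curve X t))
    = poly (pderiv (edge_poly X e)) t / poly (edge_poly X e) t"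
proof -
  let ?x = "curve X t"
  have x: "?x \<in> punctured"
    using t by (simp add: curve_dom_def)
  have k0: "poly (X k) t \<noteq> 0" for k
    using t by (simp add: curve_dom_iff)
  define L where "L i = (\<Sum>k\<in>UNIV. of_bool (i \<le> k) * poly (pderiv (X k)) t / poly (X k) t)" for i
  have Z: "poly (pderiv (\<Prod>l\<in>{i..}. X l)) t = zcoord i ?x * L i" for i
  proof -
    have "poly (pderiv (\<Prod>l\<in>{i..}. X l)) t = (\<Sum>k\<in>{i..}. (\<Prod>l\<in>{i..} - {k}. poly (X l) t) * poly (pderiv (X k)) t)"
      by (simp add: pderiv_prod poly_sum poly_prod)
    also have "\<dots> = (\<Sum>k\<in>{i..}. zcoord i ?x * (of_bool (i \<le> k) * poly (pderiv (X k)) t / poly (X k) t))"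
    proof (rule sum.cong)
      fix k assume k: "k \<in> {i..}"
      then have "zcoord i ?x = poly (X k) t * (\<Prod>l\<in>{i..} - {k}. poly (X l) t)"
        by (simp add: zcoord_curve poly_prod prod.remove)
      then show "(\<Prod>l\<in>{i..} - {k}. poly (X l) t) * poly (pderiv (X k)) t
          = zcoord i ?x * (of_bool (i \<le> k) * poly (pderiv (X k)) t / poly (X k) t)"
        using k k0 [of k] by simp
    qed simp
    also have "\<dots> = zcoord i ?x * L i"
      unfolding L_def sum_distrib_left by (intro sum.mono_neutral_left) auto
    finally show ?thesis .
  qed
  have mult: "a * d = (a / poly (X k) t) * (?x $ k * d)" for a d k
    using k0 [of k] by (simp add: curve_def)
  have eq: "(\<Sum>k\<in>UNIV. poly (pderiv (X k)) t * dlog_coeff k (edge_fun e) ?x)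
      = (\<Sum>k\<in>UNIV. poly (pderiv (X k)) t / poly (X k) t * (?x $ k * dlog_coeff k (edge_fun e) ?x))"
    by (intro sum.cong HOL.refl mult)
  show ?thesis
  proof (cases e)
    case (EA i)
    have "(\<Sum>k\<in>UNIV. poly (pderiv (X k)) t * dlog_coeff k (edge_fun e) ?x) = L i"
      unfolding eq unfolding EA edge_fun.simps dlog_forms(1) [OF x] L_def by (intro sum.cong) auto
    then show ?thesis
      using zcoord_neq_0 [OF x, of i] by (simp add: EA Z zcoord_curve [symmetric])
  next
    case (EB i)
    have "(\<Sum>k\<in>UNIV. poly (pderiv (X k)) t * dlog_coeff k (edge_fun e) ?x) = L i * (zcoord i ?x / (zcoord i ?x - 1))"
      unfolding eq unfolding EB edge_fun.simps dlog_forms(2) [OF x] L_def sum_distrib_right by (intro sum.cong) auto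
    then show ?thesis
      by (simp add: EB Z zcoord_curve [symmetric] pderiv_diff)
  next
    case (EP i j)
    have "(\<Sum>k\<in>UNIV. poly (pderiv (X k)) t * dlog_coeff k (edge_fun e) ?x)
        = (zcoord i ?x * L i - zcoord j ?x * L j) / (zcoord i ?x - zcoord j ?x)"
      unfolding eq unfolding EP edge_fun.simps dlog_forms(3) [OF x] L_def sum_distrib_left sum_subtractf [symmetric] sum_divide_distrib
      by (intro sum.cong) (auto simp: algebra_simps)
    then show ?thesis
      by (simp add: EP Z zcoord_curve [symmetric] pderiv_diff)
  qed
qed

lemma graded_dual_edge:
  "\<phi> \<in> graded_dual \<Longrightarrow> (\<lambda>u. \<phi> (edge_gen e * u)) \<in> graded_dual"
  using graded_dual_contract by (cases e) (auto simp: contract_def [abs_def])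

text \<open>\<open>curve_rel \<Phi> F\<close>: the functional \<open>\<Phi>\<close> with polynomial values is a combination of functionals with
  polynomial coefficients, and \<open>F\<close> is the same combination of their iterated integrals along the
  curve.\<close>

inductive curve_rel ::
  "(('n::{finite,linorder} p_full uea \<Rightarrow> complex) \<Rightarrow> 'n logpoly) \<Rightarrow> ('n \<Rightarrow> complex poly) \<Rightarrow>
    ('n p_full uea \<Rightarrow> complex poly) \<Rightarrow> (('n \<Rightarrow> nat) \<Rightarrow> complex \<Rightarrow> complex) \<Rightarrow> bool"
  for \<iota> X where
  base: "\<phi> \<in> graded_dual \<Longrightarrow>
    curve_rel \<iota> X (\<lambda>u. smult (\<phi> u) f) (\<lambda>p t. poly f t * \<iota> \<phi> p (curve X t))"
| add: "curve_rel \<iota> X \<Phi> F \<Longrightarrow> curve_rel \<iota> X \<Psi> G \<Longrightarrow> curve_rel \<iota> X (\<lambda>u. \<Phi> u + \<Psi> u) (\<lambda>p t. F p t + G p t)"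

context
  fixes \<iota> :: "('n::{finite,linorder} p_full uea \<Rightarrow> complex) \<Rightarrow> 'n logpoly" and X :: "'n \<Rightarrow> complex poly"
  assumes iim: "iterated_integral_map \<iota>"
begin

lemma curve_rel_zero: "curve_rel \<iota> X (\<lambda>u. 0) (\<lambda>p t. 0)"
  using curve_rel.base [of "coef []" \<iota> X 0] by (simp add: coef_graded_dual)

lemma curve_rel_mult: "curve_rel \<iota> X \<Phi> F \<Longrightarrow> curve_rel \<iota> X (\<lambda>u. g * \<Phi> u) (\<lambda>p t. poly g t * F p t)"
proof (induction rule: curve_rel.induct)
  case (base \<phi> f)
  then show ?case
    using curve_rel.base [OF base, of \<iota> X "g * f"] by (simp add: mult.assoc)
next
  case (add \<Phi> F \<Psi> G)
  then show ?case
    using curve_rel.add [OF add.IH] by (simp add: distrib_left)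
qed

lemma curve_rel_sum:
  "(\<And>e. e \<in> E \<Longrightarrow> curve_rel \<iota> X (\<Phi> e) (F e)) \<Longrightarrow>
    curve_rel \<iota> X (\<lambda>u. \<Sum>e\<in>E. \<Phi> e u) (\<lambda>p t. \<Sum>e\<in>E. F e p t)"
  by (induction E rule: infinite_finite_induct) (simp_all add: curve_rel_zero curve_rel.add)

lemma curve_rel_linear:
  assumes "curve_rel \<iota> X \<Phi> F"
  shows "\<Phi> (u + v) = \<Phi> u + \<Phi> v" "\<Phi> (c *\<^sub>C u) = smult c (\<Phi> u)"
  using assms
  by (induction rule: curve_rel.induct)
    (simp_all add: graded_dual_lin smult_add_left smult_add_right algebra_simps)

abbreviation (input) denom :: "complex poly" where
  "denom \<equiv> \<Prod>e\<in>edges. edge_poly X e"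

abbreviation (input) numer :: "'n edge \<Rightarrow> complex poly" where
  "numer e \<equiv> pderiv (edge_poly X e) * (\<Prod>d\<in>edges - {e}. edge_poly X d)"

text \<open>Differentiation along the curve on the side of the functionals, multiplied by
  \<open>denom\<close> so that the values remain polynomials.\<close>

definition curve_deriv :: "('n p_full uea \<Rightarrow> complex poly) \<Rightarrow> 'n p_full uea \<Rightarrow> complex poly" where
  "curve_deriv \<Phi> u = denom * pderiv (\<Phi> u) + (\<Sum>e\<in>edges. numer e * \<Phi> (edge_gen e * u))"

text \<open>The contribution of d log x_k along the curve, the logarithms being independent
  variables. It vanishes at every parameter where all coefficients of \<open>F\<close> do.\<close>

definition log_part :: "(('n \<Rightarrow> nat) \<Rightarrow> complex \<Rightarrow> complex) \<Rightarrow> ('n \<Rightarrow> nat) \<Rightarrow> complex \<Rightarrow> complex" where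
  "log_part F p t = (\<Sum>k\<in>UNIV. of_nat (p k + 1) * F (p(k := p k + 1)) t * poly (pderiv (X k)) t / poly (X k) t)"

lemma iota_curve_deriv:
  assumes \<phi>: "\<phi> \<in> graded_dual" and t: "t \<in> curve_dom X"
  shows "((\<lambda>t. \<iota> \<phi> p (curve X t)) has_field_derivative
    (\<Sum>e\<in>edges. poly (numer e) t * \<iota> (\<lambda>u. \<phi> (edge_gen e * u)) p (curve X t)) / poly denom t
      - log_part (\<lambda>p t. \<iota> \<phi> p (curve X t)) p t) (at t)"
proof -
  let ?x = "curve X t"
  have x: "?x \<in> punctured"
    using t by (simp add: curve_dom_def)
  have k0: "poly (X k) t \<noteq> 0" for k
    using t by (simp add: curve_dom_iff)
  have e0: "poly (edge_poly X e) t \<noteq> 0" if "e \<in> edges" for e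
    using edge_fun_nonzero [OF that x] by (simp add: edge_fun_curve)
  have holo: "\<iota> \<phi> p \<in> holo_polydisc"
    using iota_logpolys [OF iim \<phi>] by (simp add: logpolys_def)
  have "((\<lambda>t. curve X t $ k) has_field_derivative poly (pderiv (X k)) t) (at t)" for k
    by (simp add: curve_def poly_DERIV)
  from holo_chain [OF holo punctured_polydisc [OF x] this]
  have D: "((\<lambda>t. \<iota> \<phi> p (curve X t)) has_field_derivative
      (\<Sum>k\<in>UNIV. pderiv_at k (\<iota> \<phi> p) ?x * poly (pderiv (X k)) t)) (at t)" .
  have "(\<Sum>k\<in>UNIV. pderiv_at k (\<iota> \<phi> p) ?x * poly (pderiv (X k)) t)
      = (\<Sum>k\<in>UNIV. poly (pderiv (X k)) t * logpoly_deriv k (\<iota> \<phi>) p ?x) - log_part (\<lambda>p t. \<iota> \<phi> p (curve X t)) p t"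
    unfolding log_part_def sum_subtractf [symmetric]
    by (intro sum.cong) (auto simp: logpoly_deriv_def curve_def algebra_simps)
  also have "(\<Sum>k\<in>UNIV. poly (pderiv (X k)) t * logpoly_deriv k (\<iota> \<phi>) p ?x)
      = (\<Sum>e\<in>edges. \<iota> (\<lambda>u. \<phi> (edge_gen e * u)) p ?x * (poly (pderiv (edge_poly X e)) t / poly (edge_poly X e) t))"
  proof -
    have "logpoly_deriv k (\<iota> \<phi>) p ?x = (\<Sum>e\<in>edges. \<iota> (\<lambda>u. \<phi> (edge_gen e * u)) p ?x * dlog_coeff k (edge_fun e) ?x)" for k
      unfolding iota_deriv [OF iim \<phi> x] sum_edges by (simp add: contract_def [abs_def])
    then have "(\<Sum>k\<in>UNIV. poly (pderiv (X k)) t * logpoly_deriv k (\<iota> \<phi>) p ?x)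
        = (\<Sum>k\<in>UNIV. \<Sum>e\<in>edges. \<iota> (\<lambda>u. \<phi> (edge_gen e * u)) p ?x * (poly (pderiv (X k)) t * dlog_coeff k (edge_fun e) ?x))"
      by (simp add: sum_distrib_left mult_ac)
    also have "\<dots> = (\<Sum>e\<in>edges. \<Sum>k\<in>UNIV. \<iota> (\<lambda>u. \<phi> (edge_gen e * u)) p ?x * (poly (pderiv (X k)) t * dlog_coeff k (edge_fun e) ?x))"
      by (rule sum.swap)
    finally show ?thesis
      by (simp only: sum_distrib_left [symmetric] curve_dlog [OF t])
  qed
  also have "\<dots> = (\<Sum>e\<in>edges. poly (numer e) t * \<iota> (\<lambda>u. \<phi> (edge_gen e * u)) p ?x) / poly denom t"
    unfolding sum_divide_distrib
  proof (rule sum.cong)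
    fix e :: "'n edge" assume e: "e \<in> edges"
    have "poly denom t = poly (edge_poly X e) t * poly (\<Prod>d\<in>edges - {e}. edge_poly X d) t"
      by (simp add: prod.remove [OF finite_edges e])
    moreover have "poly (\<Prod>d\<in>edges - {e}. edge_poly X d) t \<noteq> 0"
      using e0 by (simp add: poly_prod finite_edges)
    ultimately show "\<iota> (\<lambda>u. \<phi> (edge_gen e * u)) p ?x * (poly (pderiv (edge_poly X e)) t / poly (edge_poly X e) t)
        = poly (numer e) t * \<iota> (\<lambda>u. \<phi> (edge_gen e * u)) p ?x / poly denom t"
      using e0 [OF e] by (simp add: field_simps)
  qed simp
  finally show ?thesis
    using D by simp
qed

lemma curve_rel_deriv:
  assumes "curve_rel \<iota> X \<Phi> F"
  shows "\<exists>F'. curve_rel \<iota> X (curve_deriv \<Phi>) F' \<and>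
    (\<forall>p. \<forall>t\<in>curve_dom X. (F p has_field_derivative F' p t / poly denom t - log_part F p t) (at t))"
  using assms
proof (induction rule: curve_rel.induct)
  case (base \<phi> f)
  let ?F = "\<lambda>p t. poly f t * \<iota> \<phi> p (curve X t)"
  let ?F' = "\<lambda>p t. poly (denom * pderiv f) t * \<iota> \<phi> p (curve X t)
    + (\<Sum>e\<in>edges. poly (numer e * f) t * \<iota> (\<lambda>u. \<phi> (edge_gen e * u)) p (curve X t))"
  have "curve_rel \<iota> X (\<lambda>u. smult (\<phi> u) (denom * pderiv f) + (\<Sum>e\<in>edges. smult (\<phi> (edge_gen e * u)) (numer e * f))) ?F'"
    by (intro curve_rel.add curve_rel_sum curve_rel.base graded_dual_edge base)
  moreover have "curve_deriv (\<lambda>u. smult (\<phi> u) f)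
      = (\<lambda>u. smult (\<phi> u) (denom * pderiv f) + (\<Sum>e\<in>edges. smult (\<phi> (edge_gen e * u)) (numer e * f)))"
    by (simp add: curve_deriv_def [abs_def] pderiv_smult)
  moreover have "(?F p has_field_derivative ?F' p t / poly denom t - log_part ?F p t) (at t)"
    if t: "t \<in> curve_dom X" for p t
  proof -
    have x: "curve X t \<in> punctured"
      using t by (simp add: curve_dom_def)
    have q0: "poly denom t \<noteq> 0"
      using edge_fun_nonzero [OF _ x] by (simp add: poly_prod edge_fun_curve finite_edges)
    have lp: "log_part ?F p t = poly f t * log_part (\<lambda>p t. \<iota> \<phi> p (curve X t)) p t"
      by (simp add: log_part_def sum_distrib_left mult_ac)
    have F': "?F' p t / poly denom t = poly (pderiv f) t * \<iota> \<phi> p (curve X t)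
        + poly f t * ((\<Sum>e\<in>edges. poly (numer e) t * \<iota> (\<lambda>u. \<phi> (edge_gen e * u)) p (curve X t)) / poly denom t)"
    proof -
      have "(\<Sum>e\<in>edges. poly (numer e * f) t * \<iota> (\<lambda>u. \<phi> (edge_gen e * u)) p (curve X t))
          = poly f t * (\<Sum>e\<in>edges. poly (numer e) t * \<iota> (\<lambda>u. \<phi> (edge_gen e * u)) p (curve X t))"
        unfolding sum_distrib_left by (intro sum.cong) auto
      then show ?thesis
        using q0 unfolding poly_mult [of denom] by (simp add: add_divide_distrib)
    qed
    show ?thesis
      unfolding lp F' by (rule DERIV_cong [OF DERIV_mult [OF poly_DERIV iota_curve_deriv [OF base t]]])
        (simp add: algebra_simps)
  qed
  ultimately show ?case
    by (intro exI [of _ ?F']) auto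
next
  case (add \<Phi> F \<Psi> G)
  then obtain F' G' where
    F': "curve_rel \<iota> X (curve_deriv \<Phi>) F'" "\<forall>p. \<forall>t\<in>curve_dom X. (F p has_field_derivative F' p t / poly denom t - log_part F p t) (at t)" and
    G': "curve_rel \<iota> X (curve_deriv \<Psi>) G'" "\<forall>p. \<forall>t\<in>curve_dom X. (G p has_field_derivative G' p t / poly denom t - log_part G p t) (at t)"
    by blast
  have "curve_deriv (\<lambda>u. \<Phi> u + \<Psi> u) = (\<lambda>u. curve_deriv \<Phi> u + curve_deriv \<Psi> u)"
    by (simp add: curve_deriv_def [abs_def] pderiv_add distrib_left sum.distrib add_ac)
  then have "curve_rel \<iota> X (curve_deriv (\<lambda>u. \<Phi> u + \<Psi> u)) (\<lambda>p t. F' p t + G' p t)"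
    using curve_rel.add [OF F'(1) G'(1)] by simp
  moreover have "((\<lambda>t. F p t + G p t) has_field_derivative
      (F' p t + G' p t) / poly denom t - log_part (\<lambda>p t. F p t + G p t) p t) (at t)" if t: "t \<in> curve_dom X" for p t
  proof (rule DERIV_cong [OF DERIV_add])
    show "(F p has_field_derivative F' p t / poly denom t - log_part F p t) (at t)"
      "(G p has_field_derivative G' p t / poly denom t - log_part G p t) (at t)"
      using F'(2) G'(2) t by blast+
    have "log_part (\<lambda>p t. F p t + G p t) p t = log_part F p t + log_part G p t"
      by (simp add: log_part_def sum.distrib [symmetric] add_divide_distrib [symmetric] distrib_left distrib_right)
    then show "F' p t / poly denom t - log_part F p t + (G' p t / poly denom t - log_part G p t)
        = (F' p t + G' p t) / poly denom t - log_part (\<lambda>p t. F p t + G p t) p t"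
      by (simp add: add_divide_distrib)
  qed
  ultimately show ?case
    by (intro exI [of _ "\<lambda>p t. F' p t + G' p t"]) auto
qed

lemma poly_eq_sum:
  fixes f :: "complex poly"
  assumes "degree f < b"
  shows "poly f t = (\<Sum>j<b. t ^ j * coeff f j)"
proof -
  have "poly f t = (\<Sum>j\<le>degree f. coeff f j * t ^ j)"
    by (rule poly_altdef)
  also have "\<dots> = (\<Sum>j<b. coeff f j * t ^ j)"
    using assms by (intro sum.mono_neutral_left) (auto simp: coeff_eq_0)
  finally show ?thesis
    by (simp add: mult.commute)
qed

text \<open>Collecting powers of t shows that \<open>F\<close> is determined by
  \<open>\<Phi>\<close>, whatever decomposition produced it. The expansion is claimed for every
  length from some bound on, so that two of them can be added.\<close>

lemma curve_rel_coeff: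
  assumes "curve_rel \<iota> X \<Phi> F"
  shows "(\<forall>j. (\<lambda>u. coeff (\<Phi> u) j) \<in> graded_dual) \<and>
    (\<exists>B. \<forall>b\<ge>B. \<forall>p t. F p t = (\<Sum>j<b. t ^ j * \<iota> (\<lambda>u. coeff (\<Phi> u) j) p (curve X t)))"
  using assms
proof (induction rule: curve_rel.induct)
  case (base \<phi> f)
  have eq: "(\<lambda>u. coeff (smult (\<phi> u) f) j) = (\<lambda>u. coeff f j * \<phi> u)" for j
    by (simp add: mult.commute)
  have "poly f t * \<iota> \<phi> p (curve X t) = (\<Sum>j<b. t ^ j * \<iota> (\<lambda>u. coeff f j * \<phi> u) p (curve X t))"
    if "b \<ge> Suc (degree f)" for b p t
    using that by (subst poly_eq_sum [of f b]) (simp_all add: iota_scale [OF iim base] sum_distrib_right mult.assoc)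
  then show ?case
    unfolding eq using graded_dual_scale [OF base] by blast
next
  case (add \<Phi> F \<Psi> G)
  then obtain B C where
    B: "\<And>b p t. b \<ge> B \<Longrightarrow> F p t = (\<Sum>j<b. t ^ j * \<iota> (\<lambda>u. coeff (\<Phi> u) j) p (curve X t))" and
    C: "\<And>b p t. b \<ge> C \<Longrightarrow> G p t = (\<Sum>j<b. t ^ j * \<iota> (\<lambda>u. coeff (\<Psi> u) j) p (curve X t))"
    by blast
  have gd: "(\<lambda>u. coeff (\<Phi> u) j) \<in> graded_dual" "(\<lambda>u. coeff (\<Psi> u) j) \<in> graded_dual" for j
    using add.IH by blast+
  have "F p t + G p t = (\<Sum>j<b. t ^ j * \<iota> (\<lambda>u. coeff (\<Phi> u + \<Psi> u) j) p (curve X t))" if "b \<ge> max B C" for b p t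
    using that by (simp add: B [of b] C [of b] iota_add [OF iim gd] sum.distrib distrib_left)
  moreover have "(\<lambda>u. coeff (\<Phi> u + \<Psi> u) j) \<in> graded_dual" for j
    using graded_dual_add [OF gd] by simp
  ultimately show ?case
    by blast
qed

lemma curve_rel_constant:
  assumes rel: "curve_rel \<iota> X \<Phi> F" and \<Phi>: "\<And>u. \<Phi> u = smult (counit u) g" and t: "t \<in> curve_dom X"
  shows "F (\<lambda>_. 0) t = poly g t"
proof -
  obtain B where B: "\<And>b p t. b \<ge> B \<Longrightarrow> F p t = (\<Sum>j<b. t ^ j * \<iota> (\<lambda>u. coeff (\<Phi> u) j) p (curve X t))"
    using curve_rel_coeff [OF rel] by blast
  let ?b = "max B (Suc (degree g))"
  have eq: "(\<lambda>u. coeff (\<Phi> u) j) = (\<lambda>u. coeff g j * coef [] u)" for j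
    by (simp add: \<Phi> coef_Nil mult.commute)
  have "curve X t \<in> polydisc"
    using t by (simp add: curve_dom_def punctured_polydisc)
  then have "\<iota> (coef []) (\<lambda>_. 0) (curve X t) = 1"
    by (simp add: coef_Nil iota_counit [OF iim] of_holo_def)
  then have "F (\<lambda>_. 0) t = (\<Sum>j<?b. t ^ j * coeff g j)"
    by (simp add: B [of ?b] eq iota_scale [OF iim coef_graded_dual])
  then show ?thesis
    by (subst poly_eq_sum [of g ?b]) auto
qed

text \<open>Induction on the degree bound d, and for fixed d on the number of words of top degree
  with nonzero value. In degree 0 a polynomial vanishes on a nonempty open set.\<close>

lemma curve_rel_injective:
  assumes sep: "separating X"
    and "curve_rel \<iota> X \<Phi> F" "\<And>p t. t \<in> curve_dom X \<Longrightarrow> F p t = 0"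
    and "\<And>w. w \<in> lists edges \<Longrightarrow> length w > d \<Longrightarrow> \<Phi> (edge_word w) = 0"
    and "w \<in> lists edges"
  shows "\<Phi> (edge_word w) = 0"
  using assms(2-)
proof (induction d arbitrary: \<Phi> F w)
  case 0
  interpret \<Phi>: Vector_Spaces.linear scaleC smult \<Phi>
  proof -
    interpret vector_space "smult :: complex \<Rightarrow> complex poly \<Rightarrow> complex poly"
      by unfold_locales (simp_all add: smult_add_right smult_add_left)
    show "Vector_Spaces.linear scaleC smult \<Phi>"
      by unfold_locales (simp_all add: curve_rel_linear [OF 0(1)])
  qed
  have \<Phi>: "\<Phi> u = smult (counit u) (\<Phi> 1)" for u
    using edge_word_span [of u]
  proof (induction rule: cvec.span_induct_alt)
    case base
    then show ?case by (simp add: \<Phi>.zero counit_simps)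
  next
    case (step c x y)
    then obtain v where v: "v \<in> lists edges" "x = edge_word v"
      by blast
    have "\<Phi> (edge_word v) = smult (counit (edge_word v)) (\<Phi> 1)"
    proof (cases v)
      case (Cons e v')
      then have "\<Phi> (edge_word v) = 0"
        using 0(3) [OF v(1)] by simp
      moreover have "counit (edge_word v) = 0"
        by (cases e) (simp_all add: Cons counit_simps)
      ultimately show ?thesis by simp
    qed (simp add: counit_simps)
    then show ?case
      using step.IH v by (simp add: \<Phi>.add \<Phi>.scale counit_simps smult_add_left)
  qed
  have "poly (\<Phi> 1) t = 0" if "t \<in> curve_dom X" for t
    using curve_rel_constant [OF 0(1) \<Phi> that] 0(2) [OF that] by simp
  then have "curve_dom X \<subseteq> {t. poly (\<Phi> 1) t = 0}"
    by blast
  \<comment> \<open>The domain is open and contains 0, where all coordinates are 1/2.\<close>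
  moreover have "infinite (curve_dom X)"
  proof -
    have half: "poly (X k) 0 = 1 / 2" for k
      using sep by (simp add: separating_def)
    have "0 \<in> curve_dom X"
      unfolding curve_dom_iff half by (simp add: norm_divide)
    then show ?thesis
      using open_curve_dom finite_imp_not_open by blast
  qed
  ultimately have "\<Phi> 1 = 0"
    using poly_roots_finite [of "\<Phi> 1"] finite_subset by blast
  then show ?case
    by (subst \<Phi>) simp
next
  case (Suc d)
  have half: "poly (X k) 0 = 1 / 2" for k
    using sep by (simp add: separating_def)
  have enz: "edge_poly X e \<noteq> 0" if "e \<in> edges" for e
    using edge_poly_nonzero [OF half that] .
  have Q: "denom \<noteq> 0"
    using enz by (simp add: finite_edges)
  have finW: "finite {w \<in> lists (edges :: 'n edge set). length w = Suc d}"
  proof -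
    have "{w \<in> lists (edges :: 'n edge set). length w = Suc d} = {w. set w \<subseteq> edges \<and> length w = Suc d}"
      by auto
    then show ?thesis
      by (simp add: finite_lists_length_eq finite_edges)
  qed
  have "\<forall>w\<in>lists edges. \<Phi> (edge_word w) = 0"
    using Suc.prems(1-3)
  proof (induction \<Phi> arbitrary: F rule: measure_induct_rule [of "\<lambda>\<Phi>. card {w \<in> lists edges. length w = Suc d \<and> \<Phi> (edge_word w) \<noteq> 0}"])
    case (less \<Phi>)
    note rel = less.prems(1) and zero = less.prems(2) and high = less.prems(3)
    show ?case
    proof (cases "\<forall>w\<in>lists edges. length w = Suc d \<longrightarrow> \<Phi> (edge_word w) = 0")
      case True
      have "\<Phi> (edge_word w) = 0" if "w \<in> lists edges" "length w > d" for w
        using that True high [of w] by (cases "length w = Suc d") auto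
      then show ?thesis
        using Suc.IH [OF rel zero] by blast
    next
      case False
      then obtain u0 where u0: "u0 \<in> lists edges" "length u0 = Suc d" "\<Phi> (edge_word u0) \<noteq> 0"
        by blast
      define f where "f = \<Phi> (edge_word u0)"
      have f: "f \<noteq> 0"
        using u0(3) by (simp add: f_def)
      obtain F' where F': "curve_rel \<iota> X (curve_deriv \<Phi>) F'"
        "\<And>p t. t \<in> curve_dom X \<Longrightarrow> (F p has_field_derivative F' p t / poly denom t - log_part F p t) (at t)"
        using curve_rel_deriv [OF rel] by blast
      have F'0: "F' p t = 0" if t: "t \<in> curve_dom X" for p t
      proof -
        have "log_part F p t = 0"
          by (simp add: log_part_def zero [OF t])
        then have "(F p has_field_derivative F' p t / poly denom t) (at t)"
          using F'(2) [OF t, of p] by simp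
        moreover have "(F p has_field_derivative 0) (at t)"
          by (rule has_field_derivative_transform_within_open [OF DERIV_const open_curve_dom t]) (simp add: zero)
        ultimately have "F' p t / poly denom t = 0"
          by (rule DERIV_unique)
        moreover have "poly denom t \<noteq> 0"
          using edge_fun_nonzero [where x = "curve X t"] t
          by (simp add: poly_prod edge_fun_curve curve_dom_def finite_edges)
        ultimately show ?thesis
          by simp
      qed
      \<comment> \<open>Differentiating and eliminating \<open>f\<close> leaves a relation with fewer top-degree terms, which is
        trivial by induction.  So the top-degree values are constant multiples of \<open>f\<close>, and in degree
        \<open>d\<close> a constant combination of the logarithmic forms is the derivative of a rational function.\<close>
      define \<Psi> where "\<Psi> u = f * curve_deriv \<Phi> u + (- (denom * pderiv f)) * \<Phi> u" for u
      define G where "G p t = poly f t * F' p t + poly (- (denom * pderiv f)) t * F p t" for p t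
      have relG: "curve_rel \<iota> X \<Psi> G"
        unfolding \<Psi>_def G_def by (intro curve_rel.add curve_rel_mult F'(1) rel)
      have G0: "G p t = 0" if "t \<in> curve_dom X" for p t
        using that by (simp add: G_def F'0 zero)
      have \<Psi>top: "\<Psi> (edge_word w) = denom * (f * pderiv (\<Phi> (edge_word w)) - pderiv f * \<Phi> (edge_word w))"
        if "w \<in> lists edges" "length w > d" for w
      proof -
        have "\<Phi> (edge_gen e * edge_word w) = 0" if "e \<in> edges" for e
          using high [of "e # w"] that \<open>w \<in> lists edges\<close> \<open>length w > d\<close> by simp
        then have "curve_deriv \<Phi> (edge_word w) = denom * pderiv (\<Phi> (edge_word w))"
          by (simp add: curve_deriv_def)
        then show ?thesis
          by (simp add: \<Psi>_def algebra_simps)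
      qed
      have \<Psi>high: "\<Psi> (edge_word w) = 0" if "w \<in> lists edges" "length w > Suc d" for w
        using that high [of w] \<Psi>top [of w] by simp
      have "card {w \<in> lists edges. length w = Suc d \<and> \<Psi> (edge_word w) \<noteq> 0}
          < card {w \<in> lists edges. length w = Suc d \<and> \<Phi> (edge_word w) \<noteq> 0}"
      proof (rule psubset_card_mono)
        show "finite {w \<in> lists edges. length w = Suc d \<and> \<Phi> (edge_word w) \<noteq> 0}"
          using finW by (rule rev_finite_subset) auto
        have "\<Psi> (edge_word u0) = 0"
          using \<Psi>top [of u0] u0 by (simp add: f_def mult.commute)
        moreover have "\<Phi> (edge_word w) = 0 \<Longrightarrow> \<Psi> (edge_word w) = 0" if "w \<in> lists edges" "length w = Suc d" for w
          using \<Psi>top [of w] that by simp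
        ultimately show "{w \<in> lists edges. length w = Suc d \<and> \<Psi> (edge_word w) \<noteq> 0}
          \<subset> {w \<in> lists edges. length w = Suc d \<and> \<Phi> (edge_word w) \<noteq> 0}"
          using u0 by blast
      qed
      from less.IH [OF this relG G0 \<Psi>high]
      have \<Psi>0: "\<Psi> (edge_word w) = 0" if "w \<in> lists edges" for w
        using that by blast
      have "\<exists>c. \<Phi> (edge_word w) = smult c f" if "w \<in> lists edges" "length w = Suc d" for w
      proof -
        have "f * pderiv (\<Phi> (edge_word w)) = pderiv f * \<Phi> (edge_word w)"
          using \<Psi>top [of w] \<Psi>0 [of w] that Q by simp
        then show ?thesis
          using pderiv_proportional [OF f] by metis
      qed
      then obtain c where c: "\<And>w. w \<in> lists edges \<Longrightarrow> length w = Suc d \<Longrightarrow> \<Phi> (edge_word w) = smult (c w) f"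
        by metis
      \<comment> \<open>The relation for \<open>\<Psi>\<close> is read at the tail of
        \<open>u0\<close>: its value there involves all \<open>c (e # v)\<close>, among them the
        constant belonging to \<open>u0\<close>.\<close>
      obtain e0 v where v: "u0 = e0 # v"
        using u0(2) by (cases u0) auto
      have v': "v \<in> lists edges" "length v = d" "e0 \<in> edges"
        using u0 v by auto
      let ?g = "\<Phi> (edge_word v)"
      have "f * f * (\<Sum>e\<in>edges. smult (c (e # v)) (numer e)) = (pderiv (- ?g) * f - (- ?g) * pderiv f) * denom"
      proof -
        have "(\<Sum>e\<in>edges. numer e * \<Phi> (edge_gen e * edge_word v)) = f * (\<Sum>e\<in>edges. smult (c (e # v)) (numer e))"
          unfolding sum_distrib_left
        proof (rule sum.cong)
          fix e :: "'n edge" assume "e \<in> edges"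
          then show "numer e * \<Phi> (edge_gen e * edge_word v) = f * smult (c (e # v)) (numer e)"
            using c [of "e # v"] v' by (simp add: mult_ac)
        qed simp
        then have "\<Psi> (edge_word v) = f * (denom * pderiv ?g + f * (\<Sum>e\<in>edges. smult (c (e # v)) (numer e))) - denom * pderiv f * ?g"
          by (simp only: \<Psi>_def curve_deriv_def mult_minus_left diff_conv_add_uminus)
        then have "f * (denom * pderiv ?g + f * (\<Sum>e\<in>edges. smult (c (e # v)) (numer e))) - denom * pderiv f * ?g = 0"
          using \<Psi>0 [OF v'(1)] by simp
        then show ?thesis
          by (simp only: pderiv_minus) algebra
      qed
      from logarithmic_residues [OF finite_edges enz f this]
      have "\<forall>t. (\<Sum>e\<in>edges. c (e # v) * of_int (ord_at t (edge_poly X e))) = 0"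
        by blast
      then have "\<forall>e\<in>edges. c (e # v) = 0"
        using sep unfolding separating_def by (elim conjE allE [of _ "\<lambda>e. c (e # v)"]) blast
      then have "\<Phi> (edge_word u0) = 0"
        using c [OF u0(1,2)] v v' by simp
      then show ?thesis
        using u0(3) by simp
    qed
  qed
  then show ?case
    using Suc.prems(4) by blast
qed

end

lemma edge_word_deg: "edge_word w \<in> U_deg (length w)"
proof (induction w)
  case Nil
  then show ?case by (auto simp: U_deg_def intro!: cvec.span_base)
next
  case (Cons e w)
  then show ?case by (cases e) (auto intro: U_deg_mult)
qed

text \<open>A functional of the graded dual has bounded degree, so the independence statement
  applies to it with the constant polynomial 1 as coefficient; words in the edge generators
  span.\<close>

lemma iota_injective:
  fixes \<iota> :: "('n::{finite,linorder} p_full uea \<Rightarrow> complex) \<Rightarrow> 'n logpoly"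
  assumes iim: "iterated_integral_map \<iota>" and \<phi>: "\<phi> \<in> graded_dual" and zero: "\<iota> \<phi> = (\<lambda>p x. 0)"
  shows "\<phi> u = 0"
proof -
  obtain X :: "'n \<Rightarrow> complex poly" where X: "separating X"
    using separating_exists by blast
  have "finite {k. \<exists>u\<in>U_deg k. \<phi> u \<noteq> 0}"
    using \<phi> by (simp add: graded_dual_def)
  then obtain d where d: "\<And>k. \<exists>u\<in>U_deg k. \<phi> u \<noteq> 0 \<Longrightarrow> k \<le> d"
    by (auto simp: finite_nat_set_iff_bounded_le)
  have high: "smult (\<phi> (edge_word w)) 1 = 0" if "length w > d" for w :: "'n edge list"
    using d [of "length w"] edge_word_deg [of w] that by force
  have "smult (\<phi> (edge_word w)) 1 = 0" if "w \<in> lists edges" for w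
    by (rule curve_rel_injective [OF iim X curve_rel.base [OF \<phi>]]) (use zero high that in auto)
  then have w: "\<phi> (edge_word w) = 0" if "w \<in> lists edges" for w
    using that by simp
  show ?thesis
    using edge_word_span [of u]
  proof (induction rule: cvec.span_induct_alt)
    case (step c x y)
    then show ?case
      using w by (auto simp: graded_dual_lin [OF \<phi>])
  qed (simp add: graded_dual_lin [OF \<phi>])
qed

text \<open>\<open>iota_coef\<close> supplies a functional with the required integral, and
  injectivity makes the definite description unique. The sign has one factor for each letter
  X_i\<beta>.\<close>

lemma formal_polylog_eq:
  fixes \<iota> :: "('n::{finite,linorder} p_full uea \<Rightarrow> complex) \<Rightarrow> 'n logpoly"
  assumes iim: "iterated_integral_map \<iota>" and s: "beta_section (s :: 'n p_sub \<Rightarrow> 'n p_full)" and idx: "polylog_index a \<kappa>"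
  shows "formal_polylog \<iota> a \<kappa> = (\<lambda>u. (- 1) ^ length a * coef (index_word a \<kappa>) u)"
  unfolding formal_polylog_def
proof (rule the_equality)
  let ?\<phi> = "\<lambda>u. (- 1) ^ length a * coef (index_word a \<kappa>) u"
  have gd: "?\<phi> \<in> graded_dual"
    by (rule graded_dual_scale [OF coef_graded_dual])
  have eq: "\<iota> ?\<phi> = of_holo (polylog a \<kappa>)"
    unfolding iota_scale [OF iim coef_graded_dual] iota_coef [OF iim s adm_index_word [OF idx]]
    by (auto simp: of_holo_def fun_eq_iff polylog_eq_word_series [OF idx])
  then show "?\<phi> \<in> graded_dual \<and> \<iota> ?\<phi> = of_holo (polylog a \<kappa>)"
    using gd by blast
  fix \<psi> assume \<psi>: "\<psi> \<in> graded_dual \<and> \<iota> \<psi> = of_holo (polylog a \<kappa>)"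
  then have gd': "(\<lambda>u. (- 1) * \<psi> u) \<in> graded_dual"
    using graded_dual_scale by blast
  have "\<iota> (\<lambda>u. ?\<phi> u + (- 1) * \<psi> u) = (\<lambda>p x. 0)"
    using \<psi> unfolding iota_add [OF iim gd gd'] eq iota_scale [OF iim conjunct1 [OF \<psi>], of "- 1"] by simp
  then have "?\<phi> u + (- 1) * \<psi> u = 0" for u
    using iota_injective [OF iim graded_dual_add [OF gd gd']] by blast
  then show "\<psi> = ?\<phi>"
    by (simp add: fun_eq_iff)
qed

theorem theorem2p1:
  fixes s :: "'n::{finite,linorder} p_sub \<Rightarrow> 'n p_full"
    and \<iota> :: "('n p_full uea \<Rightarrow> complex) \<Rightarrow> 'n logpoly"
  assumes "beta_section s"
    and "iterated_integral_map \<iota>"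
  shows "left_ideal (polylog_perp \<iota>) \<and>
    polylog_perp \<iota> =
      span_prod UNIV (range (\<lambda>y. emb (s y)))
      + span_prod UNIV {XU be om}
      + (\<Sum>(i, j)\<in>{(i, j). i < j}.
           span_prod (gen_ideal (XU (pt i) be)) (gen_ideal (XU (pt j) be)))"
proof -
  have "polylog_perp \<iota> = {u. \<forall>w. adm w \<longrightarrow> coef w u = 0}"
  proof (intro equalityI subsetI CollectI allI impI)
    fix u :: "'n p_full uea" and w assume u: "u \<in> polylog_perp \<iota>" and "adm (w :: 'n option list)"
    then obtain a \<kappa> where "polylog_index a \<kappa>" "w = index_word a \<kappa>"
      using index_word_surj by blast
    then show "coef w u = 0"
      using u formal_polylog_eq [OF assms(2,1)] by (auto simp: polylog_perp_def)
  next
    fix u :: "'n p_full uea" assume u: "u \<in> {u. \<forall>w. adm w \<longrightarrow> coef w u = 0}"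
    have "formal_polylog \<iota> a \<kappa> u = 0" if "polylog_index a \<kappa>" for a \<kappa>
      using u adm_index_word [OF that] by (simp add: formal_polylog_eq [OF assms(2,1) that])
    then show "u \<in> polylog_perp \<iota>"
      by (simp add: polylog_perp_def)
  qed
  also have "\<dots> = polylog_ideal s"
    using polylog_ideal_eq [OF assms(1)] by simp
  finally have eq: "polylog_perp \<iota> = polylog_ideal s" .
  show ?thesis
    using left_ideal_polylog_ideal [of s] unfolding eq by (simp add: polylog_ideal_def)
qed

end
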